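(* Let $A$ be a left-handed noncommutative frame, and let $(Y,\mathcal{F})$ be the dual of $A$ in $\mathbf{Sh}(\mathsf{Loc}_d)$; in particular $\mathcal{O}(Y)=A/\mathcal{D}$. Then the following are equivalent: (1) $A$ is spatial; (2) $Y$ is spatial and $\mathcal{F}\cong k_*\mathcal{E}$ for some sheaf $\mathcal{E}$ on $Y_f$, where $k:Y_f\to Y_d$ is the canonical inclusion. In this case, $A\cong H(Y,\mathcal{E})$.
   Context: **Skew lattices.** A skew lattice is a set $A$ with idempotent associative operations $\wedge,\vee$ satisfying $x\wedge(x\vee y)=x=x\vee(x\wedge y)$ and $(x\wedge y)\vee y=y=(x\vee y)\wedge y$. Natural partial order: $a\le b$ iff $a\wedge b=b\wedge a=a$. Green's relation: $a\,\mathcal{D}\,b$ iff $a\wedge b\wedge a=a$ and $b\wedge a\wedge b=b$; it is a congruence, and $A/\mathcal{D}$ is a lattice (the commutative shadow). $A$ is left-handed if $x\wedge y\wedge x=x\wedge y$ holds identically; strongly distributive if $(x\vee y)\wedge z=(x\wedge z)\vee(y\wedge z)$ and $x\wedge(y\vee z)=(x\wedge y)\vee(x\wedge z)$ hold identically. A skew lattice with $0$ has a distinguished element $0$ with $x\vee 0=x=0\vee x$ for all $x$. A commuting subset is a nonempty subset $\{x_i\}_{i\in I}$ with $x_i\wedge x_j=x_j\wedge x_i$ and $x_i\vee x_j=x_j\vee x_i$ for all $i,j$. $A$ is join complete if all commuting subsets have suprema for the natural partial order. A noncommutative frame is a strongly distributive, join complete skew lattice $A$ with $0$ such that $(\bigvee_i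 x_i)\wedge y=\bigvee_i(x_i\wedge y)$ and $x\wedge(\bigvee_i y_i)=\bigvee_i(x\wedge y_i)$ for all $x,y\in A$ and all commuting subsets $\{x_i\},\{y_i\}$; then $A/\mathcal{D}$ is a frame. A morphism of noncommutative frames preserves $\wedge$, $\vee$, $0$, suprema of commuting subsets, and the maximal $\mathcal{D}$-class. **Spatiality.** For a topological space $Y$, $Y_f$ is the set $Y$ with the front topology, with basis the locally closed subsets of $Y$. For $\mathcal{E}$ a sheaf on $Y_f$ with $\mathcal{E}(Y_f)\neq\varnothing$, $H(Y,\mathcal{E})$ is the left-handed noncommutative frame of pairs $(U,s)$ with $U\subseteq Y$ open in the original topology and $s\in\mathcal{E}(U)$, with $(U,s)\wedge(V,t)=(U\cap V,s|_{U\cap V})$ and $(U,s)\vee(V,t)=(U\cup V,\,s|_{U-V}\cup t)$, where $s|_{U-V}\cup t$ is the unique section over $U\cup V$ restricting to $s|_{U-V}$ on $U-V$ and to $t$ on $V$. A left-handed noncommutative frame is spatial if it is isomorphic to some such $H(Y,\mathcal{E})$. A locale is spatial if it is the underlying locale of a topological space; a spatial locale $Y$ is identified with the sober space $\mathrm{pt}(Y)$, so that $Y_f$ makes sense. **Dissolution locale.** For a locale $Y$ with frame $L=\mathcal{O}(Y)$, $N(L)$ is the frame of nuclei on $L$: maps $\nu:L\to L$ with $a\le\nu(a)$, $\nu(a\wedge b)=\nu(a)\wedge\nu(b)$, $\nu(\nu(a))=\nu(a)$, ordered pointwise. The dissolution locale $Y_d$ is the locale with $\mathcal{O}(Y_d)=N(L)$.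 The frame embedding $L\to N(L)$, $a\mapsto\nu_a$, $\nu_a(b)=a\vee b$, defines $\delta:Y_d\to Y$; each $\nu_a$ is complemented, and any frame morphism $\phi:L\to B$ with all $\phi(a)$ complemented extends uniquely to a frame morphism $N(L)\to B$. If $Y$ is a sober space, applying this to the inclusion $\mathcal{O}(Y)\to\mathcal{O}(Y_f)$ gives a locale morphism $k:Y_f\to Y_d$ with $\delta\circ k$ the identity-on-points map $Y_f\to Y$; it is known that $k$ identifies $Y_f$ with $\mathrm{pt}(Y_d)$, the largest spatial sublocale of $Y_d$. **The duality (known when reading this statement).** $\mathbf{Sh}(\mathsf{Loc}_d)$ has objects the pairs $(Y,\mathcal{F})$ with $Y$ a locale and $\mathcal{F}$ a sheaf on $Y_d$ with $\mathcal{F}(Y_d)\ne\varnothing$, and morphisms $(Y,\mathcal{F})\to(Y',\mathcal{F}')$ the pairs $(f,\lambda)$ with $f:Y\to Y'$ a locale morphism and $\lambda:\mathcal{F}'\to g_*\mathcal{F}$, where $g:Y_d\to Y'_d$ is induced by $f$. There is a dual equivalence between $\mathbf{Sh}(\mathsf{Loc}_d)$ and the category of left-handed noncommutative frames, sending $(Y,\mathcal{F})$ to the noncommutative frame of pairs $(U,s)$ with $U\in\mathcal{O}(Y)$, $s\in\mathcal{F}(\delta^{-1}(U))$, with $(U,s)\wedge(V,t)=(U\cap V,s|_{U\cap V})$ and $(U,s)\vee(V,t)=(U\cup V,s|_{U-V}\cup t)$ (the section over $\delta^{-1}(U\cup V)$ restricting to $s$ on $\delta^{-1}(U)-\delta^{-1}(V)$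 and to $t$ on $\delta^{-1}(V)$). The dual of $A$ is the pair $(Y,\mathcal{F})$, unique up to isomorphism, sent to (a noncommutative frame isomorphic to) $A$. *)

theory Defs
  imports "HOL-Algebra.Complete_Lattice" "HOL-Analysis.Abstract_Topology"
begin

record 'a skew_lattice = "'a partial_object" +
  smeet :: "['a, 'a] \<Rightarrow> 'a" (infixl "\<curlywedge>\<index>" 70)
  sjoin :: "['a, 'a] \<Rightarrow> 'a" (infixl "\<curlyvee>\<index>" 65)
  szero :: 'a

locale skew_lattice =
  fixes A :: "('a, 'b) skew_lattice_scheme" (structure)
  assumes smeet_closed: "\<lbrakk>x \<in> carrier A; y \<in> carrier A\<rbrakk> \<Longrightarrow> x \<curlywedge> y \<in> carrier A"
    and sjoin_closed: "\<lbrakk>x \<in> carrier A; y \<in> carrier A\<rbrakk> \<Longrightarrow> x \<curlyvee> y \<in> carrier A"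
    and smeet_idem: "x \<in> carrier A \<Longrightarrow> x \<curlywedge> x = x"
    and sjoin_idem: "x \<in> carrier A \<Longrightarrow> x \<curlyvee> x = x"
    and smeet_assoc: "\<lbrakk>x \<in> carrier A; y \<in> carrier A; z \<in> carrier A\<rbrakk>
          \<Longrightarrow> (x \<curlywedge> y) \<curlywedge> z = x \<curlywedge> (y \<curlywedge> z)"
    and sjoin_assoc: "\<lbrakk>x \<in> carrier A; y \<in> carrier A; z \<in> carrier A\<rbrakk>
          \<Longrightarrow> (x \<curlyvee> y) \<curlyvee> z = x \<curlyvee> (y \<curlyvee> z)"
    and absorb1: "\<lbrakk>x \<in> carrier A; y \<in> carrier A\<rbrakk> \<Longrightarrow> x \<curlywedge> (x \<curlyvee> y) = x"
    and absorb2: "\<lbrakk>x \<in> carrier A; y \<in> carrier A\<rbrakk> \<Longrightarrow> x \<curlyvee> (x \<curlywedge> y) = x"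
    and absorb3: "\<lbrakk>x \<in> carrier A; y \<in> carrier A\<rbrakk> \<Longrightarrow> (x \<curlywedge> y) \<curlyvee> y = y"
    and absorb4: "\<lbrakk>x \<in> carrier A; y \<in> carrier A\<rbrakk> \<Longrightarrow> (x \<curlyvee> y) \<curlywedge> y = y"

definition natural_order :: "('a, 'b) skew_lattice_scheme \<Rightarrow> 'a gorder" where
  "natural_order A = \<lparr>carrier = carrier A, eq = (=),
     le = (\<lambda>a b. a \<curlywedge>\<^bsub>A\<^esub> b = a \<and> b \<curlywedge>\<^bsub>A\<^esub> a = a)\<rparr>"

definition is_supremum :: "('a, 'b) skew_lattice_scheme \<Rightarrow> 'a set \<Rightarrow> 'a \<Rightarrow> bool" where
  "is_supremum A S s \<longleftrightarrow> least (natural_order A) s (Upper (natural_order A) S)"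

definition commuting :: "('a, 'b) skew_lattice_scheme \<Rightarrow> 'a set \<Rightarrow> bool" where
  "commuting A S \<longleftrightarrow> S \<noteq> {} \<and> S \<subseteq> carrier A \<and>
     (\<forall>x\<in>S. \<forall>y\<in>S. x \<curlywedge>\<^bsub>A\<^esub> y = y \<curlywedge>\<^bsub>A\<^esub> x \<and> x \<curlyvee>\<^bsub>A\<^esub> y = y \<curlyvee>\<^bsub>A\<^esub> x)"

definition green_D :: "('a, 'b) skew_lattice_scheme \<Rightarrow> ('a \<times> 'a) set" where
  "green_D A = {(a, b). a \<in> carrier A \<and> b \<in> carrier A \<and>
     a \<curlywedge>\<^bsub>A\<^esub> b \<curlywedge>\<^bsub>A\<^esub> a = a \<and> b \<curlywedge>\<^bsub>A\<^esub> a \<curlywedge>\<^bsub>A\<^esub> b = b}"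

text \<open>The quotient lattice by Green's relation, ordered by \<open>X \<le> Y\<close> iff \<open>X \<and> Y = X\<close>; the
  meet of two classes is the class of \<open>x \<curlywedge> y\<close> for any representatives.\<close>

definition commutative_shadow :: "('a, 'b) skew_lattice_scheme \<Rightarrow> 'a set gorder" where
  "commutative_shadow A = \<lparr>carrier = carrier A // green_D A, eq = (=),
     le = (\<lambda>X Y. \<exists>x\<in>X. \<exists>y\<in>Y. x \<curlywedge>\<^bsub>A\<^esub> y \<in> X)\<rparr>"

locale nc_frame = skew_lattice +
  assumes smeet_distrib_right: "\<lbrakk>x \<in> carrier A; y \<in> carrier A; z \<in> carrier A\<rbrakk>
          \<Longrightarrow> (x \<curlyvee> y) \<curlywedge> z = (x \<curlywedge> z) \<curlyvee> (y \<curlywedge> z)"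
    and smeet_distrib_left: "\<lbrakk>x \<in> carrier A; y \<in> carrier A; z \<in> carrier A\<rbrakk>
          \<Longrightarrow> x \<curlywedge> (y \<curlyvee> z) = (x \<curlywedge> y) \<curlyvee> (x \<curlywedge> z)"
    and zero_closed: "szero A \<in> carrier A"
    and zero_right: "x \<in> carrier A \<Longrightarrow> x \<curlyvee> szero A = x"
    and zero_left: "x \<in> carrier A \<Longrightarrow> szero A \<curlyvee> x = x"
    and join_complete: "commuting A S \<Longrightarrow> \<exists>s. is_supremum A S s"
    and sup_smeet: "\<lbrakk>commuting A S; is_supremum A S s; y \<in> carrier A\<rbrakk>
          \<Longrightarrow> is_supremum A ((\<lambda>x. x \<curlywedge> y) ` S) (s \<curlywedge> y)"
    and smeet_sup: "\<lbrakk>commuting A S; is_supremum A S s; x \<in> carrier A\<rbrakk>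
          \<Longrightarrow> is_supremum A ((\<lambda>y. x \<curlywedge> y) ` S) (x \<curlywedge> s)"

locale left_handed_nc_frame = nc_frame +
  assumes left_handed: "\<lbrakk>x \<in> carrier A; y \<in> carrier A\<rbrakk> \<Longrightarrow> x \<curlywedge> y \<curlywedge> x = x \<curlywedge> y"

text \<open>In \<open>A/\<D>\<close> the class of \<open>b\<close> is below that of \<open>a\<close> iff \<open>b \<curlywedge> a \<curlywedge> b = b\<close>.\<close>

definition maximal_D_class :: "('a, 'b) skew_lattice_scheme \<Rightarrow> 'a set" where
  "maximal_D_class A = {a \<in> carrier A. \<forall>b\<in>carrier A. b \<curlywedge>\<^bsub>A\<^esub> a \<curlywedge>\<^bsub>A\<^esub> b = b}"

definition nc_frame_hom ::
    "('a, 'c) skew_lattice_scheme \<Rightarrow> ('b, 'd) skew_lattice_scheme \<Rightarrow> ('a \<Rightarrow> 'b) \<Rightarrow> bool" where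
  "nc_frame_hom A B f \<longleftrightarrow>
     f \<in> carrier A \<rightarrow> carrier B \<and>
     (\<forall>x\<in>carrier A. \<forall>y\<in>carrier A. f (x \<curlywedge>\<^bsub>A\<^esub> y) = f x \<curlywedge>\<^bsub>B\<^esub> f y) \<and>
     (\<forall>x\<in>carrier A. \<forall>y\<in>carrier A. f (x \<curlyvee>\<^bsub>A\<^esub> y) = f x \<curlyvee>\<^bsub>B\<^esub> f y) \<and>
     f (szero A) = szero B \<and>
     (\<forall>S s. commuting A S \<and> is_supremum A S s \<longrightarrow> is_supremum B (f ` S) (f s)) \<and>
     f ` maximal_D_class A \<subseteq> maximal_D_class B"

definition nc_frame_iso ::
    "('a, 'c) skew_lattice_scheme \<Rightarrow> ('b, 'd) skew_lattice_scheme \<Rightarrow> bool" where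
  "nc_frame_iso A B \<longleftrightarrow> (\<exists>f g. nc_frame_hom A B f \<and> nc_frame_hom B A g \<and>
     (\<forall>x\<in>carrier A. g (f x) = x) \<and> (\<forall>y\<in>carrier B. f (g y) = y))"

text \<open>A locale \<open>Y\<close> is represented by its frame \<open>\<O>(Y)\<close>, and a locale morphism by the
  frame morphism in the opposite direction.\<close>

locale frame = complete_lattice +
  assumes frame_distrib: "\<lbrakk>x \<in> carrier L; S \<subseteq> carrier L\<rbrakk>
    \<Longrightarrow> x \<sqinter> (\<Squnion>S) = \<Squnion>((\<lambda>y. x \<sqinter> y) ` S)"

definition frame_hom :: "('a, 'c) gorder_scheme \<Rightarrow> ('b, 'd) gorder_scheme \<Rightarrow> ('a \<Rightarrow> 'b) \<Rightarrow> bool" where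
  "frame_hom L M h \<longleftrightarrow>
     h \<in> carrier L \<rightarrow> carrier M \<and>
     h \<top>\<^bsub>L\<^esub> = \<top>\<^bsub>M\<^esub> \<and>
     (\<forall>x\<in>carrier L. \<forall>y\<in>carrier L. h (x \<sqinter>\<^bsub>L\<^esub> y) = h x \<sqinter>\<^bsub>M\<^esub> h y) \<and>
     (\<forall>S. S \<subseteq> carrier L \<longrightarrow> h (\<Squnion>\<^bsub>L\<^esub>S) = \<Squnion>\<^bsub>M\<^esub>(h ` S))"

definition frame_iso :: "('a, 'c) gorder_scheme \<Rightarrow> ('b, 'd) gorder_scheme \<Rightarrow> bool" where
  "frame_iso L M \<longleftrightarrow> (\<exists>f g. frame_hom L M f \<and> frame_hom M L g \<and>
     (\<forall>x\<in>carrier L. g (f x) = x) \<and> (\<forall>y\<in>carrier M. f (g y) = y))"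

definition frame_complement :: "('a, 'c) gorder_scheme \<Rightarrow> 'a \<Rightarrow> 'a" where
  "frame_complement M x =
     (THE y. y \<in> carrier M \<and> x \<sqinter>\<^bsub>M\<^esub> y = \<bottom>\<^bsub>M\<^esub> \<and> x \<squnion>\<^bsub>M\<^esub> y = \<top>\<^bsub>M\<^esub>)"

definition opens :: "'p topology \<Rightarrow> 'p set gorder" where
  "opens X = \<lparr>carrier = {U. openin X U}, eq = (=), le = (\<subseteq>)\<rparr>"

definition front_topology :: "'p topology \<Rightarrow> 'p topology" where
  "front_topology Y =
     topology (arbitrary union_of (\<lambda>S. \<exists>U C. openin Y U \<and> closedin Y C \<and> S = U \<inter> C))"

text \<open>Points are completely prime filters; the case \<open>S = {}\<close> of the last clause says that
  the bottom element is not in \<open>p\<close>.\<close>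

definition points :: "('a, 'c) gorder_scheme \<Rightarrow> 'a set set" where
  "points L = {p. p \<subseteq> carrier L \<and> \<top>\<^bsub>L\<^esub> \<in> p \<and>
     (\<forall>x\<in>p. \<forall>y\<in>carrier L. x \<sqsubseteq>\<^bsub>L\<^esub> y \<longrightarrow> y \<in> p) \<and>
     (\<forall>x\<in>p. \<forall>y\<in>p. x \<sqinter>\<^bsub>L\<^esub> y \<in> p) \<and>
     (\<forall>S. S \<subseteq> carrier L \<and> \<Squnion>\<^bsub>L\<^esub>S \<in> p \<longrightarrow> (\<exists>x\<in>S. x \<in> p))}"

definition pt_open :: "('a, 'c) gorder_scheme \<Rightarrow> 'a \<Rightarrow> 'a set set" where
  "pt_open L a = {p \<in> points L. a \<in> p}"

definition pt :: "('a, 'c) gorder_scheme \<Rightarrow> 'a set topology" where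
  "pt L = topology (\<lambda>W. \<exists>a\<in>carrier L. W = pt_open L a)"

text \<open>There is no quantification over types, so the type in which the points of the space are
  sought is an explicit parameter. All spaces may be taken to be \<open>pt L\<close>, so points of type
  \<open>'a set\<close> are enough when \<open>L\<close> has elements of type \<open>'a\<close>.\<close>

definition spatial_locale :: "'p itself \<Rightarrow> ('a, 'c) gorder_scheme \<Rightarrow> bool" where
  "spatial_locale _ L \<longleftrightarrow> (\<exists>X :: 'p topology. frame_iso L (opens X))"

definition nuclei :: "('a, 'c) gorder_scheme \<Rightarrow> ('a \<Rightarrow> 'a) gorder" where
  "nuclei L = \<lparr>carrier = {n \<in> carrier L \<rightarrow>\<^sub>E carrier L.
       (\<forall>a\<in>carrier L. a \<sqsubseteq>\<^bsub>L\<^esub> n a) \<and>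
       (\<forall>a\<in>carrier L. \<forall>b\<in>carrier L. n (a \<sqinter>\<^bsub>L\<^esub> b) = n a \<sqinter>\<^bsub>L\<^esub> n b) \<and>
       (\<forall>a\<in>carrier L. n (n a) = n a)},
     eq = (=), le = (\<lambda>m n. \<forall>a\<in>carrier L. m a \<sqsubseteq>\<^bsub>L\<^esub> n a)\<rparr>"

text \<open>The nucleus \<open>\<nu>\<^sub>a\<close>, i.e. the open \<open>\<delta>\<^sup>-\<^sup>1(a)\<close> of the dissolution locale.\<close>

definition nu :: "('a, 'c) gorder_scheme \<Rightarrow> 'a \<Rightarrow> 'a \<Rightarrow> 'a" where
  "nu L a = (\<lambda>b\<in>carrier L. a \<squnion>\<^bsub>L\<^esub> b)"

text \<open>The extension along \<open>\<nu>\<close> of a frame morphism \<open>\<phi> : L \<rightarrow> B\<close> with complemented values,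
  given by the universal property of the frame of nuclei.\<close>

definition nuclei_extension ::
    "('a, 'c) gorder_scheme \<Rightarrow> ('b, 'd) gorder_scheme \<Rightarrow> ('a \<Rightarrow> 'b) \<Rightarrow> ('a \<Rightarrow> 'a) \<Rightarrow> 'b" where
  "nuclei_extension L B \<phi> = (THE h. h \<in> extensional (carrier (nuclei L)) \<and>
     frame_hom (nuclei L) B h \<and> (\<forall>a\<in>carrier L. h (nu L a) = \<phi> a))"

text \<open>The frame morphism \<open>N(L) \<rightarrow> \<O>(Y\<^sub>f)\<close> of the canonical inclusion \<open>k : Y\<^sub>f \<rightarrow> Y\<^sub>d\<close>, where
  \<open>Y = pt L\<close>; the map \<open>pt_open L\<close> is the inclusion of the opens of \<open>Y\<close> in those of \<open>Y\<^sub>f\<close>.\<close>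

definition k_map :: "('a, 'c) gorder_scheme \<Rightarrow> ('a \<Rightarrow> 'a) \<Rightarrow> 'a set set" where
  "k_map L = nuclei_extension L (opens (front_topology (pt L))) (pt_open L)"

text \<open>For \<open>V \<le> U\<close>, the map \<open>res F U V\<close> is the restriction from \<open>U\<close> to \<open>V\<close>. A sheaf on a
  space \<open>X\<close> is a sheaf on the frame \<open>opens X\<close>.\<close>

record ('o, 's) presheaf =
  sect :: "'o \<Rightarrow> 's set"
  res :: "'o \<Rightarrow> 'o \<Rightarrow> 's \<Rightarrow> 's"

locale presheaf =
  fixes M :: "('o, 'c) gorder_scheme" (structure) and F :: "('o, 's) presheaf"
  assumes res_closed: "\<lbrakk>U \<in> carrier M; V \<in> carrier M; V \<sqsubseteq> U; s \<in> sect F U\<rbrakk>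
      \<Longrightarrow> res F U V s \<in> sect F V"
    and res_id: "\<lbrakk>U \<in> carrier M; s \<in> sect F U\<rbrakk> \<Longrightarrow> res F U U s = s"
    and res_res: "\<lbrakk>U \<in> carrier M; V \<in> carrier M; W \<in> carrier M; W \<sqsubseteq> V; V \<sqsubseteq> U; s \<in> sect F U\<rbrakk>
      \<Longrightarrow> res F V W (res F U V s) = res F U W s"

locale sheaf = presheaf +
  assumes glueing: "\<lbrakk>C \<subseteq> carrier M; \<And>V. V \<in> C \<Longrightarrow> s V \<in> sect F V;
      \<And>V W. \<lbrakk>V \<in> C; W \<in> C\<rbrakk> \<Longrightarrow> res F V (V \<sqinter> W) (s V) = res F W (V \<sqinter> W) (s W)\<rbrakk>
      \<Longrightarrow> \<exists>!t. t \<in> sect F (\<Squnion>C) \<and> (\<forall>V\<in>C. res F (\<Squnion>C) V t = s V)"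

definition sheaf_iso ::
    "('o, 'c) gorder_scheme \<Rightarrow> ('o, 's) presheaf \<Rightarrow> ('o, 't) presheaf \<Rightarrow> bool" where
  "sheaf_iso M F G \<longleftrightarrow> (\<exists>\<phi>. (\<forall>U\<in>carrier M. bij_betw (\<phi> U) (sect F U) (sect G U)) \<and>
     (\<forall>U\<in>carrier M. \<forall>V\<in>carrier M. V \<sqsubseteq>\<^bsub>M\<^esub> U \<longrightarrow>
        (\<forall>s\<in>sect F U. \<phi> V (res F U V s) = res G U V (\<phi> U s))))"

text \<open>The direct image along the locale morphism with frame morphism \<open>h\<close>.\<close>

definition direct_image :: "('m \<Rightarrow> 'o) \<Rightarrow> ('o, 's) presheaf \<Rightarrow> ('m, 's) presheaf" where
  "direct_image h E = \<lparr>sect = (\<lambda>U. sect E (h U)), res = (\<lambda>U V. res E (h U) (h V))\<rparr>"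

text \<open>The zero, forced by the operations, is the empty open with its unique section.\<close>

definition H :: "'p topology \<Rightarrow> ('p set, 's) presheaf \<Rightarrow> ('p set \<times> 's) skew_lattice" where
  "H Y E = \<lparr>carrier = {(U, s). openin Y U \<and> s \<in> sect E U},
     smeet = (\<lambda>(U, s) (V, t). (U \<inter> V, res E U (U \<inter> V) s)),
     sjoin = (\<lambda>(U, s) (V, t). (U \<union> V, THE r. r \<in> sect E (U \<union> V) \<and>
        res E (U \<union> V) (U - V) r = res E U (U - V) s \<and> res E (U \<union> V) V r = t)),
     szero = ({}, THE s. s \<in> sect E {})\<rparr>"

text \<open>The types of points and of sections are parameters, as for \<^const>\<open>spatial_locale\<close>.\<close>

definition spatial :: "'p itself \<Rightarrow> 's itself \<Rightarrow> ('a, 'c) skew_lattice_scheme \<Rightarrow> bool" where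
  "spatial _ _ A \<longleftrightarrow> (\<exists>(Y :: 'p topology) (E :: ('p set, 's) presheaf).
     sheaf (opens (front_topology Y)) E \<and> sect E (topspace Y) \<noteq> {} \<and> nc_frame_iso A (H Y E))"

text \<open>\<open>\<delta>\<^sup>-\<^sup>1(U) - \<delta>\<^sup>-\<^sup>1(V)\<close>, the difference being taken in the dissolution locale.\<close>

definition delta_diff :: "('a, 'c) gorder_scheme \<Rightarrow> 'a \<Rightarrow> 'a \<Rightarrow> 'a \<Rightarrow> 'a" where
  "delta_diff L U V = nu L U \<sqinter>\<^bsub>nuclei L\<^esub> frame_complement (nuclei L) (nu L V)"

definition dual_nc_frame ::
    "('a, 'c) gorder_scheme \<Rightarrow> ('a \<Rightarrow> 'a, 's) presheaf \<Rightarrow> ('a \<times> 's) skew_lattice" where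
  "dual_nc_frame L F = \<lparr>carrier = {(U, s). U \<in> carrier L \<and> s \<in> sect F (nu L U)},
     smeet = (\<lambda>(U, s) (V, t). (U \<sqinter>\<^bsub>L\<^esub> V, res F (nu L U) (nu L (U \<sqinter>\<^bsub>L\<^esub> V)) s)),
     sjoin = (\<lambda>(U, s) (V, t). (U \<squnion>\<^bsub>L\<^esub> V, THE r. r \<in> sect F (nu L (U \<squnion>\<^bsub>L\<^esub> V)) \<and>
        res F (nu L (U \<squnion>\<^bsub>L\<^esub> V)) (delta_diff L U V) r = res F (nu L U) (delta_diff L U V) s \<and>
        res F (nu L (U \<squnion>\<^bsub>L\<^esub> V)) (nu L V) r = t)),
     szero = (\<bottom>\<^bsub>L\<^esub>, THE s. s \<in> sect F (nu L \<bottom>\<^bsub>L\<^esub>))\<rparr>"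

text \<open>A dual is determined only up to isomorphism, hence a relation rather than a function.\<close>

definition is_dual ::
    "('a, 'c) skew_lattice_scheme \<Rightarrow> ('l, 'd) gorder_scheme \<Rightarrow> ('l \<Rightarrow> 'l, 's) presheaf \<Rightarrow> bool" where
  "is_dual A L F \<longleftrightarrow> frame L \<and> sheaf (nuclei L) F \<and> sect F \<top>\<^bsub>nuclei L\<^esub> \<noteq> {} \<and>
     nc_frame_iso A (dual_nc_frame L F)"

end

theory Submission
  imports Defs
begin

text \<open>Write \<open>dual(L, F)\<close> for the noncommutative frame of pairs \<open>(u, s)\<close> with \<open>s \<in> F(\<nu>\<^sub>u)\<close>. Two observations
  carry the proof.

  The first is that, over a space, the two kinds of section frames coincide. Let \<open>\<phi>\<close> be an isomorphism
  from \<open>L\<close> to the opens of a space \<open>X\<close>, and let \<open>h\<close> be a frame morphism from \<open>N(L)\<close> to the front opens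
  of \<open>X\<close> with \<open>h(\<nu>\<^sub>u) = \<phi>(u)\<close>. Then \<open>h\<close> takes differences of open parts to set differences, and so
  \<open>(u, s) \<mapsto> (\<phi> u, s)\<close> is an isomorphism from \<open>dual(L, h\<^sub>* E)\<close> to \<open>H(X, E)\<close> (\<open>skew_iso_dual_H\<close>).

  The second is that \<open>F\<close> can be recovered from \<open>dual(L, F)\<close> (\<open>sheaf_iso_of_skew_iso\<close>). The parts
  \<open>\<nu>\<^sub>u - \<nu>\<^sub>v\<close> generate \<open>N(L)\<close> under joins (\<open>nucleus_eq_sup_delta_diff\<close>), every section over such a part extends to a
  global one, because \<open>F\<close> has some global section to fill the complement (\<open>extend_from_delta_diff\<close>),
  and two global sections \<open>x\<close>, \<open>x'\<close> agree on \<open>\<nu>\<^sub>u - \<nu>\<^sub>v\<close> iff \<open>(x \<curlywedge> a) \<curlyvee> b = (x' \<curlywedge> a) \<curlyvee> b\<close>, where \<open>a\<close> and \<open>b\<close> are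
  any elements over \<open>u\<close> and \<open>v\<close> (\<open>agree_delta_diff_iff\<close>). An isomorphism of the skew lattices
  over \<open>L\<close> hence gives a bijection of the global sections that preserves where they agree, and this
  extends to all sections by glueing (\<open>globally_generated_pair\<close>).

  If \<open>L\<close> is spatial and \<open>F \<cong> k\<^sub>* E\<close>, the first observation, applied to \<open>X = pt L\<close> and \<open>h = k\<close>, gives
  \<open>A \<cong> dual(L, F) \<cong> dual(L, k\<^sub>* E) \<cong> H(pt L, E)\<close>. Conversely, let \<open>A \<cong> H(X, E)\<close> for some space \<open>X\<close>. Green's
  relation is definable from the meet, so the isomorphism \<open>dual(L, F) \<cong> H(X, E)\<close> lies over an
  isomorphism of \<open>L\<close> with the opens of \<open>X\<close> (\<open>shadow_map_unique\<close>). The space \<open>X\<close> may fail to be sober; let \<open>\<eta>\<close> be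
  the map from \<open>X\<close> to \<open>pt L\<close>. It is continuous for the front topologies, and both observations with
  \<open>h = \<eta>\<^sup>-\<^sup>1 \<circ> k\<close> give \<open>F \<cong> h\<^sub>* E = k\<^sub>* (\<eta>\<^sub>* E)\<close>. The type of the sections of \<open>\<eta>\<^sub>* E\<close> can then be changed to that of
  the sections of \<open>F\<close>, because every front open of \<open>pt L\<close> has the form \<open>k(n)\<close>.\<close>

section \<open>Complete lattices with carriers\<close>

lemma partial_orderI:
  assumes "eq L = (=)"
    and "\<And>x. x \<in> carrier L \<Longrightarrow> x \<sqsubseteq>\<^bsub>L\<^esub> x"
    and "\<And>x y. \<lbrakk>x \<in> carrier L; y \<in> carrier L; x \<sqsubseteq>\<^bsub>L\<^esub> y; y \<sqsubseteq>\<^bsub>L\<^esub> x\<rbrakk> \<Longrightarrow> x = y"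
    and "\<And>x y z. \<lbrakk>x \<in> carrier L; y \<in> carrier L; z \<in> carrier L; x \<sqsubseteq>\<^bsub>L\<^esub> y; y \<sqsubseteq>\<^bsub>L\<^esub> z\<rbrakk>
      \<Longrightarrow> x \<sqsubseteq>\<^bsub>L\<^esub> z"
  shows "partial_order L"
proof
  show "x .=\<^bsub>L\<^esub> y" if "x \<sqsubseteq>\<^bsub>L\<^esub> y" "y \<sqsubseteq>\<^bsub>L\<^esub> x" "x \<in> carrier L" "y \<in> carrier L" for x y
    using assms(1) assms(3) [OF that(3,4,1,2)] by simp
  show "x \<sqsubseteq>\<^bsub>L\<^esub> z" if "x \<sqsubseteq>\<^bsub>L\<^esub> y" "y \<sqsubseteq>\<^bsub>L\<^esub> z" "x \<in> carrier L" "y \<in> carrier L" "z \<in> carrier L"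
    for x y z
    using assms(4) [OF that(3-5,1,2)] .
qed (simp_all add: assms(1,2))

context complete_lattice
begin

lemma sup_eqI:
  assumes "S \<subseteq> carrier L" "s \<in> carrier L" "\<And>x. x \<in> S \<Longrightarrow> x \<sqsubseteq> s"
    and "\<And>z. \<lbrakk>z \<in> carrier L; \<And>x. x \<in> S \<Longrightarrow> x \<sqsubseteq> z\<rbrakk> \<Longrightarrow> s \<sqsubseteq> z"
  shows "\<Squnion>S = s"
  by (meson assms le_antisym sup_closed sup_least sup_upper)

lemma join_eqI:
  assumes "x \<in> carrier L" "y \<in> carrier L" "s \<in> carrier L" "x \<sqsubseteq> s" "y \<sqsubseteq> s"
    and "\<And>z. \<lbrakk>z \<in> carrier L; x \<sqsubseteq> z; y \<sqsubseteq> z\<rbrakk> \<Longrightarrow> s \<sqsubseteq> z"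
  shows "x \<squnion> y = s"
  using assms unfolding join_def by (intro sup_eqI) auto

lemma meet_eqI:
  assumes "x \<in> carrier L" "y \<in> carrier L" "s \<in> carrier L" "s \<sqsubseteq> x" "s \<sqsubseteq> y"
    and "\<And>z. \<lbrakk>z \<in> carrier L; z \<sqsubseteq> x; z \<sqsubseteq> y\<rbrakk> \<Longrightarrow> z \<sqsubseteq> s"
  shows "x \<sqinter> y = s"
  by (meson assms le_antisym meet_closed meet_le meet_left meet_right)

lemma top_eqI: "\<lbrakk>t \<in> carrier L; \<And>x. x \<in> carrier L \<Longrightarrow> x \<sqsubseteq> t\<rbrakk> \<Longrightarrow> \<top> = t"
  using le_antisym top_closed top_higher by blast

lemma bottom_eqI: "\<lbrakk>t \<in> carrier L; \<And>x. x \<in> carrier L \<Longrightarrow> t \<sqsubseteq> x\<rbrakk> \<Longrightarrow> \<bottom> = t"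
  using le_antisym bottom_closed bottom_lower by blast

lemma sup_empty_eq: "\<Squnion>{} = \<bottom>"
  by (rule sup_eqI) simp_all

lemma le_iff_meet_eq: "\<lbrakk>x \<in> carrier L; y \<in> carrier L\<rbrakk> \<Longrightarrow> x \<sqsubseteq> y \<longleftrightarrow> x \<sqinter> y = x"
  using le_iff_join by auto

end

lemma complete_lattice_transport:
  assumes "complete_lattice M" and eq: "eq L = (=)" and bij: "bij_betw f (carrier L) (carrier M)"
    and le: "\<And>x y. \<lbrakk>x \<in> carrier L; y \<in> carrier L\<rbrakk> \<Longrightarrow> f x \<sqsubseteq>\<^bsub>M\<^esub> f y \<longleftrightarrow> x \<sqsubseteq>\<^bsub>L\<^esub> y"
  shows "complete_lattice L"
proof -
  interpret M: complete_lattice M by fact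
  have fc: "f x \<in> carrier M" if "x \<in> carrier L" for x
    using bij that by (auto simp: bij_betw_def)
  have inj: "inj_on f (carrier L)" and surj: "f ` carrier L = carrier M"
    using bij by (auto simp: bij_betw_def)
  interpret L: partial_order L
  proof (rule partial_orderI [OF eq])
    show "x = y" if "x \<in> carrier L" "y \<in> carrier L" "x \<sqsubseteq>\<^bsub>L\<^esub> y" "y \<sqsubseteq>\<^bsub>L\<^esub> x" for x y
      using that inj le fc M.le_antisym by (meson inj_onD)
    show "x \<sqsubseteq>\<^bsub>L\<^esub> z"
      if "x \<in> carrier L" "y \<in> carrier L" "z \<in> carrier L" "x \<sqsubseteq>\<^bsub>L\<^esub> y" "y \<sqsubseteq>\<^bsub>L\<^esub> z" for x y z
      using that le fc M.le_trans by meson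
  qed (use fc in \<open>simp flip: le\<close>)
  show ?thesis
  proof (rule L.complete_latticeI)
    fix S assume S: "S \<subseteq> carrier L"
    then have fS: "f ` S \<subseteq> carrier M" using fc by auto
    obtain s where s: "s \<in> carrier L" "f s = \<Squnion>\<^bsub>M\<^esub>(f ` S)"
      using surj M.sup_closed [OF fS] by (metis imageE)
    have "least L s (Upper L S)"
    proof (rule least_UpperI)
      show "x \<sqsubseteq>\<^bsub>L\<^esub> s" if "x \<in> S" for x
        using that S s M.sup_upper [OF fS, of "f x"] by (auto simp: subset_iff simp flip: le)
      show "s \<sqsubseteq>\<^bsub>L\<^esub> y" if "y \<in> Upper L S" for y
      proof -
        have y: "y \<in> carrier L" "\<And>x. x \<in> S \<Longrightarrow> x \<sqsubseteq>\<^bsub>L\<^esub> y"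
          using that S by (auto simp: Upper_def)
        have "f s \<sqsubseteq>\<^bsub>M\<^esub> f y"
          unfolding s(2) using fS fc y S le by (intro M.sup_least) (auto simp: subset_iff)
        then show ?thesis using s y by (simp flip: le)
      qed
    qed (use S s in auto)
    then show "\<exists>s. least L s (Upper L S)" ..
    obtain i where i: "i \<in> carrier L" "f i = \<Sqinter>\<^bsub>M\<^esub>(f ` S)"
      using surj M.inf_closed [OF fS] by (metis imageE)
    have "greatest L i (Lower L S)"
    proof (rule greatest_LowerI)
      show "i \<sqsubseteq>\<^bsub>L\<^esub> x" if "x \<in> S" for x
        using that S i M.inf_lower [OF fS, of "f x"] by (auto simp: subset_iff simp flip: le)
      show "y \<sqsubseteq>\<^bsub>L\<^esub> i" if "y \<in> Lower L S" for y
      proof -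
        have y: "y \<in> carrier L" "\<And>x. x \<in> S \<Longrightarrow> y \<sqsubseteq>\<^bsub>L\<^esub> x"
          using that S by (auto simp: Lower_def)
        have "f y \<sqsubseteq>\<^bsub>M\<^esub> f i"
          unfolding i(2) using fS fc y S le by (intro M.inf_greatest) (auto simp: subset_iff)
        then show ?thesis using i y by (simp flip: le)
      qed
    qed (use S i in auto)
    then show "\<exists>i. greatest L i (Lower L S)" ..
  qed
qed

lemma frame_hom_of_order_iso:
  assumes "complete_lattice L" "complete_lattice M" and bij: "bij_betw f (carrier L) (carrier M)"
    and le: "\<And>x y. \<lbrakk>x \<in> carrier L; y \<in> carrier L\<rbrakk> \<Longrightarrow> f x \<sqsubseteq>\<^bsub>M\<^esub> f y \<longleftrightarrow> x \<sqsubseteq>\<^bsub>L\<^esub> y"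
  shows "frame_hom L M f"
proof -
  interpret L: complete_lattice L by fact
  interpret M: complete_lattice M by fact
  have fc: "f x \<in> carrier M" if "x \<in> carrier L" for x
    using bij that by (auto simp: bij_betw_def)
  have surj: "\<exists>x\<in>carrier L. y = f x" if "y \<in> carrier M" for y
    using bij that by (auto simp: bij_betw_def)
  show ?thesis
    unfolding frame_hom_def
  proof (intro conjI ballI allI impI)
    show "f \<in> carrier L \<rightarrow> carrier M" using fc by auto
    show "f \<top>\<^bsub>L\<^esub> = \<top>\<^bsub>M\<^esub>"
    proof (rule M.top_eqI [symmetric])
      fix z assume "z \<in> carrier M"
      then obtain w where "w \<in> carrier L" "z = f w" using surj by blast
      then show "z \<sqsubseteq>\<^bsub>M\<^esub> f \<top>\<^bsub>L\<^esub>" using le by simp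
    qed (simp add: fc)
    fix x y assume xy: "x \<in> carrier L" "y \<in> carrier L"
    show "f (x \<sqinter>\<^bsub>L\<^esub> y) = f x \<sqinter>\<^bsub>M\<^esub> f y"
    proof (rule M.meet_eqI [symmetric])
      fix z assume z: "z \<in> carrier M" "z \<sqsubseteq>\<^bsub>M\<^esub> f x" "z \<sqsubseteq>\<^bsub>M\<^esub> f y"
      then obtain w where "w \<in> carrier L" "z = f w" using surj by blast
      then show "z \<sqsubseteq>\<^bsub>M\<^esub> f (x \<sqinter>\<^bsub>L\<^esub> y)" using z le xy L.meet_le by auto
    qed (use xy fc L.meet_left L.meet_right in \<open>simp_all add: le\<close>)
  next
    fix S assume S: "S \<subseteq> carrier L"
    show "f (\<Squnion>\<^bsub>L\<^esub>S) = \<Squnion>\<^bsub>M\<^esub>(f ` S)"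
    proof (rule M.sup_eqI [symmetric])
      fix z assume z: "z \<in> carrier M" "\<And>x. x \<in> f ` S \<Longrightarrow> x \<sqsubseteq>\<^bsub>M\<^esub> z"
      then obtain w where w: "w \<in> carrier L" "z = f w" using surj by blast
      have "\<Squnion>\<^bsub>L\<^esub>S \<sqsubseteq>\<^bsub>L\<^esub> w"
        using z(2) w S by (intro L.sup_least) (auto simp: subset_iff simp flip: le)
      then show "f (\<Squnion>\<^bsub>L\<^esub>S) \<sqsubseteq>\<^bsub>M\<^esub> z" using w le S by auto
    qed (use S fc L.sup_upper in \<open>auto simp: subset_iff le\<close>)
  qed
qed

lemma frame_iso_of_order_iso:
  assumes "complete_lattice L" "complete_lattice M" and bij: "bij_betw f (carrier L) (carrier M)"
    and le: "\<And>x y. \<lbrakk>x \<in> carrier L; y \<in> carrier L\<rbrakk> \<Longrightarrow> f x \<sqsubseteq>\<^bsub>M\<^esub> f y \<longleftrightarrow> x \<sqsubseteq>\<^bsub>L\<^esub> y"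
  shows "frame_iso L M"
proof -
  let ?g = "inv_into (carrier L) f"
  have bg: "bij_betw ?g (carrier M) (carrier L)"
    using bij by (rule bij_betw_inv_into)
  have "frame_hom M L ?g"
  proof (rule frame_hom_of_order_iso [OF assms(2,1) bg])
    fix x y assume "x \<in> carrier M" "y \<in> carrier M"
    then show "?g x \<sqsubseteq>\<^bsub>L\<^esub> ?g y \<longleftrightarrow> x \<sqsubseteq>\<^bsub>M\<^esub> y"
      using le [of "?g x" "?g y"] bg bij_betw_inv_into_right [OF bij] by (auto simp: bij_betw_def)
  qed
  then show ?thesis
    unfolding frame_iso_def
    using frame_hom_of_order_iso [OF assms] bij_betw_inv_into_left [OF bij]
      bij_betw_inv_into_right [OF bij] by blast
qed

lemma frame_hom_carrier: "\<lbrakk>frame_hom L M h; x \<in> carrier L\<rbrakk> \<Longrightarrow> h x \<in> carrier M"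
  by (auto simp: frame_hom_def)

lemma frame_hom_mono:
  assumes "complete_lattice L" "complete_lattice M" "frame_hom L M h"
    "x \<in> carrier L" "y \<in> carrier L" "x \<sqsubseteq>\<^bsub>L\<^esub> y"
  shows "h x \<sqsubseteq>\<^bsub>M\<^esub> h y"
proof -
  interpret L: complete_lattice L by fact
  interpret M: complete_lattice M by fact
  have "h x \<sqinter>\<^bsub>M\<^esub> h y = h x"
    using assms L.le_iff_meet_eq [of x y] by (metis frame_hom_def)
  then show ?thesis
    using M.le_iff_meet_eq frame_hom_carrier [OF assms(3)] assms(4,5) by simp
qed

lemma frame_hom_bottom:
  assumes "complete_lattice L" "complete_lattice M" "frame_hom L M h"
  shows "h \<bottom>\<^bsub>L\<^esub> = \<bottom>\<^bsub>M\<^esub>"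
proof -
  interpret L: complete_lattice L by fact
  interpret M: complete_lattice M by fact
  have "h (\<Squnion>\<^bsub>L\<^esub>{}) = \<Squnion>\<^bsub>M\<^esub>(h ` {})"
    using assms(3) by (auto simp: frame_hom_def)
  then show ?thesis by (simp add: L.sup_empty_eq M.sup_empty_eq)
qed

lemma frame_hom_join:
  assumes "frame_hom L M h" "x \<in> carrier L" "y \<in> carrier L"
  shows "h (x \<squnion>\<^bsub>L\<^esub> y) = h x \<squnion>\<^bsub>M\<^esub> h y"
proof -
  have "h (\<Squnion>\<^bsub>L\<^esub>{x, y}) = \<Squnion>\<^bsub>M\<^esub>(h ` {x, y})"
    using assms unfolding frame_hom_def by blast
  then show ?thesis by (simp add: join_def)
qed

lemma frame_hom_comp:
  assumes "frame_hom L M h" "frame_hom M N k"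
  shows "frame_hom L N (k \<circ> h)"
proof -
  have "k (h (\<Squnion>\<^bsub>L\<^esub>S)) = \<Squnion>\<^bsub>N\<^esub>((k \<circ> h) ` S)" if "S \<subseteq> carrier L" for S
  proof -
    have "h ` S \<subseteq> carrier M" using that assms by (auto simp: frame_hom_def)
    then show ?thesis using that assms by (simp add: frame_hom_def image_comp)
  qed
  then show ?thesis
    using assms by (auto simp: frame_hom_def Pi_iff)
qed

lemma frame_isoE:
  assumes "frame_iso L M" "complete_lattice L" "complete_lattice M"
  obtains f where "frame_hom L M f" "bij_betw f (carrier L) (carrier M)"
    "\<And>x y. \<lbrakk>x \<in> carrier L; y \<in> carrier L\<rbrakk> \<Longrightarrow> f x \<sqsubseteq>\<^bsub>M\<^esub> f y \<longleftrightarrow> x \<sqsubseteq>\<^bsub>L\<^esub> y"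
proof -
  obtain f g where fg: "frame_hom L M f" "frame_hom M L g"
    "\<And>x. x \<in> carrier L \<Longrightarrow> g (f x) = x" "\<And>y. y \<in> carrier M \<Longrightarrow> f (g y) = y"
    using assms(1) unfolding frame_iso_def by blast
  note c = frame_hom_carrier [OF fg(1)] frame_hom_carrier [OF fg(2)]
  have "bij_betw f (carrier L) (carrier M)"
    using c fg by (intro bij_betw_byWitness [where f' = g]) auto
  moreover have "f x \<sqsubseteq>\<^bsub>M\<^esub> f y \<longleftrightarrow> x \<sqsubseteq>\<^bsub>L\<^esub> y" if "x \<in> carrier L" "y \<in> carrier L" for x y
    using that frame_hom_mono [OF assms(2,3) fg(1), of x y]
      frame_hom_mono [OF assms(3,2) fg(2), of "f x" "f y"] fg(3) c by auto
  ultimately show ?thesis using fg(1) that by blast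
qed

subsection \<open>Lattices of open sets\<close>

lemma carrier_opens: "carrier (opens X) = {U. openin X U}"
  and le_opens: "U \<sqsubseteq>\<^bsub>opens X\<^esub> V \<longleftrightarrow> U \<subseteq> V"
  by (auto simp: opens_def)

lemma complete_lattice_opens: "complete_lattice (opens X)"
proof -
  interpret partial_order "opens X"
    by (rule partial_orderI) (simp_all add: opens_def)
  show ?thesis
  proof (rule complete_latticeI)
    fix S assume S: "S \<subseteq> carrier (opens X)"
    have "least (opens X) (\<Union>S) (Upper (opens X) S)"
      using S by (intro least_UpperI) (auto simp: carrier_opens le_opens Upper_def)
    then show "\<exists>s. least (opens X) s (Upper (opens X) S)" ..
    have "greatest (opens X) (\<Union>{U. openin X U \<and> (\<forall>V\<in>S. U \<subseteq> V)}) (Lower (opens X) S)"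
      using S by (intro greatest_LowerI) (auto simp: carrier_opens le_opens Lower_def)
    then show "\<exists>i. greatest (opens X) i (Lower (opens X) S)" ..
  qed
qed

lemma sup_opens: "S \<subseteq> {U. openin X U} \<Longrightarrow> \<Squnion>\<^bsub>opens X\<^esub>S = \<Union>S"
  by (rule complete_lattice.sup_eqI [OF complete_lattice_opens]) (auto simp: carrier_opens le_opens)

lemma join_opens: "\<lbrakk>openin X U; openin X V\<rbrakk> \<Longrightarrow> U \<squnion>\<^bsub>opens X\<^esub> V = U \<union> V"
  by (rule complete_lattice.join_eqI [OF complete_lattice_opens]) (auto simp: carrier_opens le_opens)

lemma meet_opens: "\<lbrakk>openin X U; openin X V\<rbrakk> \<Longrightarrow> U \<sqinter>\<^bsub>opens X\<^esub> V = U \<inter> V"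
  by (rule complete_lattice.meet_eqI [OF complete_lattice_opens]) (auto simp: carrier_opens le_opens)

lemma top_opens: "\<top>\<^bsub>opens X\<^esub> = topspace X"
  by (rule complete_lattice.top_eqI [OF complete_lattice_opens])
    (simp_all add: opens_def openin_subset)

lemma bottom_opens: "\<bottom>\<^bsub>opens X\<^esub> = {}"
  by (rule complete_lattice.bottom_eqI [OF complete_lattice_opens]) (auto simp: carrier_opens le_opens)

section \<open>Frames and their nuclei\<close>

context complete_lattice
begin

lemma le_meet_iff:
  "\<lbrakk>x \<in> carrier L; y \<in> carrier L; z \<in> carrier L\<rbrakk> \<Longrightarrow> z \<sqsubseteq> x \<sqinter> y \<longleftrightarrow> z \<sqsubseteq> x \<and> z \<sqsubseteq> y"
  by (meson le_trans meet_closed meet_le meet_left meet_right)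

lemma join_le_iff:
  "\<lbrakk>x \<in> carrier L; y \<in> carrier L; z \<in> carrier L\<rbrakk> \<Longrightarrow> x \<squnion> y \<sqsubseteq> z \<longleftrightarrow> x \<sqsubseteq> z \<and> y \<sqsubseteq> z"
  by (meson le_trans join_closed join_le join_left join_right)

lemma meet_self: "x \<in> carrier L \<Longrightarrow> x \<sqinter> x = x"
  by (rule meet_eqI) auto

lemma eq_iff_le: "\<lbrakk>x \<in> carrier L; y \<in> carrier L\<rbrakk> \<Longrightarrow> x = y \<longleftrightarrow> x \<sqsubseteq> y \<and> y \<sqsubseteq> x"
  by (metis le_antisym le_refl)

end

definition heyting_imp :: "('a, 'c) gorder_scheme \<Rightarrow> 'a \<Rightarrow> 'a \<Rightarrow> 'a" where
  "heyting_imp L a b = \<Squnion>\<^bsub>L\<^esub>{c \<in> carrier L. a \<sqinter>\<^bsub>L\<^esub> c \<sqsubseteq>\<^bsub>L\<^esub> b}"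

text \<open>The nucleus complementary to \<open>\<nu>\<^sub>a\<close>.\<close>

definition imp_nucleus :: "('a, 'c) gorder_scheme \<Rightarrow> 'a \<Rightarrow> 'a \<Rightarrow> 'a" where
  "imp_nucleus L a = (\<lambda>b\<in>carrier L. heyting_imp L a b)"

context frame
begin

lemma heyting_imp_closed: "heyting_imp L a b \<in> carrier L"
  by (auto simp: heyting_imp_def intro: sup_closed)

lemma le_heyting_imp_iff:
  assumes "a \<in> carrier L" "b \<in> carrier L" "c \<in> carrier L"
  shows "c \<sqsubseteq> heyting_imp L a b \<longleftrightarrow> a \<sqinter> c \<sqsubseteq> b"
proof
  let ?S = "{c \<in> carrier L. a \<sqinter> c \<sqsubseteq> b}"
  assume c: "c \<sqsubseteq> heyting_imp L a b"
  have "a \<sqinter> \<Squnion>?S = \<Squnion>((\<sqinter>) a ` ?S)"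
    using assms by (intro frame_distrib) auto
  also have "\<dots> \<sqsubseteq> b"
    using assms by (intro sup_least) auto
  finally have "a \<sqinter> heyting_imp L a b \<sqsubseteq> b"
    by (simp add: heyting_imp_def)
  moreover have "a \<sqinter> c \<sqsubseteq> a \<sqinter> heyting_imp L a b"
    using assms c heyting_imp_closed meet_left meet_right
    by (subst le_meet_iff) (auto intro: le_trans [of _ c])
  ultimately show "a \<sqinter> c \<sqsubseteq> b"
    using assms heyting_imp_closed le_trans by (meson meet_closed)
next
  assume "a \<sqinter> c \<sqsubseteq> b"
  then show "c \<sqsubseteq> heyting_imp L a b"
    using assms unfolding heyting_imp_def by (intro sup_upper) auto
qed

lemma meet_join_distrib:
  assumes "a \<in> carrier L" "b \<in> carrier L" "c \<in> carrier L"
  shows "a \<sqinter> (b \<squnion> c) = (a \<sqinter> b) \<squnion> (a \<sqinter> c)"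
  using frame_distrib [of a "{b, c}"] assms by (simp add: join_def)

lemma join_meet_distrib:
  assumes "a \<in> carrier L" "b \<in> carrier L" "c \<in> carrier L"
  shows "(a \<squnion> b) \<sqinter> (a \<squnion> c) = a \<squnion> (b \<sqinter> c)"
proof (rule le_antisym)
  have 1: "(a \<squnion> b) \<sqinter> a \<sqsubseteq> a" "b \<sqinter> a \<sqsubseteq> a" "b \<sqinter> c \<sqsubseteq> b \<sqinter> c"
    using assms meet_right by auto
  have 2: "a \<sqsubseteq> a \<squnion> (b \<sqinter> c)" "b \<sqinter> c \<sqsubseteq> a \<squnion> (b \<sqinter> c)"
    using assms join_left join_right by auto
  have "(a \<squnion> b) \<sqinter> (a \<squnion> c) = ((a \<squnion> b) \<sqinter> a) \<squnion> ((c \<sqinter> a) \<squnion> (c \<sqinter> b))"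
    using assms meet_join_distrib [of "a \<squnion> b" a c] meet_join_distrib [of c a b]
    by (simp add: meet_comm [of L _ c])
  moreover have "(a \<squnion> b) \<sqinter> a \<sqsubseteq> a \<squnion> (b \<sqinter> c)" "c \<sqinter> a \<sqsubseteq> a \<squnion> (b \<sqinter> c)" "c \<sqinter> b \<sqsubseteq> a \<squnion> (b \<sqinter> c)"
    using assms 1 2 le_trans [of "(a \<squnion> b) \<sqinter> a" a] le_trans [of "c \<sqinter> a" a] meet_right [of c a]
    by (auto simp: meet_comm [of L c b])
  ultimately show "(a \<squnion> b) \<sqinter> (a \<squnion> c) \<sqsubseteq> a \<squnion> (b \<sqinter> c)"
    using assms by (simp add: join_le_iff)
next
  show "a \<squnion> (b \<sqinter> c) \<sqsubseteq> (a \<squnion> b) \<sqinter> (a \<squnion> c)"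
    using assms join_left [of a b] join_right [of a b] join_left [of a c] join_right [of a c]
      meet_left [of b c] meet_right [of b c]
    by (auto simp: join_le_iff le_meet_iff intro: le_trans [of _ b] le_trans [of _ c])
qed (use assms in auto)

subsection \<open>The complete lattice of nuclei\<close>

lemma le_nuclei: "m \<sqsubseteq>\<^bsub>nuclei L\<^esub> n \<longleftrightarrow> (\<forall>a\<in>carrier L. m a \<sqsubseteq> n a)"
  by (simp add: nuclei_def)

lemma nucleusI:
  assumes "n \<in> extensional (carrier L)" and "\<And>a. a \<in> carrier L \<Longrightarrow> n a \<in> carrier L"
    and "\<And>a. a \<in> carrier L \<Longrightarrow> a \<sqsubseteq> n a"
    and "\<And>a b. \<lbrakk>a \<in> carrier L; b \<in> carrier L\<rbrakk> \<Longrightarrow> n (a \<sqinter> b) = n a \<sqinter> n b"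
    and "\<And>a. a \<in> carrier L \<Longrightarrow> n (n a) \<sqsubseteq> n a"
  shows "n \<in> carrier (nuclei L)"
  using assms by (auto simp: nuclei_def PiE_def intro: le_antisym)

context
  fixes n assumes n: "n \<in> carrier (nuclei L)"
begin

lemma nucleus_closed: "a \<in> carrier L \<Longrightarrow> n a \<in> carrier L"
  and nucleus_increasing: "a \<in> carrier L \<Longrightarrow> a \<sqsubseteq> n a"
  and nucleus_meet: "\<lbrakk>a \<in> carrier L; b \<in> carrier L\<rbrakk> \<Longrightarrow> n (a \<sqinter> b) = n a \<sqinter> n b"
  and nucleus_idem: "a \<in> carrier L \<Longrightarrow> n (n a) = n a"
  and nucleus_extensional: "n \<in> extensional (carrier L)"
  using n by (auto simp: nuclei_def PiE_def)

lemma nucleus_mono: "\<lbrakk>a \<in> carrier L; b \<in> carrier L; a \<sqsubseteq> b\<rbrakk> \<Longrightarrow> n a \<sqsubseteq> n b"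
  by (metis le_iff_meet_eq nucleus_closed nucleus_meet)

end

lemma partial_order_nuclei: "partial_order (nuclei L)"
proof (rule partial_orderI)
  show "x = y" if "x \<in> carrier (nuclei L)" "y \<in> carrier (nuclei L)"
      "x \<sqsubseteq>\<^bsub>nuclei L\<^esub> y" "y \<sqsubseteq>\<^bsub>nuclei L\<^esub> x" for x y
    using that by (intro extensionalityI [of x "carrier L"])
      (auto simp: le_nuclei nucleus_closed nucleus_extensional intro: le_antisym)
  show "x \<sqsubseteq>\<^bsub>nuclei L\<^esub> z" if "x \<in> carrier (nuclei L)" "y \<in> carrier (nuclei L)"
      "z \<in> carrier (nuclei L)" "x \<sqsubseteq>\<^bsub>nuclei L\<^esub> y" "y \<sqsubseteq>\<^bsub>nuclei L\<^esub> z" for x y z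
    using that unfolding le_nuclei by (meson le_trans nucleus_closed)
qed (simp_all add: le_nuclei nucleus_closed, simp add: nuclei_def)

text \<open>Infima of nuclei are computed pointwise. Suprema are not, and they exist only as infima of
  upper bounds.\<close>

lemma complete_lattice_nuclei: "complete_lattice (nuclei L)"
proof (rule partial_order.complete_lattice_criterion1 [OF partial_order_nuclei])
  have "(\<lambda>a\<in>carrier L. \<top>) \<in> carrier (nuclei L)"
    by (rule nucleusI) (auto simp: meet_self)
  then show "\<exists>g. greatest (nuclei L) g (carrier (nuclei L))"
    by (intro exI [of _ "\<lambda>a\<in>carrier L. \<top>"])
      (auto simp: greatest_def le_nuclei nucleus_closed)
next
  fix S assume S: "S \<subseteq> carrier (nuclei L)"
  define m where "m = (\<lambda>a\<in>carrier L. \<Sqinter>((\<lambda>n. n a) ` S))"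
  have cl: "(\<lambda>n. n a) ` S \<subseteq> carrier L" if "a \<in> carrier L" for a
    using S that nucleus_closed by auto
  have mc: "m a \<in> carrier L" if "a \<in> carrier L" for a
    using cl [OF that] that by (simp add: m_def)
  have lower: "m a \<sqsubseteq> n a" if "a \<in> carrier L" "n \<in> S" for a n
    using that inf_lower [OF cl] by (simp add: m_def)
  have great: "z \<sqsubseteq> m a" if "a \<in> carrier L" "z \<in> carrier L" "\<And>n. n \<in> S \<Longrightarrow> z \<sqsubseteq> n a" for a z
    using that cl [OF that(1)] by (auto simp: m_def intro!: inf_greatest)
  have "m \<in> carrier (nuclei L)"
  proof (rule nucleusI)
    show "m \<in> extensional (carrier L)" by (simp add: m_def)
    show "a \<sqsubseteq> m a" if "a \<in> carrier L" for a
      using that S nucleus_increasing by (intro great) auto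
    show "m (m a) \<sqsubseteq> m a" if "a \<in> carrier L" for a
    proof (rule great [OF that mc [OF mc [OF that]]])
      fix n assume nS: "n \<in> S"
      then have n: "n \<in> carrier (nuclei L)" using S by auto
      have "m (m a) \<sqsubseteq> n (m a)" "n (m a) \<sqsubseteq> n (n a)"
        using lower [OF mc nS] nucleus_mono [OF n mc _ lower] nucleus_closed [OF n] that nS by auto
      then show "m (m a) \<sqsubseteq> n a"
        using nucleus_idem [OF n that] nucleus_closed [OF n] mc that
          le_trans [of "m (m a)" "n (m a)" "n a"] by simp
    qed
    show "m (a \<sqinter> b) = m a \<sqinter> m b" if ab: "a \<in> carrier L" "b \<in> carrier L" for a b
    proof (rule meet_eqI [symmetric])
      have le: "m (a \<sqinter> b) \<sqsubseteq> n a" "m (a \<sqinter> b) \<sqsubseteq> n b" if "n \<in> S" for n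
      proof -
        have n: "n \<in> carrier (nuclei L)" using S that by auto
        have "m (a \<sqinter> b) \<sqsubseteq> n a \<sqinter> n b"
          using lower [of "a \<sqinter> b", OF _ that] nucleus_meet [OF n] ab by auto
        then show "m (a \<sqinter> b) \<sqsubseteq> n a" "m (a \<sqinter> b) \<sqsubseteq> n b"
          using le_meet_iff nucleus_closed [OF n] mc ab by auto
      qed
      show "m (a \<sqinter> b) \<sqsubseteq> m a" "m (a \<sqinter> b) \<sqsubseteq> m b"
        using le ab mc by (auto intro: great)
      fix z assume z: "z \<in> carrier L" "z \<sqsubseteq> m a" "z \<sqsubseteq> m b"
      show "z \<sqsubseteq> m (a \<sqinter> b)"
      proof (rule great)
        fix n assume "n \<in> S"
        then have n: "n \<in> carrier (nuclei L)" using S by auto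
        have "z \<sqsubseteq> n a" "z \<sqsubseteq> n b"
          using z lower [OF _ \<open>n \<in> S\<close>] ab mc nucleus_closed [OF n]
            le_trans [of z "m a" "n a"] le_trans [of z "m b" "n b"] by simp_all
        then show "z \<sqsubseteq> n (a \<sqinter> b)"
          using nucleus_meet [OF n] nucleus_closed [OF n] le_meet_iff ab z by auto
      qed (use z ab in auto)
    qed (use ab mc in auto)
  qed (use mc in auto)
  moreover have "greatest (nuclei L) m (Lower (nuclei L) S)"
    using S calculation by (intro greatest_LowerI)
      (auto simp: le_nuclei Lower_def nucleus_closed subset_iff intro: great lower)
  ultimately show "\<exists>i. greatest (nuclei L) i (Lower (nuclei L) S)" by blast
qed


lemma meet_nuclei:
  assumes m: "m \<in> carrier (nuclei L)" and n: "n \<in> carrier (nuclei L)" and a: "a \<in> carrier L"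
  shows "(m \<sqinter>\<^bsub>nuclei L\<^esub> n) a = m a \<sqinter> n a"
proof -
  let ?i = "m \<sqinter>\<^bsub>nuclei L\<^esub> n"
  let ?j = "\<lambda>a\<in>carrier L. m a \<sqinter> n a"
  interpret N: complete_lattice "nuclei L" by (rule complete_lattice_nuclei)
  note c = nucleus_closed [OF m] nucleus_closed [OF n]
  have "?j \<in> carrier (nuclei L)"
  proof (rule nucleusI)
    show "x \<sqsubseteq> ?j x" if "x \<in> carrier L" for x
      using that c nucleus_increasing m n by (auto simp: le_meet_iff)
    show "?j (x \<sqinter> y) = ?j x \<sqinter> ?j y" if "x \<in> carrier L" "y \<in> carrier L" for x y
      using that c nucleus_meet [OF m] nucleus_meet [OF n]
      by (simp add: meet_assoc) (metis meet_assoc meet_comm)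
    show "?j (?j x) \<sqsubseteq> ?j x" if "x \<in> carrier L" for x
    proof -
      let ?y = "m x \<sqinter> n x"
      have y: "?y \<in> carrier L" using that c by simp
      have "m ?y \<sqsubseteq> m x"
        using nucleus_mono [OF m y c(1) [OF that] meet_left] nucleus_idem [OF m that] c that by simp
      moreover have "n ?y \<sqsubseteq> n x"
        using nucleus_mono [OF n y c(2) [OF that] meet_right] nucleus_idem [OF n that] c that by simp
      ultimately have "m ?y \<sqinter> n ?y \<sqsubseteq> ?y"
        using y that c le_trans [OF meet_left [of "m ?y" "n ?y"], of "m x"]
          le_trans [OF meet_right [of "m ?y" "n ?y"], of "n x"] by (simp add: le_meet_iff)
      then show ?thesis using y that by simp
    qed
  qed (use c in auto)
  then have "?i = ?j"
    using c m n meet_left meet_right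
    by (intro N.meet_eqI) (auto simp: le_nuclei le_meet_iff nucleus_closed)
  then show ?thesis using a by simp
qed

lemma top_nuclei: "\<top>\<^bsub>nuclei L\<^esub> = (\<lambda>a\<in>carrier L. \<top>)"
proof -
  have "(\<lambda>a\<in>carrier L. \<top>) \<in> carrier (nuclei L)"
    by (rule nucleusI) (simp_all add: meet_self)
  moreover have "n \<sqsubseteq>\<^bsub>nuclei L\<^esub> (\<lambda>a\<in>carrier L. \<top>)" if "n \<in> carrier (nuclei L)" for n
    using nucleus_closed [OF that] by (simp add: le_nuclei)
  ultimately show ?thesis
    by (rule complete_lattice.top_eqI [OF complete_lattice_nuclei])
qed

lemma bottom_nuclei: "\<bottom>\<^bsub>nuclei L\<^esub> = (\<lambda>a\<in>carrier L. a)"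
proof -
  have "(\<lambda>a\<in>carrier L. a) \<in> carrier (nuclei L)"
    by (rule nucleusI) simp_all
  moreover have "(\<lambda>a\<in>carrier L. a) \<sqsubseteq>\<^bsub>nuclei L\<^esub> n" if "n \<in> carrier (nuclei L)" for n
    using nucleus_increasing [OF that] by (simp add: le_nuclei)
  ultimately show ?thesis
    by (rule complete_lattice.bottom_eqI [OF complete_lattice_nuclei])
qed

sublocale N: complete_lattice "nuclei L"
  by (rule complete_lattice_nuclei)

subsection \<open>Open parts of the dissolution and their complements\<close>

lemma nu_nucleus: "u \<in> carrier L \<Longrightarrow> nu L u \<in> carrier (nuclei L)"
proof (rule nucleusI)
  assume u: "u \<in> carrier L"
  show "nu L u (nu L u a) \<sqsubseteq> nu L u a" if "a \<in> carrier L" for a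
    using u that join_left by (simp add: nu_def join_le_iff)
qed (auto simp: nu_def join_right join_meet_distrib)

lemma nu_mono: "\<lbrakk>u \<in> carrier L; v \<in> carrier L; u \<sqsubseteq> v\<rbrakk> \<Longrightarrow> nu L u \<sqsubseteq>\<^bsub>nuclei L\<^esub> nu L v"
  using join_left join_right
  by (auto simp: le_nuclei nu_def join_le_iff intro: le_trans [of _ v])

lemma nu_top: "nu L \<top> = \<top>\<^bsub>nuclei L\<^esub>"
  unfolding top_nuclei nu_def by (rule restrict_ext) (use top_join eq_is_equal in auto)

lemma nu_bottom: "nu L \<bottom> = \<bottom>\<^bsub>nuclei L\<^esub>"
  unfolding bottom_nuclei nu_def by (rule restrict_ext) (use bottom_join eq_is_equal in auto)

lemma nu_le_iff:
  assumes "u \<in> carrier L" "n \<in> carrier (nuclei L)"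
  shows "nu L u \<sqsubseteq>\<^bsub>nuclei L\<^esub> n \<longleftrightarrow> (\<forall>a\<in>carrier L. u \<sqsubseteq> n a)"
  using assms nucleus_increasing nucleus_closed by (auto simp: le_nuclei nu_def join_le_iff)

lemma meet_heyting_imp_le: "\<lbrakk>a \<in> carrier L; b \<in> carrier L\<rbrakk> \<Longrightarrow> a \<sqinter> heyting_imp L a b \<sqsubseteq> b"
  using le_heyting_imp_iff [of a b "heyting_imp L a b"] heyting_imp_closed by simp

lemma imp_nucleus_nucleus:
  assumes v: "v \<in> carrier L"
  shows "imp_nucleus L v \<in> carrier (nuclei L)"
proof (rule nucleusI)
  let ?i = "heyting_imp L v"
  show "a \<sqsubseteq> imp_nucleus L v a" if "a \<in> carrier L" for a
    using v that meet_right by (simp add: imp_nucleus_def le_heyting_imp_iff)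
  show "imp_nucleus L v (a \<sqinter> b) = imp_nucleus L v a \<sqinter> imp_nucleus L v b"
    if ab: "a \<in> carrier L" "b \<in> carrier L" for a b
  proof -
    have "?i a \<sqinter> ?i b = ?i (a \<sqinter> b)"
      by (rule meet_eqI) (use ab v heyting_imp_closed meet_heyting_imp_le [of v "a \<sqinter> b"] in
          \<open>auto simp: le_heyting_imp_iff le_meet_iff\<close>)
    then show ?thesis using ab by (simp add: imp_nucleus_def)
  qed
  show "imp_nucleus L v (imp_nucleus L v a) \<sqsubseteq> imp_nucleus L v a" if a: "a \<in> carrier L" for a
  proof -
    have "v \<sqinter> ?i (?i a) \<sqsubseteq> v \<sqinter> ?i a"
      using v a heyting_imp_closed meet_heyting_imp_le meet_left by (simp add: le_meet_iff)
    then have "v \<sqinter> ?i (?i a) \<sqsubseteq> a"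
      using v a heyting_imp_closed meet_heyting_imp_le le_trans by (meson meet_closed)
    then show ?thesis
      using v a heyting_imp_closed by (simp add: imp_nucleus_def le_heyting_imp_iff)
  qed
qed (auto simp: imp_nucleus_def heyting_imp_closed)

lemma meet_heyting_imp_join_le:
  assumes "v \<in> carrier L" "b \<in> carrier L"
  shows "(v \<squnion> b) \<sqinter> heyting_imp L v b \<sqsubseteq> b"
proof -
  have "(v \<squnion> b) \<sqinter> heyting_imp L v b = (v \<sqinter> heyting_imp L v b) \<squnion> (heyting_imp L v b \<sqinter> b)"
    using assms heyting_imp_closed meet_join_distrib [of "heyting_imp L v b" v b]
    by (simp add: meet_comm [of L "heyting_imp L v b"])
  then show ?thesis
    using assms heyting_imp_closed meet_heyting_imp_le meet_right by (simp add: join_le_iff)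
qed

lemma nu_meet_imp_nucleus:
  assumes v: "v \<in> carrier L"
  shows "nu L v \<sqinter>\<^bsub>nuclei L\<^esub> imp_nucleus L v = \<bottom>\<^bsub>nuclei L\<^esub>"
proof (rule N.bottom_eqI [symmetric])
  show "nu L v \<sqinter>\<^bsub>nuclei L\<^esub> imp_nucleus L v \<sqsubseteq>\<^bsub>nuclei L\<^esub> n" if n: "n \<in> carrier (nuclei L)" for n
    unfolding le_nuclei
  proof
    fix b assume b: "b \<in> carrier L"
    have "(nu L v \<sqinter>\<^bsub>nuclei L\<^esub> imp_nucleus L v) b = (v \<squnion> b) \<sqinter> heyting_imp L v b"
      using v b nu_nucleus imp_nucleus_nucleus
      by (simp add: meet_nuclei) (simp add: nu_def imp_nucleus_def)
    then show "(nu L v \<sqinter>\<^bsub>nuclei L\<^esub> imp_nucleus L v) b \<sqsubseteq> n b"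
      using le_trans [OF meet_heyting_imp_join_le [OF v b] nucleus_increasing [OF n b]]
        v b heyting_imp_closed nucleus_closed [OF n] by simp
  qed
qed (use v nu_nucleus imp_nucleus_nucleus in simp)

text \<open>Complements have to be unique for the description operator in \<^const>\<open>frame_complement\<close> to pick one.
  If a nucleus \<open>n\<close> is complementary to \<open>\<nu>\<^sub>v\<close>, then \<open>b \<mapsto> n (v \<squnion> b)\<close> is a nucleus above both, hence
  the top one. This gives \<open>n v = \<top>\<close>, and with it \<open>n b \<ge> n (v \<sqinter> (v \<rightarrow> b)) = n (v \<rightarrow> b)\<close>.\<close>

lemma nucleus_top_of_join_nu:
  assumes v: "v \<in> carrier L" and n: "n \<in> carrier (nuclei L)"
    and top: "nu L v \<squnion>\<^bsub>nuclei L\<^esub> n = \<top>\<^bsub>nuclei L\<^esub>"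
  shows "n v = \<top>"
proof -
  define r where "r = (\<lambda>b\<in>carrier L. n (v \<squnion> b))"
  note c = nucleus_closed [OF n]
  have v_le: "v \<sqsubseteq> n (v \<squnion> b)" and b_le: "b \<sqsubseteq> n (v \<squnion> b)" if "b \<in> carrier L" for b
    using v that c nucleus_increasing [OF n, of "v \<squnion> b"]
    by (simp_all add: join_le_iff)
  have "r \<in> carrier (nuclei L)"
  proof (rule nucleusI)
    show "r (a \<sqinter> b) = r a \<sqinter> r b" if "a \<in> carrier L" "b \<in> carrier L" for a b
      using that v nucleus_meet [OF n, of "v \<squnion> a" "v \<squnion> b"] join_meet_distrib [of v a b]
      by (simp add: r_def)
    show "r (r a) \<sqsubseteq> r a" if "a \<in> carrier L" for a
    proof -
      have "v \<squnion> n (v \<squnion> a) = n (v \<squnion> a)"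
        using v_le [OF that] that v c by (simp add: le_iff_meet [symmetric])
      then show ?thesis
        using that v c nucleus_idem [OF n] by (simp add: r_def)
    qed
  qed (use v c b_le in \<open>auto simp: r_def\<close>)
  moreover have "nu L v \<sqsubseteq>\<^bsub>nuclei L\<^esub> r"
    using v_le v by (simp add: nu_le_iff calculation) (simp add: r_def)
  moreover have "n \<sqsubseteq>\<^bsub>nuclei L\<^esub> r"
    using v nucleus_mono [OF n] join_right by (simp add: le_nuclei r_def)
  ultimately have "\<top>\<^bsub>nuclei L\<^esub> \<sqsubseteq>\<^bsub>nuclei L\<^esub> r"
    using v n nu_nucleus by (simp flip: top add: N.join_le_iff)
  then have "\<top> \<sqsubseteq> n (v \<squnion> v)"
    using v by (simp add: le_nuclei top_nuclei r_def)
  moreover have "v \<squnion> v = v"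
    using v le_iff_meet by auto
  ultimately show ?thesis
    using c [OF v] v by (simp add: eq_iff_le)
qed

text \<open>The join of nuclei has no pointwise formula, but a nucleus \<open>q\<close> above both parts can be tested at
  its fixed points \<open>q b\<close>. There \<open>v \<sqsubseteq> q b\<close>, so \<open>v \<rightarrow> q b = \<top>\<close> and the difference takes the value \<open>u \<squnion> q b\<close>.\<close>

lemma nu_diff_join_nu:
  assumes u: "u \<in> carrier L" and v: "v \<in> carrier L"
  shows "(nu L u \<sqinter>\<^bsub>nuclei L\<^esub> imp_nucleus L v) \<squnion>\<^bsub>nuclei L\<^esub> nu L v = nu L (u \<squnion> v)"
proof (rule N.join_eqI)
  let ?d = "nu L u \<sqinter>\<^bsub>nuclei L\<^esub> imp_nucleus L v"
  have dc: "?d \<in> carrier (nuclei L)"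
    using u v nu_nucleus imp_nucleus_nucleus by simp
  show "nu L v \<sqsubseteq>\<^bsub>nuclei L\<^esub> nu L (u \<squnion> v)"
    using u v join_right by (simp add: nu_mono)
  show "?d \<sqsubseteq>\<^bsub>nuclei L\<^esub> nu L (u \<squnion> v)"
    using N.le_trans [OF N.meet_left nu_mono, of u "imp_nucleus L v" "u \<squnion> v"]
      u v join_left nu_nucleus imp_nucleus_nucleus by simp
  fix q assume q: "q \<in> carrier (nuclei L)" "?d \<sqsubseteq>\<^bsub>nuclei L\<^esub> q" "nu L v \<sqsubseteq>\<^bsub>nuclei L\<^esub> q"
  show "nu L (u \<squnion> v) \<sqsubseteq>\<^bsub>nuclei L\<^esub> q"
    unfolding nu_le_iff [OF join_closed [OF u v] q(1)]
  proof
    fix b assume b: "b \<in> carrier L"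
    note qb = nucleus_closed [OF q(1) b]
    have vq: "v \<sqsubseteq> q b"
      using q(3) b by (simp add: nu_le_iff [OF v q(1)])
    then have "heyting_imp L v (q b) = \<top>"
      using v qb heyting_imp_closed le_heyting_imp_iff [of v "q b" \<top>]
        le_trans [OF meet_left [of v \<top>], of "q b"] by (simp add: eq_iff_le)
    then have "?d (q b) = (u \<squnion> q b) \<sqinter> \<top>"
      using u v qb nu_nucleus imp_nucleus_nucleus
      by (simp add: meet_nuclei) (simp add: nu_def imp_nucleus_def)
    moreover have "?d (q b) \<sqsubseteq> q (q b)"
      using q(2) qb by (simp add: le_nuclei)
    moreover have "u \<sqsubseteq> (u \<squnion> q b) \<sqinter> \<top>"
      using u qb join_left by (simp add: le_meet_iff)
    ultimately have "u \<sqsubseteq> q b"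
      using nucleus_idem [OF q(1) b] qb u le_trans [of u "(u \<squnion> q b) \<sqinter> \<top>" "q b"] by simp
    then show "u \<squnion> v \<sqsubseteq> q b" using vq u v qb by (simp add: join_le_iff)
  qed
qed (use u v nu_nucleus imp_nucleus_nucleus in auto)

lemma nu_join_imp_nucleus:
  assumes v: "v \<in> carrier L"
  shows "nu L v \<squnion>\<^bsub>nuclei L\<^esub> imp_nucleus L v = \<top>\<^bsub>nuclei L\<^esub>"
proof -
  have "\<top>\<^bsub>nuclei L\<^esub> \<sqinter>\<^bsub>nuclei L\<^esub> imp_nucleus L v = imp_nucleus L v"
    using v imp_nucleus_nucleus by (intro N.meet_eqI) auto
  moreover have "\<top> \<squnion> v = \<top>"
    using v by (intro join_eqI) auto
  ultimately show ?thesis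
    using nu_diff_join_nu [of \<top> v] v by (simp add: nu_top join_comm [of "nuclei L"])
qed

lemma frame_complement_nu:
  assumes v: "v \<in> carrier L"
  shows "frame_complement (nuclei L) (nu L v) = imp_nucleus L v"
  unfolding frame_complement_def
proof (rule the_equality)
  fix n assume n: "n \<in> carrier (nuclei L) \<and> nu L v \<sqinter>\<^bsub>nuclei L\<^esub> n = \<bottom>\<^bsub>nuclei L\<^esub> \<and>
    nu L v \<squnion>\<^bsub>nuclei L\<^esub> n = \<top>\<^bsub>nuclei L\<^esub>"
  then have nc: "n \<in> carrier (nuclei L)" and ntop: "n v = \<top>"
    using nucleus_top_of_join_nu [OF v] by auto
  show "n = imp_nucleus L v"
  proof (rule N.le_antisym)
    show "n \<sqsubseteq>\<^bsub>nuclei L\<^esub> imp_nucleus L v"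
      unfolding le_nuclei
    proof
      fix b assume b: "b \<in> carrier L"
      have "(nu L v \<sqinter>\<^bsub>nuclei L\<^esub> n) b = b"
        using n b by (simp add: bottom_nuclei)
      then have "(v \<squnion> b) \<sqinter> n b = b"
        using meet_nuclei [OF nu_nucleus [OF v] nc b] b by (simp add: nu_def)
      moreover have "v \<sqinter> n b \<sqsubseteq> (v \<squnion> b) \<sqinter> n b"
        using v b nucleus_closed [OF nc] join_left [of v b] meet_left [of v "n b"] meet_right [of v "n b"]
          le_trans [of "v \<sqinter> n b" v "v \<squnion> b"] by (simp add: le_meet_iff)
      ultimately show "n b \<sqsubseteq> imp_nucleus L v b"
        using v b nucleus_closed [OF nc] by (simp add: imp_nucleus_def le_heyting_imp_iff)
    qed
    show "imp_nucleus L v \<sqsubseteq>\<^bsub>nuclei L\<^esub> n"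
      unfolding le_nuclei
    proof
      fix b assume b: "b \<in> carrier L"
      let ?i = "heyting_imp L v b"
      have "n (v \<sqinter> ?i) = \<top> \<sqinter> n ?i"
        using nucleus_meet [OF nc v heyting_imp_closed] ntop by simp
      also have "\<dots> = n ?i"
        using nucleus_closed [OF nc heyting_imp_closed] by (intro meet_eqI) auto
      finally have "n ?i \<sqsubseteq> n b"
        using nucleus_mono [OF nc _ b meet_heyting_imp_le [OF v b]] v heyting_imp_closed by simp
      then show "imp_nucleus L v b \<sqsubseteq> n b"
        using nucleus_increasing [OF nc heyting_imp_closed] b nucleus_closed [OF nc]
          le_trans [of ?i "n ?i" "n b"] heyting_imp_closed by (simp add: imp_nucleus_def)
    qed
  qed (use nc imp_nucleus_nucleus v in auto)
qed (use v imp_nucleus_nucleus nu_meet_imp_nucleus nu_join_imp_nucleus in simp)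

lemma delta_diff_eq:
  "v \<in> carrier L \<Longrightarrow> delta_diff L u v = nu L u \<sqinter>\<^bsub>nuclei L\<^esub> imp_nucleus L v"
  by (simp add: delta_diff_def frame_complement_nu)

context
  fixes u v assumes u: "u \<in> carrier L" and v: "v \<in> carrier L"
begin

lemma delta_diff_closed: "delta_diff L u v \<in> carrier (nuclei L)"
  using u v nu_nucleus imp_nucleus_nucleus by (simp add: delta_diff_eq)

lemma delta_diff_le_nu: "delta_diff L u v \<sqsubseteq>\<^bsub>nuclei L\<^esub> nu L u"
  using u v nu_nucleus imp_nucleus_nucleus N.meet_left by (simp add: delta_diff_eq)

lemma delta_diff_join_nu: "delta_diff L u v \<squnion>\<^bsub>nuclei L\<^esub> nu L v = nu L (u \<squnion> v)"
  using u v nu_diff_join_nu by (simp add: delta_diff_eq)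

lemma delta_diff_meet_nu: "delta_diff L u v \<sqinter>\<^bsub>nuclei L\<^esub> nu L v = \<bottom>\<^bsub>nuclei L\<^esub>"
proof -
  have "delta_diff L u v \<sqinter>\<^bsub>nuclei L\<^esub> nu L v
      = nu L u \<sqinter>\<^bsub>nuclei L\<^esub> (nu L v \<sqinter>\<^bsub>nuclei L\<^esub> imp_nucleus L v)"
    using u v nu_nucleus imp_nucleus_nucleus
    by (simp add: delta_diff_eq N.meet_assoc meet_comm [of "nuclei L" "imp_nucleus L v"])
  also have "\<dots> = \<bottom>\<^bsub>nuclei L\<^esub>"
    using u v nu_nucleus by (simp add: nu_meet_imp_nucleus, intro N.meet_eqI) auto
  finally show ?thesis .
qed

end

text \<open>The locally closed parts generate the dissolution: as \<open>a \<sqinter> (a \<rightarrow> b) \<sqsubseteq> b\<close>, the part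
  \<open>\<delta>\<^sup>-\<^sup>1(n a) - \<delta>\<^sup>-\<^sup>1(a)\<close> lies below \<open>n\<close>, and its value at \<open>a\<close> is at least \<open>n a\<close>.\<close>

lemma nucleus_eq_sup_delta_diff:
  assumes n: "n \<in> carrier (nuclei L)"
  shows "n = \<Squnion>\<^bsub>nuclei L\<^esub>((\<lambda>a. delta_diff L (n a) a) ` carrier L)"
proof (rule N.sup_eqI [symmetric])
  note c = nucleus_closed [OF n]
  show "(\<lambda>a. delta_diff L (n a) a) ` carrier L \<subseteq> carrier (nuclei L)"
    using c delta_diff_closed by auto
  have app: "delta_diff L (n a) a b = (n a \<squnion> b) \<sqinter> heyting_imp L a b"
    if "a \<in> carrier L" "b \<in> carrier L" for a b
    using that c nu_nucleus imp_nucleus_nucleus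
    by (simp add: delta_diff_eq meet_nuclei) (simp add: nu_def imp_nucleus_def)
  fix d assume "d \<in> (\<lambda>a. delta_diff L (n a) a) ` carrier L"
  then obtain a where a: "a \<in> carrier L" "d = delta_diff L (n a) a" by blast
  show "d \<sqsubseteq>\<^bsub>nuclei L\<^esub> n"
    unfolding le_nuclei
  proof
    fix b assume b: "b \<in> carrier L"
    let ?i = "heyting_imp L a b"
    have ic: "?i \<in> carrier L" by (rule heyting_imp_closed)
    have "n a \<sqinter> ?i \<sqsubseteq> n a \<sqinter> n ?i"
      using a ic c nucleus_increasing [OF n ic] meet_left [of "n a" ?i] meet_right [of "n a" ?i]
        le_trans [of "n a \<sqinter> ?i" ?i "n ?i"] by (simp add: le_meet_iff)
    also have "n a \<sqinter> n ?i = n (a \<sqinter> ?i)"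
      using nucleus_meet [OF n a(1) ic] by simp
    also have "\<dots> \<sqsubseteq> n b"
      using nucleus_mono [OF n _ b meet_heyting_imp_le [OF a(1) b]] a ic by simp
    finally have "n a \<sqinter> ?i \<sqsubseteq> n b"
      using a b ic c by simp
    moreover have "b \<sqinter> ?i \<sqsubseteq> n b"
      using le_trans [OF meet_left [OF b ic] nucleus_increasing [OF n b]] b ic c by simp
    moreover have "(n a \<squnion> b) \<sqinter> ?i = (n a \<sqinter> ?i) \<squnion> (b \<sqinter> ?i)"
      using a b c ic meet_join_distrib [of ?i "n a" b] by (simp add: meet_comm [of L ?i])
    ultimately show "d b \<sqsubseteq> n b"
      using a b c ic by (simp add: app join_le_iff)
  qed
next
  fix q assume q: "q \<in> carrier (nuclei L)"
    "\<And>d. d \<in> (\<lambda>a. delta_diff L (n a) a) ` carrier L \<Longrightarrow> d \<sqsubseteq>\<^bsub>nuclei L\<^esub> q"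
  show "n \<sqsubseteq>\<^bsub>nuclei L\<^esub> q"
    unfolding le_nuclei
  proof
    fix a assume a: "a \<in> carrier L"
    note na = nucleus_closed [OF n a]
    have "delta_diff L (n a) a a = (n a \<squnion> a) \<sqinter> heyting_imp L a a"
      using a na nu_nucleus imp_nucleus_nucleus
      by (simp add: delta_diff_eq meet_nuclei) (simp add: nu_def imp_nucleus_def)
    moreover have "n a \<sqsubseteq> heyting_imp L a a"
      using a na meet_left by (simp add: le_heyting_imp_iff)
    ultimately have "n a \<sqsubseteq> delta_diff L (n a) a a"
      using a na join_left heyting_imp_closed by (simp add: le_meet_iff)
    moreover have "delta_diff L (n a) a a \<sqsubseteq> q a"
      using q(2) a by (auto simp: le_nuclei)
    ultimately show "n a \<sqsubseteq> q a"
      using a na nucleus_closed [OF q(1) a] nucleus_closed [OF delta_diff_closed [OF na a] a]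
        le_trans by blast
  qed
qed (use n in auto)

end

section \<open>Front topologies and points\<close>

lemma openin_front:
  "openin (front_topology Y) =
     arbitrary union_of (\<lambda>S. \<exists>U C. openin Y U \<and> closedin Y C \<and> S = U \<inter> C)"
  unfolding front_topology_def
proof (rule topology_inverse', rule istopology_base)
  fix S T
  assume "\<exists>U C. openin Y U \<and> closedin Y C \<and> S = U \<inter> C" "\<exists>U C. openin Y U \<and> closedin Y C \<and> T = U \<inter> C"
  then obtain U C V D where "openin Y U" "closedin Y C" "S = U \<inter> C" "openin Y V" "closedin Y D" "T = V \<inter> D"
    by blast
  then have "openin Y (U \<inter> V)" "closedin Y (C \<inter> D)" "S \<inter> T = (U \<inter> V) \<inter> (C \<inter> D)"
    by auto
  then show "\<exists>U C. openin Y U \<and> closedin Y C \<and> S \<inter> T = U \<inter> C" by blast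
qed

lemma openin_front_locally_closed:
  "\<lbrakk>openin Y U; closedin Y C\<rbrakk> \<Longrightarrow> openin (front_topology Y) (U \<inter> C)"
  unfolding openin_front by (rule union_of_inc) (auto simp: arbitrary_def)

lemma openin_front_of_open: "openin Y U \<Longrightarrow> openin (front_topology Y) U"
  using openin_front_locally_closed [OF _ closedin_topspace, of Y U]
  by (simp add: inf.absorb1 openin_subset)

lemma openin_front_diff:
  assumes "openin Y U" "openin Y V"
  shows "openin (front_topology Y) (U - V)"
proof -
  have "U - V = U \<inter> (topspace Y - V)" using openin_subset [OF assms(1)] by blast
  then show ?thesis
    using assms by (simp add: openin_front_locally_closed closedin_diff)
qed

text \<open>The intersection of an open and a closed set is a difference of two opens, so these differences
  form a base.\<close>

lemma openin_front_cases:
  assumes "openin (front_topology Y) S" "x \<in> S"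
  obtains U V where "openin Y U" "openin Y V" "x \<in> U - V" "U - V \<subseteq> S"
proof -
  obtain K where K: "\<Union>K = S" "K \<subseteq> {S. \<exists>U C. openin Y U \<and> closedin Y C \<and> S = U \<inter> C}"
    using assms(1) by (auto simp: openin_front union_of_def)
  then obtain T where T: "x \<in> T" "T \<in> K" using assms(2) by blast
  then obtain U C where UC: "openin Y U" "closedin Y C" "T = U \<inter> C" using K(2) by blast
  then have "U - (topspace Y - C) = T" using openin_subset [of Y U] by blast
  moreover have "T \<subseteq> S" using K(1) T(2) by blast
  ultimately show ?thesis
    using T UC that [of U "topspace Y - C"] by (simp add: openin_diff)
qed

lemma topspace_front [simp]: "topspace (front_topology Y) = topspace Y"
proof
  show "topspace (front_topology Y) \<subseteq> topspace Y"
  proof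
    fix x assume x: "x \<in> topspace (front_topology Y)"
    obtain U V where "openin Y U" "openin Y V" "x \<in> U - V" "U - V \<subseteq> topspace (front_topology Y)"
      by (rule openin_front_cases [OF openin_topspace x])
    then show "x \<in> topspace Y" using openin_subset by blast
  qed
  show "topspace Y \<subseteq> topspace (front_topology Y)"
    by (rule openin_subset) (simp add: openin_front_of_open)
qed

text \<open>Preimages commute with differences, so a continuous map is continuous for the front topologies.\<close>

lemma frame_hom_preimage_front:
  assumes f: "f ` topspace X \<subseteq> topspace Y"
    and cont: "\<And>U. openin Y U \<Longrightarrow> openin X {x \<in> topspace X. f x \<in> U}"
  shows "frame_hom (opens (front_topology Y)) (opens (front_topology X)) (\<lambda>S. {x \<in> topspace X. f x \<in> S})"
proof -
  have op: "openin (front_topology X) {x \<in> topspace X. f x \<in> S}" if S: "openin (front_topology Y) S" for S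
  proof (subst openin_subopen, safe)
    fix x assume x: "x \<in> topspace X" "f x \<in> S"
    obtain U V where UV: "openin Y U" "openin Y V" "f x \<in> U - V" "U - V \<subseteq> S"
      by (rule openin_front_cases [OF S x(2)])
    let ?T = "{x \<in> topspace X. f x \<in> U} - {x \<in> topspace X. f x \<in> V}"
    have "openin (front_topology X) ?T" "x \<in> ?T" "?T \<subseteq> {x \<in> topspace X. f x \<in> S}"
      using UV cont x(1) by (auto intro: openin_front_diff)
    then show "\<exists>T. openin (front_topology X) T \<and> x \<in> T \<and> T \<subseteq> {x \<in> topspace X. f x \<in> S}" by blast
  qed
  show ?thesis
    unfolding frame_hom_def
  proof (intro conjI ballI allI impI)
    fix C assume C: "C \<subseteq> carrier (opens (front_topology Y))"
    then have "(\<lambda>S. {x \<in> topspace X. f x \<in> S}) ` C \<subseteq> {U. openin (front_topology X) U}"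
      using op by (auto simp: carrier_opens)
    then show "{x \<in> topspace X. f x \<in> \<Squnion>\<^bsub>opens (front_topology Y)\<^esub>C} =
        \<Squnion>\<^bsub>opens (front_topology X)\<^esub>((\<lambda>S. {x \<in> topspace X. f x \<in> S}) ` C)"
      using C by (auto simp: carrier_opens sup_opens)
  qed (use op f in \<open>auto simp: carrier_opens top_opens meet_opens\<close>)
qed

subsection \<open>Extending a frame morphism into open sets along the dissolution\<close>

text \<open>The value at \<open>n\<close> that is forced on any frame morphism extending \<open>\<phi>\<close> along \<open>\<nu>\<close>, since \<open>n\<close> is the join of the
  differences of \<open>\<nu>\<close> at \<open>n a\<close> and \<open>\<nu>\<close> at \<open>a\<close>.\<close>

definition front_extension :: "('a, 'c) gorder_scheme \<Rightarrow> ('a \<Rightarrow> 'p set) \<Rightarrow> ('a \<Rightarrow> 'a) \<Rightarrow> 'p set" where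
  "front_extension L \<phi> n = (\<Union>a\<in>carrier L. \<phi> (n a) - \<phi> a)"

context frame
begin

text \<open>Every frame morphism out of the nuclei turns the complement of \<open>\<nu>\<^sub>v\<close> into a complement, so it is
  determined on locally closed parts, and these generate.\<close>

lemma
  assumes hom: "frame_hom (nuclei L) (opens (front_topology X)) h"
    and nu: "\<And>a. a \<in> carrier L \<Longrightarrow> h (nu L a) = \<phi> a"
  shows frame_hom_delta_diff:
      "\<lbrakk>u \<in> carrier L; v \<in> carrier L\<rbrakk> \<Longrightarrow> h (delta_diff L u v) = \<phi> u - \<phi> v"
    and frame_hom_eq_front_extension:
      "n \<in> carrier (nuclei L) \<Longrightarrow> h n = front_extension L \<phi> n"
proof -
  let ?O = "opens (front_topology X)"
  have op: "openin (front_topology X) (h n)" if "n \<in> carrier (nuclei L)" for n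
    using frame_hom_carrier [OF hom that] by (simp add: carrier_opens)
  show dd: "h (delta_diff L u v) = \<phi> u - \<phi> v" if u: "u \<in> carrier L" and v: "v \<in> carrier L" for u v
  proof -
    note c = nu_nucleus [OF v] imp_nucleus_nucleus [OF v] nu_nucleus [OF u]
    have "h (nu L v \<sqinter>\<^bsub>nuclei L\<^esub> imp_nucleus L v) = {}"
      using nu_meet_imp_nucleus [OF v] frame_hom_bottom [OF complete_lattice_nuclei complete_lattice_opens hom]
      by (simp add: bottom_opens)
    then have "h (nu L v) \<inter> h (imp_nucleus L v) = {}"
      using hom c op by (simp add: frame_hom_def meet_opens)
    moreover have "h (nu L v) \<union> h (imp_nucleus L v) = topspace X"
      using nu_join_imp_nucleus [OF v] frame_hom_join [OF hom c(1,2)] hom op c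
      by (simp add: frame_hom_def top_opens join_opens)
    moreover have "h (delta_diff L u v) = h (nu L u) \<inter> h (imp_nucleus L v)"
      using hom c op v by (simp add: delta_diff_eq frame_hom_def meet_opens)
    moreover have "h (nu L u) \<subseteq> topspace X"
      using openin_subset [OF op [OF c(3)]] by simp
    ultimately show ?thesis
      using nu [OF u] nu [OF v] by blast
  qed
  show "h n = front_extension L \<phi> n" if n: "n \<in> carrier (nuclei L)"
  proof -
    let ?D = "(\<lambda>a. delta_diff L (n a) a) ` carrier L"
    have D: "?D \<subseteq> carrier (nuclei L)"
      using nucleus_closed [OF n] delta_diff_closed by auto
    have "h n = h (\<Squnion>\<^bsub>nuclei L\<^esub>?D)"
      using nucleus_eq_sup_delta_diff [OF n] by simp
    also have "\<dots> = \<Squnion>\<^bsub>?O\<^esub>(h ` ?D)"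
      using hom D by (auto simp: frame_hom_def)
    also have "\<dots> = \<Union>(h ` ?D)"
      using D op by (intro sup_opens) auto
    also have "\<dots> = front_extension L \<phi> n"
      using dd nucleus_closed [OF n] by (simp add: front_extension_def image_comp)
    finally show ?thesis .
  qed
qed

context
  fixes X :: "'p topology" and \<phi> assumes hom: "frame_hom L (opens X) \<phi>"
begin

lemma to_opens_open: "a \<in> carrier L \<Longrightarrow> openin X (\<phi> a)"
  using frame_hom_carrier [OF hom] by (simp add: carrier_opens)

lemma to_opens_mono: "\<lbrakk>a \<in> carrier L; b \<in> carrier L; a \<sqsubseteq> b\<rbrakk> \<Longrightarrow> \<phi> a \<subseteq> \<phi> b"
  using frame_hom_mono [OF complete_lattice_axioms complete_lattice_opens hom] by (simp add: le_opens)

lemma to_opens_meet: "\<lbrakk>a \<in> carrier L; b \<in> carrier L\<rbrakk> \<Longrightarrow> \<phi> (a \<sqinter> b) = \<phi> a \<inter> \<phi> b"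
  using hom to_opens_open by (simp add: frame_hom_def meet_opens)

lemma to_opens_join: "\<lbrakk>a \<in> carrier L; b \<in> carrier L\<rbrakk> \<Longrightarrow> \<phi> (a \<squnion> b) = \<phi> a \<union> \<phi> b"
  using frame_hom_join [OF hom] to_opens_open by (simp add: join_opens)

lemma to_opens_sup: "S \<subseteq> carrier L \<Longrightarrow> \<phi> (\<Squnion>S) = \<Union>(\<phi> ` S)"
  using hom to_opens_open by (subst sup_opens [symmetric, of _ X]) (auto simp: frame_hom_def)

lemma to_opens_top: "\<phi> \<top> = topspace X"
  using hom by (simp add: frame_hom_def top_opens)

text \<open>For a point \<open>x\<close>, let \<open>c\<close> be the join of all \<open>a\<close> with \<open>x \<notin> \<phi> a\<close>. The nucleus sending \<open>a\<close> to \<open>\<top>\<close> if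
  \<open>x \<in> \<phi> a\<close> and to \<open>c\<close> otherwise is the largest nucleus whose extension misses \<open>x\<close>; this
  is why extension preserves joins.\<close>

lemma ex_nucleus_avoiding_point:
  assumes x: "x \<in> topspace X"
  obtains m where "m \<in> carrier (nuclei L)"
    and "\<And>n. n \<in> carrier (nuclei L) \<Longrightarrow> n \<sqsubseteq>\<^bsub>nuclei L\<^esub> m \<longleftrightarrow> x \<notin> front_extension L \<phi> n"
proof -
  define c where "c = \<Squnion>{a \<in> carrier L. x \<notin> \<phi> a}"
  have c: "c \<in> carrier L" and xc: "x \<notin> \<phi> c"
    by (auto simp: c_def to_opens_sup intro: sup_closed)
  have le_c: "a \<sqsubseteq> c \<longleftrightarrow> x \<notin> \<phi> a" if "a \<in> carrier L" for a
    using that xc to_opens_mono [OF that c] by (auto simp: c_def intro: sup_upper)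
  define m where "m = (\<lambda>a\<in>carrier L. if x \<in> \<phi> a then \<top> else c)"
  have m: "m \<in> carrier (nuclei L)"
  proof (rule nucleusI)
    show "m (a \<sqinter> b) = m a \<sqinter> m b" if "a \<in> carrier L" "b \<in> carrier L" for a b
    proof -
      have "\<top> \<sqinter> \<top> = \<top>" "c \<sqinter> c = c" "c \<sqinter> \<top> = c" "\<top> \<sqinter> c = c"
        using c by (auto intro!: meet_eqI)
      then show ?thesis using that by (simp add: m_def to_opens_meet)
    qed
  qed (use c xc le_c x in \<open>auto simp: m_def to_opens_top\<close>)
  moreover have "n \<sqsubseteq>\<^bsub>nuclei L\<^esub> m \<longleftrightarrow> x \<notin> front_extension L \<phi> n"
    if n: "n \<in> carrier (nuclei L)" for n
  proof -
    have "n a \<sqsubseteq> m a \<longleftrightarrow> (x \<in> \<phi> (n a) \<longrightarrow> x \<in> \<phi> a)" if "a \<in> carrier L" for a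
      using that le_c [of "n a"] nucleus_closed [OF n that] by (simp add: m_def)
    then show ?thesis by (auto simp: le_nuclei front_extension_def)
  qed
  ultimately show ?thesis using that by blast
qed

lemma front_extension_open:
  assumes "n \<in> carrier (nuclei L)"
  shows "openin (front_topology X) (front_extension L \<phi> n)"
  unfolding front_extension_def
  using nucleus_closed [OF assms] by (auto intro!: openin_front_diff to_opens_open)

lemma front_extension_subset:
  "n \<in> carrier (nuclei L) \<Longrightarrow> front_extension L \<phi> n \<subseteq> topspace X"
  using openin_subset [OF front_extension_open] by simp

lemma front_extension_nu:
  assumes u: "u \<in> carrier L"
  shows "front_extension L \<phi> (nu L u) = \<phi> u"
proof -
  have "\<phi> (nu L u a) = \<phi> u \<union> \<phi> a" if "a \<in> carrier L" for a
    using that u by (simp add: nu_def to_opens_join)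
  moreover have "\<phi> \<bottom> = {}"
    using to_opens_sup [of "{}"] by (simp add: sup_empty_eq)
  ultimately show ?thesis
    by (auto simp: front_extension_def)
qed

lemma frame_hom_front_extension:
  "frame_hom (nuclei L) (opens (front_topology X)) (front_extension L \<phi>)"
  unfolding frame_hom_def
proof (intro conjI ballI allI impI)
  let ?h = "front_extension L \<phi>"
  show "?h \<in> carrier (nuclei L) \<rightarrow> carrier (opens (front_topology X))"
    using front_extension_open by (auto simp: carrier_opens)
  show "?h \<top>\<^bsub>nuclei L\<^esub> = \<top>\<^bsub>opens (front_topology X)\<^esub>"
    using front_extension_nu [of \<top>] by (simp add: nu_top top_opens to_opens_top)
  show "?h (m \<sqinter>\<^bsub>nuclei L\<^esub> n) = ?h m \<sqinter>\<^bsub>opens (front_topology X)\<^esub> ?h n"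
    if m: "m \<in> carrier (nuclei L)" and n: "n \<in> carrier (nuclei L)" for m n
  proof -
    have app: "\<phi> ((m \<sqinter>\<^bsub>nuclei L\<^esub> n) a) = \<phi> (m a) \<inter> \<phi> (n a)" if "a \<in> carrier L" for a
      using that nucleus_closed [OF m] nucleus_closed [OF n] by (simp add: meet_nuclei m n to_opens_meet)
    have "x \<in> ?h (m \<sqinter>\<^bsub>nuclei L\<^esub> n)" if xm: "x \<in> ?h m" and xn: "x \<in> ?h n" for x
    proof -
      obtain a where a: "a \<in> carrier L" "x \<in> \<phi> (m a)" "x \<notin> \<phi> a"
        using xm by (auto simp: front_extension_def)
      obtain b where b: "b \<in> carrier L" "x \<in> \<phi> (n b)" "x \<notin> \<phi> b"
        using xn by (auto simp: front_extension_def)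
      note ab = a b
      \<comment> \<open>Two witnesses combine because \<open>x\<close> lies outside \<open>\<phi> a \<union> \<phi> b = \<phi> (a \<squnion> b)\<close>.\<close>
      have "m a \<sqsubseteq> m (a \<squnion> b)" "n b \<sqsubseteq> n (a \<squnion> b)"
        using ab join_left join_right nucleus_mono [OF m] nucleus_mono [OF n] by simp_all
      then have "x \<in> \<phi> (m (a \<squnion> b))" "x \<in> \<phi> (n (a \<squnion> b))"
        using ab to_opens_mono [of "m a" "m (a \<squnion> b)"] to_opens_mono [of "n b" "n (a \<squnion> b)"]
          nucleus_closed [OF m] nucleus_closed [OF n] by auto
      moreover have "x \<notin> \<phi> (a \<squnion> b)" "a \<squnion> b \<in> carrier L"
        using ab by (auto simp: to_opens_join)
      ultimately show ?thesis
        using app by (auto simp: front_extension_def)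
    qed
    moreover have "?h (m \<sqinter>\<^bsub>nuclei L\<^esub> n) \<subseteq> ?h m \<inter> ?h n"
      using app by (auto simp: front_extension_def)
    ultimately show ?thesis
      using m n front_extension_open by (subst meet_opens) auto
  qed
  show "?h (\<Squnion>\<^bsub>nuclei L\<^esub>S) = \<Squnion>\<^bsub>opens (front_topology X)\<^esub>(?h ` S)" if S: "S \<subseteq> carrier (nuclei L)" for S
  proof -
    have "x \<in> ?h (\<Squnion>\<^bsub>nuclei L\<^esub>S) \<longleftrightarrow> x \<in> \<Union>(?h ` S)" if x: "x \<in> topspace X" for x
    proof -
      obtain m where m: "m \<in> carrier (nuclei L)"
        "\<And>n. n \<in> carrier (nuclei L) \<Longrightarrow> n \<sqsubseteq>\<^bsub>nuclei L\<^esub> m \<longleftrightarrow> x \<notin> ?h n"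
        using ex_nucleus_avoiding_point [OF x] by metis
      have "\<Squnion>\<^bsub>nuclei L\<^esub>S \<sqsubseteq>\<^bsub>nuclei L\<^esub> m \<longleftrightarrow> (\<forall>n\<in>S. n \<sqsubseteq>\<^bsub>nuclei L\<^esub> m)"
      proof
        assume le: "\<Squnion>\<^bsub>nuclei L\<^esub>S \<sqsubseteq>\<^bsub>nuclei L\<^esub> m"
        show "\<forall>n\<in>S. n \<sqsubseteq>\<^bsub>nuclei L\<^esub> m"
          using S N.le_trans [OF N.sup_upper [OF S] le _ N.sup_closed [OF S] m(1)] by auto
      qed (use N.sup_least [OF S m(1)] in blast)
      moreover have "(\<forall>n\<in>S. n \<sqsubseteq>\<^bsub>nuclei L\<^esub> m) \<longleftrightarrow> (\<forall>n\<in>S. x \<notin> ?h n)"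
        using m(2) S by (intro ball_cong) auto
      ultimately show ?thesis
        using m(2) [OF N.sup_closed [OF S]] by blast
    qed
    moreover have "?h (\<Squnion>\<^bsub>nuclei L\<^esub>S) \<subseteq> topspace X" "\<Union>(?h ` S) \<subseteq> topspace X"
      using S front_extension_subset by auto
    ultimately have "?h (\<Squnion>\<^bsub>nuclei L\<^esub>S) = \<Union>(?h ` S)" by blast
    then show ?thesis
      using S front_extension_open by (subst sup_opens) auto
  qed
qed

lemma nuclei_extension_eq:
  "nuclei_extension L (opens (front_topology X)) \<phi> = restrict (front_extension L \<phi>) (carrier (nuclei L))"
  unfolding nuclei_extension_def
proof (rule the_equality)
  let ?h = "restrict (front_extension L \<phi>) (carrier (nuclei L))"
  have "frame_hom (nuclei L) (opens (front_topology X)) ?h"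
    using frame_hom_front_extension by (auto simp: frame_hom_def image_def subset_iff) 
  then show "?h \<in> extensional (carrier (nuclei L)) \<and> frame_hom (nuclei L) (opens (front_topology X)) ?h \<and>
      (\<forall>a\<in>carrier L. ?h (nu L a) = \<phi> a)"
    by (simp add: front_extension_nu nu_nucleus)
  fix h assume h: "h \<in> extensional (carrier (nuclei L)) \<and>
    frame_hom (nuclei L) (opens (front_topology X)) h \<and> (\<forall>a\<in>carrier L. h (nu L a) = \<phi> a)"
  then show "h = ?h"
    using frame_hom_eq_front_extension [of X h \<phi>]
    by (intro extensionalityI [of _ "carrier (nuclei L)"]) auto
qed

end

subsection \<open>The space of points\<close>

lemma
  shows pt_open_meet:
      "\<lbrakk>a \<in> carrier L; b \<in> carrier L\<rbrakk> \<Longrightarrow> pt_open L (a \<sqinter> b) = pt_open L a \<inter> pt_open L b"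
    and pt_open_sup: "S \<subseteq> carrier L \<Longrightarrow> pt_open L (\<Squnion>S) = \<Union>(pt_open L ` S)"
proof -
  have up: "b \<in> p" if "p \<in> points L" "a \<in> p" "b \<in> carrier L" "a \<sqsubseteq> b" for p a b
    using that unfolding points_def by blast
  show "pt_open L (a \<sqinter> b) = pt_open L a \<inter> pt_open L b" if ab: "a \<in> carrier L" "b \<in> carrier L" for a b
  proof -
    have "a \<sqinter> b \<in> p \<longleftrightarrow> a \<in> p \<and> b \<in> p" if p: "p \<in> points L" for p
      using up [OF p _ ab(1) meet_left [OF ab]] up [OF p _ ab(2) meet_right [OF ab]] p
      unfolding points_def by blast
    then show ?thesis unfolding pt_open_def by blast
  qed
  show "pt_open L (\<Squnion>S) = \<Union>(pt_open L ` S)" if S: "S \<subseteq> carrier L" for S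
  proof -
    have "\<Squnion>S \<in> p \<longleftrightarrow> (\<exists>x\<in>S. x \<in> p)" if p: "p \<in> points L" for p
      using up [OF p _ sup_closed [OF S] sup_upper [OF S]] p S unfolding points_def by blast
    then show ?thesis unfolding pt_open_def by blast
  qed
qed

lemma openin_pt: "openin (pt L) W \<longleftrightarrow> (\<exists>a\<in>carrier L. W = pt_open L a)"
proof -
  have "istopology (\<lambda>W. \<exists>a\<in>carrier L. W = pt_open L a)"
    unfolding istopology_def
  proof (intro conjI allI impI)
    show "\<exists>a\<in>carrier L. S \<inter> T = pt_open L a"
      if "\<exists>a\<in>carrier L. S = pt_open L a" "\<exists>a\<in>carrier L. T = pt_open L a" for S T
      using that pt_open_meet meet_closed by metis
    show "\<exists>a\<in>carrier L. \<Union>K = pt_open L a" if K: "\<forall>S\<in>K. \<exists>a\<in>carrier L. S = pt_open L a" for K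
    proof -
      let ?S = "{a \<in> carrier L. pt_open L a \<in> K}"
      have "K \<subseteq> pt_open L ` ?S"
      proof
        fix T assume "T \<in> K"
        moreover from this obtain a where "a \<in> carrier L" "T = pt_open L a" using K by blast
        ultimately show "T \<in> pt_open L ` ?S" by blast
      qed
      then have "K = pt_open L ` ?S" by auto
      then have "\<Union>K = \<Union>(pt_open L ` ?S)" by (rule arg_cong)
      also have "\<dots> = pt_open L (\<Squnion>?S)" by (rule pt_open_sup [symmetric]) auto
      finally show ?thesis by (intro bexI [of _ "\<Squnion>?S"]) auto
    qed
  qed
  then show ?thesis by (simp add: pt_def topology_inverse')
qed

lemma pt_open_top: "pt_open L \<top> = topspace (pt L)"
proof
  obtain a where "topspace (pt L) = pt_open L a"
    using openin_pt [of "topspace (pt L)"] by auto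
  moreover have "\<top> \<in> p" if "p \<in> points L" for p
    using that unfolding points_def by blast
  ultimately show "topspace (pt L) \<subseteq> pt_open L \<top>"
    unfolding pt_open_def by blast
qed (use openin_pt in \<open>auto intro!: openin_subset\<close>)

lemma frame_hom_pt_open: "frame_hom L (opens (pt L)) (pt_open L)"
  unfolding frame_hom_def
proof (intro conjI ballI allI impI)
  fix S assume S: "S \<subseteq> carrier L"
  then have "pt_open L ` S \<subseteq> {U. openin (pt L) U}" by (auto simp: openin_pt)
  then show "pt_open L (\<Squnion>S) = \<Squnion>\<^bsub>opens (pt L)\<^esub>(pt_open L ` S)"
    using S by (simp add: sup_opens pt_open_sup)
next
  have op: "openin (pt L) (pt_open L a)" if "a \<in> carrier L" for a
    using that openin_pt by blast
  then show "pt_open L \<in> carrier L \<rightarrow> carrier (opens (pt L))" by (simp add: carrier_opens)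
  show "pt_open L (a \<sqinter> b) = pt_open L a \<sqinter>\<^bsub>opens (pt L)\<^esub> pt_open L b"
    if "a \<in> carrier L" "b \<in> carrier L" for a b
    using that by (simp add: meet_opens [OF op op] pt_open_meet)
qed (simp add: top_opens pt_open_top)

lemmas k_map_eq = nuclei_extension_eq [OF frame_hom_pt_open, folded k_map_def]

lemma frame_hom_k_map: "frame_hom (nuclei L) (opens (front_topology (pt L))) (k_map L)"
proof -
  have "k_map L ` S = front_extension L (pt_open L) ` S" if "S \<subseteq> carrier (nuclei L)" for S
    using that by (auto simp: k_map_eq intro!: image_cong)
  then show ?thesis
    using frame_hom_front_extension [OF frame_hom_pt_open]
    by (auto simp: frame_hom_def k_map_eq)
qed

lemma k_map_nu: "a \<in> carrier L \<Longrightarrow> k_map L (nu L a) = pt_open L a"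
  by (simp add: k_map_eq nu_nucleus front_extension_nu [OF frame_hom_pt_open])

text \<open>Every front open of \<open>pt L\<close> is a union of differences of opens, each of which comes from a
  locally closed part of the dissolution.\<close>

lemma k_map_surj:
  assumes W: "openin (front_topology (pt L)) W"
  obtains n where "n \<in> carrier (nuclei L)" "k_map L n = W"
proof -
  note dd = frame_hom_delta_diff [OF frame_hom_k_map k_map_nu]
  let ?S = "{d. \<exists>u\<in>carrier L. \<exists>v\<in>carrier L. d = delta_diff L u v \<and> k_map L d \<subseteq> W}"
  have S: "?S \<subseteq> carrier (nuclei L)" using delta_diff_closed by auto
  have op: "k_map L ` ?S \<subseteq> {U. openin (front_topology (pt L)) U}"
    using S frame_hom_carrier [OF frame_hom_k_map] by (auto simp: carrier_opens)
  have "k_map L (\<Squnion>\<^bsub>nuclei L\<^esub>?S) = \<Union>(k_map L ` ?S)"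
    using frame_hom_k_map S sup_opens [OF op] by (simp add: frame_hom_def)
  also have "\<dots> = W"
  proof
    show "W \<subseteq> \<Union>(k_map L ` ?S)"
    proof
      fix p assume p: "p \<in> W"
      obtain U V where UV: "openin (pt L) U" "openin (pt L) V" "p \<in> U - V" "U - V \<subseteq> W"
        by (rule openin_front_cases [OF W p])
      then obtain u v where uv: "u \<in> carrier L" "v \<in> carrier L" "U = pt_open L u" "V = pt_open L v"
        by (auto simp: openin_pt)
      have "delta_diff L u v \<in> ?S" "p \<in> k_map L (delta_diff L u v)"
        using uv UV dd by auto
      then show "p \<in> \<Union>(k_map L ` ?S)" by blast
    qed
  qed auto
  finally show ?thesis using that N.sup_closed [OF S] by blast
qed

subsection \<open>Spatial locales and soberification\<close>

text \<open>The map \<open>X \<rightarrow> pt L\<close> that corresponds to a frame morphism \<open>\<phi>\<close> from \<open>L\<close> to the opens of \<open>X\<close>. If \<open>\<phi>\<close> is an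
  isomorphism, then it is the unit of soberification.\<close>

definition filter_of_point :: "('a \<Rightarrow> 'p set) \<Rightarrow> 'p \<Rightarrow> 'a set" where
  "filter_of_point \<phi> x = {a \<in> carrier L. x \<in> \<phi> a}"

context
  fixes X :: "'p topology" and \<phi> assumes hom: "frame_hom L (opens X) \<phi>"
begin

lemma filter_of_point_in_points:
  assumes "x \<in> topspace X"
  shows "filter_of_point \<phi> x \<in> points L"
proof -
  have "\<exists>y\<in>S. y \<in> filter_of_point \<phi> x" if "S \<subseteq> carrier L" "\<Squnion>S \<in> filter_of_point \<phi> x" for S
    using that to_opens_sup [OF hom that(1)] by (auto simp: filter_of_point_def)
  moreover have "b \<in> filter_of_point \<phi> x"
    if "a \<in> filter_of_point \<phi> x" "b \<in> carrier L" "a \<sqsubseteq> b" for a b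
    using that to_opens_mono [OF hom, of a b] by (auto simp: filter_of_point_def)
  ultimately show ?thesis
    using assms by (simp add: points_def) (simp add: filter_of_point_def to_opens_top [OF hom] to_opens_meet [OF hom])
qed

lemma filter_of_point_preimage:
  "a \<in> carrier L \<Longrightarrow> {x \<in> topspace X. filter_of_point \<phi> x \<in> pt_open L a} = \<phi> a"
  using filter_of_point_in_points openin_subset [OF to_opens_open [OF hom]]
  by (auto simp: pt_open_def filter_of_point_def)

lemma frame_hom_filter_of_point:
  "frame_hom (opens (front_topology (pt L))) (opens (front_topology X))
     (\<lambda>S. {x \<in> topspace X. filter_of_point \<phi> x \<in> S})"
proof (rule frame_hom_preimage_front)
  show "filter_of_point \<phi> ` topspace X \<subseteq> topspace (pt L)"
    using filter_of_point_in_points by (auto simp: pt_open_top [symmetric] pt_open_def filter_of_point_def to_opens_top [OF hom])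
  show "openin X {x \<in> topspace X. filter_of_point \<phi> x \<in> U}" if "openin (pt L) U" for U
    using that to_opens_open [OF hom] by (auto simp: openin_pt filter_of_point_preimage)
qed

lemma frame_hom_filter_of_point_k_map:
  "frame_hom (nuclei L) (opens (front_topology X)) ((\<lambda>S. {x \<in> topspace X. filter_of_point \<phi> x \<in> S}) \<circ> k_map L)"
  "a \<in> carrier L \<Longrightarrow> ((\<lambda>S. {x \<in> topspace X. filter_of_point \<phi> x \<in> S}) \<circ> k_map L) (nu L a) = \<phi> a"
  using frame_hom_comp [OF frame_hom_k_map frame_hom_filter_of_point]
  by (auto simp: k_map_nu filter_of_point_preimage)

end

text \<open>For an arbitrary frame, \<open>pt_open\<close> need not reflect the order; it does when \<open>L\<close> has enough points, and
  every space \<open>X\<close> that represents \<open>L\<close> provides them.\<close>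

lemma pt_open_le_iff:
  assumes "frame_iso L (opens X)" "a \<in> carrier L" "b \<in> carrier L"
  shows "pt_open L a \<subseteq> pt_open L b \<longleftrightarrow> a \<sqsubseteq> b"
proof
  obtain \<phi> where \<phi>: "frame_hom L (opens X) \<phi>"
    "\<And>x y. \<lbrakk>x \<in> carrier L; y \<in> carrier L\<rbrakk> \<Longrightarrow> \<phi> x \<sqsubseteq>\<^bsub>opens X\<^esub> \<phi> y \<longleftrightarrow> x \<sqsubseteq> y"
    using frame_isoE [OF assms(1) complete_lattice_axioms complete_lattice_opens] by metis
  assume "pt_open L a \<subseteq> pt_open L b"
  then have "\<phi> a \<subseteq> \<phi> b"
    using filter_of_point_preimage [OF \<phi>(1) assms(2)] filter_of_point_preimage [OF \<phi>(1) assms(3)] by blast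
  then show "a \<sqsubseteq> b" using \<phi>(2) assms by (simp add: le_opens)
qed (use to_opens_mono [OF frame_hom_pt_open] assms in auto)

lemma frame_iso_pt:
  assumes "frame_iso L (opens X)"
  shows "frame_iso L (opens (pt L))" "bij_betw (pt_open L) (carrier L) (carrier (opens (pt L)))"
proof -
  note le = pt_open_le_iff [OF assms]
  show bij: "bij_betw (pt_open L) (carrier L) (carrier (opens (pt L)))"
    unfolding bij_betw_def
  proof
    show "inj_on (pt_open L) (carrier L)"
    proof (rule inj_onI)
      fix a b assume "a \<in> carrier L" "b \<in> carrier L" "pt_open L a = pt_open L b"
      then show "a = b" using le [of a b] le [of b a] by (simp add: eq_iff_le)
    qed
    show "pt_open L ` carrier L = carrier (opens (pt L))"
      by (auto simp: carrier_opens openin_pt)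
  qed
  show "frame_iso L (opens (pt L))"
    by (rule frame_iso_of_order_iso [OF complete_lattice_axioms complete_lattice_opens bij])
      (use le in \<open>simp add: le_opens\<close>)
qed

end

section \<open>Sheaves\<close>

lemma sheaf_sect_unique_bottom:
  assumes "complete_lattice M" "sheaf M F"
  shows "\<exists>!t. t \<in> sect F \<bottom>\<^bsub>M\<^esub>"
  using sheaf.glueing [OF assms(2), of "{}"] complete_lattice.sup_empty_eq [OF assms(1)] by simp

lemma sheaf_sections_eqI:
  assumes M: "complete_lattice M" and F: "sheaf M F" and C: "C \<subseteq> carrier M"
    and xy: "x \<in> sect F (\<Squnion>\<^bsub>M\<^esub>C)" "y \<in> sect F (\<Squnion>\<^bsub>M\<^esub>C)"
    and eq: "\<And>V. V \<in> C \<Longrightarrow> res F (\<Squnion>\<^bsub>M\<^esub>C) V x = res F (\<Squnion>\<^bsub>M\<^esub>C) V y"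
  shows "x = y"
proof -
  interpret M: complete_lattice M by fact
  interpret sheaf M F by fact
  let ?s = "\<lambda>V. res F (\<Squnion>\<^bsub>M\<^esub>C) V x"
  have c: "V \<in> carrier M" "V \<sqsubseteq>\<^bsub>M\<^esub> \<Squnion>\<^bsub>M\<^esub>C" if "V \<in> C" for V
    using that C M.sup_upper [OF C] by auto
  have "\<exists>!t. t \<in> sect F (\<Squnion>\<^bsub>M\<^esub>C) \<and> (\<forall>V\<in>C. res F (\<Squnion>\<^bsub>M\<^esub>C) V t = ?s V)"
  proof (rule glueing [OF C])
    show "?s V \<in> sect F V" if "V \<in> C" for V
      using res_closed [OF M.sup_closed [OF C] c [OF that] xy(1)] .
    show "res F V (V \<sqinter>\<^bsub>M\<^esub> W) (?s V) = res F W (V \<sqinter>\<^bsub>M\<^esub> W) (?s W)" if "V \<in> C" "W \<in> C" for V W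
      using that c M.meet_left M.meet_right M.sup_closed [OF C] xy(1) by (simp add: res_res)
  qed
  then show ?thesis using xy eq by metis
qed

lemma sheaf_glue_disjoint:
  assumes M: "complete_lattice M" and F: "sheaf M F"
    and UV: "U \<in> carrier M" "V \<in> carrier M" "U \<sqinter>\<^bsub>M\<^esub> V = \<bottom>\<^bsub>M\<^esub>"
    and st: "s \<in> sect F U" "t \<in> sect F V"
  shows "\<exists>!r. r \<in> sect F (U \<squnion>\<^bsub>M\<^esub> V) \<and> res F (U \<squnion>\<^bsub>M\<^esub> V) U r = s \<and> res F (U \<squnion>\<^bsub>M\<^esub> V) V r = t"
proof -
  interpret M: complete_lattice M by fact
  interpret sheaf M F by fact
  have bot: "x = y" if "x \<in> sect F \<bottom>\<^bsub>M\<^esub>" "y \<in> sect F \<bottom>\<^bsub>M\<^esub>" for x y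
    using that sheaf_sect_unique_bottom [OF M F] by blast
  \<comment> \<open>If \<open>U = V\<close>, then both are \<open>\<bottom>\<close>, which has only one section.\<close>
  have st_eq: "s = t" if "U = V"
    using that UV st bot M.meet_self [OF UV(1)] by simp
  define f where "f W = (if W = U then s else t)" for W
  have f: "f U = s" "f V = t" using st_eq by (auto simp: f_def)
  have "\<exists>!r. r \<in> sect F (\<Squnion>\<^bsub>M\<^esub>{U, V}) \<and> (\<forall>W\<in>{U, V}. res F (\<Squnion>\<^bsub>M\<^esub>{U, V}) W r = f W)"
  proof (rule glueing)
    show "f W \<in> sect F W" if "W \<in> {U, V}" for W
      using that f st by auto
    show "res F W (W \<sqinter>\<^bsub>M\<^esub> W') (f W) = res F W' (W \<sqinter>\<^bsub>M\<^esub> W') (f W')" if "W \<in> {U, V}" "W' \<in> {U, V}" for W W'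
    proof -
      have 1: "res F U \<bottom>\<^bsub>M\<^esub> s = res F V \<bottom>\<^bsub>M\<^esub> t"
        using UV st by (intro bot res_closed) auto
      have 2: "V \<sqinter>\<^bsub>M\<^esub> U = \<bottom>\<^bsub>M\<^esub>" using UV(3) meet_comm [of M] by metis
      show ?thesis using that f 1 2 UV(3) by auto
    qed
  qed (use UV in auto)
  then show ?thesis by (simp add: f join_def)
qed

lemma sheaf_direct_image:
  assumes M: "complete_lattice M" and N: "complete_lattice N" and h: "frame_hom M N h" and E: "sheaf N E"
  shows "sheaf M (direct_image h E)"
proof -
  interpret M: complete_lattice M by fact
  interpret N: complete_lattice N by fact
  interpret sheaf N E by fact
  note hc = frame_hom_carrier [OF h]
  note hm = frame_hom_mono [OF M N h]
  show ?thesis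
  proof
    show "res (direct_image h E) U V s \<in> sect (direct_image h E) V"
      if "U \<in> carrier M" "V \<in> carrier M" "V \<sqsubseteq>\<^bsub>M\<^esub> U" "s \<in> sect (direct_image h E) U" for U V s
      using that hc hm by (simp add: direct_image_def res_closed)
    show "res (direct_image h E) U U s = s" if "U \<in> carrier M" "s \<in> sect (direct_image h E) U" for U s
      using that hc by (simp add: direct_image_def res_id)
    show "res (direct_image h E) V W (res (direct_image h E) U V s) = res (direct_image h E) U W s"
      if "U \<in> carrier M" "V \<in> carrier M" "W \<in> carrier M" "W \<sqsubseteq>\<^bsub>M\<^esub> V" "V \<sqsubseteq>\<^bsub>M\<^esub> U"
        "s \<in> sect (direct_image h E) U" for U V W s
      using that hc hm by (simp add: direct_image_def res_res)
    fix C s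
    assume C: "C \<subseteq> carrier M" and s: "\<And>V. V \<in> C \<Longrightarrow> s V \<in> sect (direct_image h E) V"
      and comp: "\<And>V W. \<lbrakk>V \<in> C; W \<in> C\<rbrakk> \<Longrightarrow>
        res (direct_image h E) V (V \<sqinter>\<^bsub>M\<^esub> W) (s V) = res (direct_image h E) W (V \<sqinter>\<^bsub>M\<^esub> W) (s W)"
    have meet: "h (V \<sqinter>\<^bsub>M\<^esub> W) = h V \<sqinter>\<^bsub>N\<^esub> h W" if "V \<in> C" "W \<in> C" for V W
    proof -
      have "V \<in> carrier M" "W \<in> carrier M" using that C by auto
      then show ?thesis using h by (simp add: frame_hom_def)
    qed
    have s': "s V \<in> sect E (h V)" if "V \<in> C" for V
      using s [OF that] by (simp add: direct_image_def)
    have comp': "res E (h V) (h V \<sqinter>\<^bsub>N\<^esub> h W) (s V) = res E (h W) (h V \<sqinter>\<^bsub>N\<^esub> h W) (s W)"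
      if "V \<in> C" "W \<in> C" for V W
      using comp [OF that] meet [OF that] by (simp add: direct_image_def)
    \<comment> \<open>Two members of the cover with the same image carry the same section, by compatibility.\<close>
    have same: "s V = s W" if "V \<in> C" "W \<in> C" "h V = h W" for V W
    proof -
      have "h V \<in> carrier N" using that C hc by auto
      then show ?thesis
        using comp' [OF that(1,2)] s' [OF that(1)] s' [OF that(2)] that(3) res_id [of "h V"]
        by (simp add: N.meet_self)
    qed
    define s1 where "s1 U = s (SOME V. V \<in> C \<and> h V = U)" for U
    have s1: "s1 (h V) = s V" if "V \<in> C" for V
      unfolding s1_def using that by (intro same) (rule someI2 [of _ V]; simp)+
    have "\<exists>!t. t \<in> sect E (\<Squnion>\<^bsub>N\<^esub>(h ` C)) \<and> (\<forall>V\<in>h ` C. res E (\<Squnion>\<^bsub>N\<^esub>(h ` C)) V t = s1 V)"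
    proof (rule glueing)
      show "h ` C \<subseteq> carrier N" using C hc by auto
    qed (use s1 s' comp' in auto)
    moreover have "h (\<Squnion>\<^bsub>M\<^esub>C) = \<Squnion>\<^bsub>N\<^esub>(h ` C)"
      using h C by (simp add: frame_hom_def)
    ultimately show "\<exists>!t. t \<in> sect (direct_image h E) (\<Squnion>\<^bsub>M\<^esub>C) \<and>
        (\<forall>V\<in>C. res (direct_image h E) (\<Squnion>\<^bsub>M\<^esub>C) V t = s V)"
      by (simp add: direct_image_def s1)
  qed
qed

lemma direct_image_comp: "direct_image g (direct_image f E) = direct_image (f \<circ> g) E"
  by (simp add: direct_image_def)

subsection \<open>Isomorphisms of sheaves\<close>

lemma sheaf_isoE:
  assumes "sheaf_iso M F G"
  obtains \<phi> where "\<And>U. U \<in> carrier M \<Longrightarrow> bij_betw (\<phi> U) (sect F U) (sect G U)"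
    and "\<And>U V s. \<lbrakk>U \<in> carrier M; V \<in> carrier M; V \<sqsubseteq>\<^bsub>M\<^esub> U; s \<in> sect F U\<rbrakk>
      \<Longrightarrow> \<phi> V (res F U V s) = res G U V (\<phi> U s)"
  using assms unfolding sheaf_iso_def by blast

lemma sheaf_isoI:
  assumes "\<And>U. U \<in> carrier M \<Longrightarrow> bij_betw (\<phi> U) (sect F U) (sect G U)"
    and "\<And>U V s. \<lbrakk>U \<in> carrier M; V \<in> carrier M; V \<sqsubseteq>\<^bsub>M\<^esub> U; s \<in> sect F U\<rbrakk>
      \<Longrightarrow> \<phi> V (res F U V s) = res G U V (\<phi> U s)"
  shows "sheaf_iso M F G"
  unfolding sheaf_iso_def using assms by blast

lemma sheaf_iso_trans:
  assumes "sheaf_iso M F G" "sheaf_iso M G K"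
  shows "sheaf_iso M F K"
proof -
  obtain \<phi> where \<phi>: "\<And>U. U \<in> carrier M \<Longrightarrow> bij_betw (\<phi> U) (sect F U) (sect G U)"
    "\<And>U V s. \<lbrakk>U \<in> carrier M; V \<in> carrier M; V \<sqsubseteq>\<^bsub>M\<^esub> U; s \<in> sect F U\<rbrakk>
      \<Longrightarrow> \<phi> V (res F U V s) = res G U V (\<phi> U s)"
    by (rule sheaf_isoE [OF assms(1)], rule that) blast+
  obtain \<psi> where \<psi>: "\<And>U. U \<in> carrier M \<Longrightarrow> bij_betw (\<psi> U) (sect G U) (sect K U)"
    "\<And>U V s. \<lbrakk>U \<in> carrier M; V \<in> carrier M; V \<sqsubseteq>\<^bsub>M\<^esub> U; s \<in> sect G U\<rbrakk>
      \<Longrightarrow> \<psi> V (res G U V s) = res K U V (\<psi> U s)"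
    by (rule sheaf_isoE [OF assms(2)], rule that) blast+
  show ?thesis
  proof (rule sheaf_isoI [where \<phi> = "\<lambda>U. \<psi> U \<circ> \<phi> U"])
    show "bij_betw (\<psi> U \<circ> \<phi> U) (sect F U) (sect K U)" if "U \<in> carrier M" for U
      using \<phi>(1) \<psi>(1) that bij_betw_trans by blast
    show "(\<psi> V \<circ> \<phi> V) (res F U V s) = res K U V ((\<psi> U \<circ> \<phi> U) s)"
      if "U \<in> carrier M" "V \<in> carrier M" "V \<sqsubseteq>\<^bsub>M\<^esub> U" "s \<in> sect F U" for U V s
      using \<phi>(2) [OF that] \<psi>(2) [OF that(1-3), of "\<phi> U s"] bij_betwE [OF \<phi>(1) [OF that(1)]] that(4) by simp
  qed
qed

lemma sheaf_iso_direct_image: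
  assumes "complete_lattice M" "complete_lattice N" "frame_hom M N h" "sheaf_iso N E E'"
  shows "sheaf_iso M (direct_image h E) (direct_image h E')"
proof -
  obtain \<phi> where \<phi>: "\<And>U. U \<in> carrier N \<Longrightarrow> bij_betw (\<phi> U) (sect E U) (sect E' U)"
    "\<And>U V s. \<lbrakk>U \<in> carrier N; V \<in> carrier N; V \<sqsubseteq>\<^bsub>N\<^esub> U; s \<in> sect E U\<rbrakk>
      \<Longrightarrow> \<phi> V (res E U V s) = res E' U V (\<phi> U s)"
    by (rule sheaf_isoE [OF assms(4)], rule that) blast+
  show ?thesis
    by (rule sheaf_isoI [where \<phi> = "\<phi> \<circ> h"])
      (use \<phi> frame_hom_carrier [OF assms(3)] frame_hom_mono [OF assms(1-3)] in \<open>simp_all add: direct_image_def\<close>)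
qed

text \<open>The structure of a sheaf can be carried along arbitrary bijections of its sets of sections,
  for instance in order to change the type of the sections.\<close>

definition transported_presheaf ::
    "('o \<Rightarrow> 's set) \<Rightarrow> ('o \<Rightarrow> 's \<Rightarrow> 't) \<Rightarrow> ('o, 't) presheaf \<Rightarrow> ('o, 's) presheaf" where
  "transported_presheaf S b E =
     \<lparr>sect = S, res = (\<lambda>U V s. inv_into (S V) (b V) (res E U V (b U s)))\<rparr>"

lemma
  assumes M: "complete_lattice M" and E: "sheaf M E"
    and b: "\<And>U. U \<in> carrier M \<Longrightarrow> bij_betw (b U) (S U) (sect E U)"
  shows sheaf_transported: "sheaf M (transported_presheaf S b E)"
    and sheaf_iso_transported: "sheaf_iso M E (transported_presheaf S b E)"
proof -
  interpret M: complete_lattice M by fact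
  interpret sheaf M E by fact
  let ?T = "transported_presheaf S b E"
  have [simp]: "sect ?T = S" by (simp add: transported_presheaf_def)
  have bS: "b U s \<in> sect E U" if "U \<in> carrier M" "s \<in> S U" for U s
    using bij_betwE [OF b [OF that(1)]] that(2) by blast
  have inj: "s = t" if "U \<in> carrier M" "s \<in> S U" "t \<in> S U" "b U s = b U t" for U s t
    using b [OF that(1)] that by (auto simp: bij_betw_def inj_on_def)
  have surj: "\<exists>s\<in>S U. b U s = x" if "U \<in> carrier M" "x \<in> sect E U" for U x
    using b [OF that(1)] that(2) unfolding bij_betw_def by (metis imageE)
  have r: "res ?T U V s \<in> S V" "b V (res ?T U V s) = res E U V (b U s)"
    if "U \<in> carrier M" "V \<in> carrier M" "V \<sqsubseteq>\<^bsub>M\<^esub> U" "s \<in> S U" for U V s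
  proof -
    have "res E U V (b U s) \<in> b V ` S V"
      using res_closed [OF that(1-3) bS [OF that(1,4)]] b [OF that(2)] by (simp add: bij_betw_def)
    then show "res ?T U V s \<in> S V" "b V (res ?T U V s) = res E U V (b U s)"
      by (auto simp: transported_presheaf_def inv_into_into f_inv_into_f)
  qed
  show "sheaf M ?T"
  proof
    show "res ?T U V s \<in> sect ?T V"
      if "U \<in> carrier M" "V \<in> carrier M" "V \<sqsubseteq>\<^bsub>M\<^esub> U" "s \<in> sect ?T U" for U V s
      using that r by simp
    show "res ?T U U s = s" if "U \<in> carrier M" "s \<in> sect ?T U" for U s
      using that r [of U U s] res_id bS by (intro inj [of U]) auto
    show "res ?T V W (res ?T U V s) = res ?T U W s"
      if *: "U \<in> carrier M" "V \<in> carrier M" "W \<in> carrier M" "W \<sqsubseteq>\<^bsub>M\<^esub> V" "V \<sqsubseteq>\<^bsub>M\<^esub> U" "s \<in> sect ?T U"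
      for U V W s
    proof (rule inj [of W])
      have WU: "W \<sqsubseteq>\<^bsub>M\<^esub> U" using * M.le_trans by blast
      have V: "res ?T U V s \<in> S V" using * r by simp
      show "b W (res ?T V W (res ?T U V s)) = b W (res ?T U W s)"
        using * WU V bS by (simp add: r res_res)
      show "res ?T V W (res ?T U V s) \<in> S W" "res ?T U W s \<in> S W"
        using * WU V r by simp_all
    qed (use * in simp)
    fix C s
    assume C: "C \<subseteq> carrier M" and s: "\<And>V. V \<in> C \<Longrightarrow> s V \<in> sect ?T V"
      and comp: "\<And>V W. \<lbrakk>V \<in> C; W \<in> C\<rbrakk> \<Longrightarrow> res ?T V (V \<sqinter>\<^bsub>M\<^esub> W) (s V) = res ?T W (V \<sqinter>\<^bsub>M\<^esub> W) (s W)"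
    have ex1: "\<exists>!t. t \<in> sect E (\<Squnion>\<^bsub>M\<^esub>C) \<and> (\<forall>V\<in>C. res E (\<Squnion>\<^bsub>M\<^esub>C) V t = b V (s V))"
    proof (rule glueing [OF C])
      show "b V (s V) \<in> sect E V" if "V \<in> C" for V
        using that C s bS by auto
      show "res E V (V \<sqinter>\<^bsub>M\<^esub> W) (b V (s V)) = res E W (V \<sqinter>\<^bsub>M\<^esub> W) (b W (s W))"
        if VW: "V \<in> C" "W \<in> C" for V W
      proof -
        have c: "V \<in> carrier M" "W \<in> carrier M" "s V \<in> S V" "s W \<in> S W" using VW C s by auto
        show ?thesis
          using arg_cong [OF comp [OF VW], of "b (V \<sqinter>\<^bsub>M\<^esub> W)"] c M.meet_left M.meet_right
          by (simp add: r)
      qed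
    qed
    have iff: "(\<forall>V\<in>C. res ?T (\<Squnion>\<^bsub>M\<^esub>C) V t = s V) \<longleftrightarrow> (\<forall>V\<in>C. res E (\<Squnion>\<^bsub>M\<^esub>C) V (b (\<Squnion>\<^bsub>M\<^esub>C) t) = b V (s V))"
      if t: "t \<in> S (\<Squnion>\<^bsub>M\<^esub>C)" for t
    proof (rule ball_cong [OF refl])
      fix V assume V: "V \<in> C"
      then have c: "V \<in> carrier M" "V \<sqsubseteq>\<^bsub>M\<^esub> \<Squnion>\<^bsub>M\<^esub>C" "s V \<in> S V"
        using C M.sup_upper [OF C] s by auto
      note rr = r [OF M.sup_closed [OF C] c(1,2) t]
      show "(res ?T (\<Squnion>\<^bsub>M\<^esub>C) V t = s V) = (res E (\<Squnion>\<^bsub>M\<^esub>C) V (b (\<Squnion>\<^bsub>M\<^esub>C) t) = b V (s V))"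
        using inj [OF c(1) rr(1) c(3)] rr(2) by auto
    qed
    obtain x where x: "x \<in> sect E (\<Squnion>\<^bsub>M\<^esub>C)" "\<forall>V\<in>C. res E (\<Squnion>\<^bsub>M\<^esub>C) V x = b V (s V)"
      using ex1 by blast
    obtain t where t: "t \<in> S (\<Squnion>\<^bsub>M\<^esub>C)" "b (\<Squnion>\<^bsub>M\<^esub>C) t = x"
      using surj [OF M.sup_closed [OF C] x(1)] by blast
    show "\<exists>!t. t \<in> sect ?T (\<Squnion>\<^bsub>M\<^esub>C) \<and> (\<forall>V\<in>C. res ?T (\<Squnion>\<^bsub>M\<^esub>C) V t = s V)"
    proof (rule ex1I [of _ t])
      show "t \<in> sect ?T (\<Squnion>\<^bsub>M\<^esub>C) \<and> (\<forall>V\<in>C. res ?T (\<Squnion>\<^bsub>M\<^esub>C) V t = s V)"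
        using t x(2) iff [OF t(1)] by simp
      fix t' assume "t' \<in> sect ?T (\<Squnion>\<^bsub>M\<^esub>C) \<and> (\<forall>V\<in>C. res ?T (\<Squnion>\<^bsub>M\<^esub>C) V t' = s V)"
      then have t': "t' \<in> S (\<Squnion>\<^bsub>M\<^esub>C)" "\<forall>V\<in>C. res E (\<Squnion>\<^bsub>M\<^esub>C) V (b (\<Squnion>\<^bsub>M\<^esub>C) t') = b V (s V)"
        using iff by auto
      then have "b (\<Squnion>\<^bsub>M\<^esub>C) t' = x"
        using ex1 x bS [OF M.sup_closed [OF C]] by blast
      then show "t' = t" using inj [OF M.sup_closed [OF C] t'(1) t(1)] t(2) by simp
    qed
  qed
  show "sheaf_iso M E ?T"
  proof (rule sheaf_isoI [where \<phi> = "\<lambda>U. inv_into (S U) (b U)"])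
    show "bij_betw (inv_into (S U) (b U)) (sect E U) (sect ?T U)" if "U \<in> carrier M" for U
      using bij_betw_inv_into [OF b [OF that]] by simp
    show "inv_into (S V) (b V) (res E U V s) = res ?T U V (inv_into (S U) (b U) s)"
      if "U \<in> carrier M" "V \<in> carrier M" "V \<sqsubseteq>\<^bsub>M\<^esub> U" "s \<in> sect E U" for U V s
      using that bij_betw_inv_into_right [OF b [OF that(1)]] by (simp add: transported_presheaf_def)
  qed
qed

subsection \<open>Sheaves determined by their global sections\<close>

text \<open>The section \<open>t\<close> of \<open>G\<close> corresponds to the section \<open>s\<close> of \<open>F\<close> under the map that a map \<open>\<theta>\<close> of global
  sections induces: wherever \<open>s\<close> is the restriction of a global section \<open>x\<close> to a member of the base,
  \<open>t\<close> is the restriction of \<open>\<theta> x\<close>.\<close>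

definition related_sections ::
    "('o, 'c) gorder_scheme \<Rightarrow> 'o set \<Rightarrow> ('s \<Rightarrow> 't) \<Rightarrow> ('o, 's) presheaf \<Rightarrow> ('o, 't) presheaf
      \<Rightarrow> 'o \<Rightarrow> 's \<Rightarrow> 't \<Rightarrow> bool" where
  "related_sections M B \<theta> F G n s t \<longleftrightarrow>
     (\<forall>b\<in>B. b \<sqsubseteq>\<^bsub>M\<^esub> n \<longrightarrow> (\<forall>x\<in>sect F \<top>\<^bsub>M\<^esub>.
        res F \<top>\<^bsub>M\<^esub> b x = res F n b s \<longrightarrow> res G \<top>\<^bsub>M\<^esub> b (\<theta> x) = res G n b t))"

text \<open>Two sheaves on a locale with a base \<open>B\<close> over which all sections are restrictions of global ones,
  and a bijection of the global sections that preserves and reflects agreement on members of \<open>B\<close>.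
  The assumptions are symmetric in the two sheaves, which gives the inverse of the isomorphism
  constructed from them.\<close>

locale globally_generated_pair = complete_lattice M + F: sheaf M F + G: sheaf M G
  for M :: "('o, 'c) gorder_scheme" (structure)
    and F :: "('o, 's) presheaf" and G :: "('o, 't) presheaf" +
  fixes B :: "'o set" and \<theta> :: "'s \<Rightarrow> 't"
  assumes base_carrier: "B \<subseteq> carrier M"
    and base: "n \<in> carrier M \<Longrightarrow> \<Squnion>{b \<in> B. b \<sqsubseteq> n} = n"
    and extF: "\<lbrakk>b \<in> B; s \<in> sect F b\<rbrakk> \<Longrightarrow> \<exists>x\<in>sect F \<top>. res F \<top> b x = s"
    and extG: "\<lbrakk>b \<in> B; t \<in> sect G b\<rbrakk> \<Longrightarrow> \<exists>y\<in>sect G \<top>. res G \<top> b y = t"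
    and bij: "bij_betw \<theta> (sect F \<top>) (sect G \<top>)"
    and agree_base: "\<lbrakk>b \<in> B; x \<in> sect F \<top>; x' \<in> sect F \<top>\<rbrakk>
      \<Longrightarrow> res F \<top> b x = res F \<top> b x' \<longleftrightarrow> res G \<top> b (\<theta> x) = res G \<top> b (\<theta> x')"
begin

lemma theta_closed: "x \<in> sect F \<top> \<Longrightarrow> \<theta> x \<in> sect G \<top>"
  using bij bij_betwE by blast

text \<open>The part of \<open>M\<close> where two global sections agree is determined by the members of the base
  that it contains.\<close>

lemma agree:
  assumes n: "n \<in> carrier M" and x: "x \<in> sect F \<top>" and x': "x' \<in> sect F \<top>"
    and eq: "res F \<top> n x = res F \<top> n x'"
  shows "res G \<top> n (\<theta> x) = res G \<top> n (\<theta> x')"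
proof -
  let ?C = "{b \<in> B. b \<sqsubseteq> n}"
  have C: "?C \<subseteq> carrier M" using base_carrier by auto
  have "res G n b (res G \<top> n (\<theta> x)) = res G n b (res G \<top> n (\<theta> x'))" if "b \<in> ?C" for b
  proof -
    have b: "b \<in> carrier M" "b \<sqsubseteq> n" "b \<in> B" using that base_carrier by auto
    have "res F \<top> b x = res F \<top> b x'"
      using F.res_res [OF _ n b(1) b(2) _ x] F.res_res [OF _ n b(1) b(2) _ x'] n eq by simp
    then have "res G \<top> b (\<theta> x) = res G \<top> b (\<theta> x')"
      using agree_base [OF b(3) x x'] by blast
    then show ?thesis
      using b n theta_closed [OF x] theta_closed [OF x'] by (simp add: G.res_res)
  qed
  then show ?thesis
    using sheaf_sections_eqI [OF complete_lattice_axioms G.sheaf_axioms C] base [OF n]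
      G.res_closed [OF _ n _ theta_closed] x x' n by simp
qed

text \<open>A section over \<open>n\<close> is glued from restrictions of global sections to members of the base, and
  the glueing data only involve the agreement of these global sections, which \<open>\<theta>\<close> respects.\<close>

lemma ex1_related:
  assumes n: "n \<in> carrier M" and s: "s \<in> sect F n"
  shows "\<exists>!t. t \<in> sect G n \<and> related_sections M B \<theta> F G n s t"
proof -
  let ?C = "{b \<in> B. b \<sqsubseteq> n}"
  have C: "?C \<subseteq> carrier M" using base_carrier by auto
  have "\<exists>x. x \<in> sect F \<top> \<and> res F \<top> b x = res F n b s" if "b \<in> ?C" for b
    using extF [of b "res F n b s"] that C F.res_closed [OF n _ _ s, of b] by blast
  then obtain x where x: "\<And>b. b \<in> ?C \<Longrightarrow> x b \<in> sect F \<top>"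
    "\<And>b. b \<in> ?C \<Longrightarrow> res F \<top> b (x b) = res F n b s"
    by metis
  let ?t = "\<lambda>b. res G \<top> b (\<theta> (x b))"
  have ex1: "\<exists>!t. t \<in> sect G (\<Squnion>?C) \<and> (\<forall>b\<in>?C. res G (\<Squnion>?C) b t = ?t b)"
  proof (rule G.glueing [OF C])
    show "?t b \<in> sect G b" if "b \<in> ?C" for b
      using that C by (intro G.res_closed theta_closed x) auto
    show "res G b (b \<sqinter> b') (?t b) = res G b' (b \<sqinter> b') (?t b')" if bb: "b \<in> ?C" "b' \<in> ?C" for b b'
    proof -
      have c: "b \<in> carrier M" "b' \<in> carrier M" "b \<sqsubseteq> n" "b' \<sqsubseteq> n" using bb C by auto
      have mc: "b \<sqinter> b' \<in> carrier M" "b \<sqinter> b' \<sqsubseteq> b" "b \<sqinter> b' \<sqsubseteq> b'"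
        using c meet_left meet_right by auto
      have "res F \<top> (b \<sqinter> b') (x b) = res F b (b \<sqinter> b') (res F n b s)"
        using F.res_res [OF top_closed c(1) mc(1,2) _ x(1) [OF bb(1)]] x(2) [OF bb(1)] c by simp
      also have "\<dots> = res F b' (b \<sqinter> b') (res F n b' s)"
        using F.res_res [OF n c(1) mc(1,2) c(3) s] F.res_res [OF n c(2) mc(1,3) c(4) s] by simp
      also have "\<dots> = res F \<top> (b \<sqinter> b') (x b')"
        using F.res_res [OF top_closed c(2) mc(1,3) _ x(1) [OF bb(2)]] x(2) [OF bb(2)] c by simp
      finally have "res G \<top> (b \<sqinter> b') (\<theta> (x b)) = res G \<top> (b \<sqinter> b') (\<theta> (x b'))"
        by (rule agree [OF mc(1) x(1) [OF bb(1)] x(1) [OF bb(2)]])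
      then show ?thesis
        using G.res_res [OF top_closed c(1) mc(1,2) _ theta_closed [OF x(1) [OF bb(1)]]]
          G.res_res [OF top_closed c(2) mc(1,3) _ theta_closed [OF x(1) [OF bb(2)]]] c by simp
    qed
  qed
  have "related_sections M B \<theta> F G n s t \<longleftrightarrow> (\<forall>b\<in>?C. res G n b t = ?t b)" for t
  proof
    show "\<forall>b\<in>?C. res G n b t = ?t b" if "related_sections M B \<theta> F G n s t"
      using that x unfolding related_sections_def by simp
    show "related_sections M B \<theta> F G n s t" if *: "\<forall>b\<in>?C. res G n b t = ?t b"
      unfolding related_sections_def
    proof (intro ballI impI)
      fix b y assume b: "b \<in> B" "b \<sqsubseteq> n" and y: "y \<in> sect F \<top>" "res F \<top> b y = res F n b s"
      then have bC: "b \<in> ?C" by simp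
      show "res G \<top> b (\<theta> y) = res G n b t"
        using agree_base [OF b(1) y(1) x(1) [OF bC]] x(2) [OF bC] y(2) * bC by simp
    qed
  qed
  then show ?thesis using ex1 base [OF n] by simp
qed

lemma related_res:
  assumes "n \<in> carrier M" "m \<in> carrier M" "m \<sqsubseteq> n" "s \<in> sect F n" "t \<in> sect G n"
    and rel: "related_sections M B \<theta> F G n s t"
  shows "related_sections M B \<theta> F G m (res F n m s) (res G n m t)"
  unfolding related_sections_def
proof (intro ballI impI)
  fix b x assume b: "b \<in> B" "b \<sqsubseteq> m" and x: "x \<in> sect F \<top>" "res F \<top> b x = res F m b (res F n m s)"
  have bc: "b \<in> carrier M" using b base_carrier by auto
  then have bn: "b \<sqsubseteq> n" using b assms le_trans by blast
  have "res F \<top> b x = res F n b s"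
    using x(2) F.res_res [OF assms(1,2) bc b(2) assms(3,4)] by simp
  then have "res G \<top> b (\<theta> x) = res G n b t"
    using rel b(1) bn x(1) unfolding related_sections_def by blast
  then show "res G \<top> b (\<theta> x) = res G m b (res G n m t)"
    using G.res_res [OF assms(1,2) bc b(2) assms(3,5)] by simp
qed

lemma related_sym:
  assumes n: "n \<in> carrier M" and s: "s \<in> sect F n" and t: "t \<in> sect G n"
    and rel: "related_sections M B \<theta> F G n s t"
  shows "related_sections M B (inv_into (sect F \<top>) \<theta>) G F n t s"
  unfolding related_sections_def
proof (intro ballI impI)
  fix b y assume b: "b \<in> B" "b \<sqsubseteq> n" and y: "y \<in> sect G \<top>" "res G \<top> b y = res G n b t"
  let ?z = "inv_into (sect F \<top>) \<theta> y"
  have z: "?z \<in> sect F \<top>" "\<theta> ?z = y"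
    using bij y(1) by (auto simp: bij_betw_def inv_into_into f_inv_into_f)
  have bc: "b \<in> carrier M" using b base_carrier by auto
  obtain x where x: "x \<in> sect F \<top>" "res F \<top> b x = res F n b s"
    using extF [OF b(1) F.res_closed [OF n bc b(2) s]] by blast
  have "res G \<top> b (\<theta> x) = res G n b t"
    using rel b x unfolding related_sections_def by blast
  then show "res F \<top> b ?z = res F n b s"
    using agree_base [OF b(1) z(1) x(1)] z(2) y(2) x(2) by simp
qed

lemma opposite: "globally_generated_pair M G F B (inv_into (sect F \<top>) \<theta>)"
proof
  let ?i = "inv_into (sect F \<top>) \<theta>"
  show "bij_betw ?i (sect G \<top>) (sect F \<top>)" using bij by (rule bij_betw_inv_into)
  show "(res G \<top> b y = res G \<top> b y') = (res F \<top> b (?i y) = res F \<top> b (?i y'))"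
    if "b \<in> B" "y \<in> sect G \<top>" "y' \<in> sect G \<top>" for b y y'
    using agree_base [OF that(1), of "?i y" "?i y'"] that bij
    by (auto simp: bij_betw_def inv_into_into f_inv_into_f)
qed (use base_carrier base extF extG in auto)

theorem sheaf_iso: "sheaf_iso M F G"
proof -
  interpret op: globally_generated_pair M G F B "inv_into (sect F \<top>) \<theta>" by (rule opposite)
  let ?i = "inv_into (sect F \<top>) \<theta>"
  let ?R = "related_sections M B \<theta> F G"
  define \<phi> where "\<phi> n s = (THE t. t \<in> sect G n \<and> ?R n s t)" for n s
  have \<phi>: "\<phi> n s \<in> sect G n" "?R n s (\<phi> n s)" if "n \<in> carrier M" "s \<in> sect F n" for n s
    using theI' [OF ex1_related [OF that]] by (auto simp: \<phi>_def)
  have \<phi>_eq: "\<phi> n s = t" if "n \<in> carrier M" "s \<in> sect F n" "t \<in> sect G n" "?R n s t" for n s t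
    using ex1_related [OF that(1,2)] \<phi> [OF that(1,2)] that(3,4) by blast
  have sym: "?R n s t" if "n \<in> carrier M" "s \<in> sect F n" "t \<in> sect G n"
    "related_sections M B ?i G F n t s" for n s t
  proof -
    have "inv_into (sect G \<top>) ?i x = \<theta> x" if "x \<in> sect F \<top>" for x
      using op.bij bij that by (metis bij_betw_def bij_betw_inv_into_left inv_into_f_eq theta_closed)
    then show ?thesis
      using op.related_sym [OF that(1,3,2,4)] by (simp add: related_sections_def)
  qed
  show ?thesis
  proof (rule sheaf_isoI [where \<phi> = \<phi>])
    fix n assume n: "n \<in> carrier M"
    show "bij_betw (\<phi> n) (sect F n) (sect G n)"
      unfolding bij_betw_def
    proof
      show "inj_on (\<phi> n) (sect F n)"
      proof (rule inj_onI)
        fix s s' assume s: "s \<in> sect F n" "s' \<in> sect F n" "\<phi> n s = \<phi> n s'"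
        have "related_sections M B ?i G F n (\<phi> n s) s" "related_sections M B ?i G F n (\<phi> n s) s'"
          using related_sym [OF n s(1)] related_sym [OF n s(2)] \<phi> [OF n s(1)] \<phi> [OF n s(2)] s(3) by auto
        then show "s = s'" using op.ex1_related [OF n] \<phi>(1) [OF n s(1)] s(1,2) by blast
      qed
      show "\<phi> n ` sect F n = sect G n"
      proof
        show "\<phi> n ` sect F n \<subseteq> sect G n" using \<phi>(1) [OF n] by blast
        show "sect G n \<subseteq> \<phi> n ` sect F n"
        proof
          fix t assume t: "t \<in> sect G n"
          obtain s where s: "s \<in> sect F n" "related_sections M B ?i G F n t s"
            using op.ex1_related [OF n t] by blast
          then have "\<phi> n s = t" using \<phi>_eq [OF n s(1) t sym [OF n s(1) t s(2)]] by simp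
          then show "t \<in> \<phi> n ` sect F n" using s(1) by blast
        qed
      qed
    qed
  next
    fix n m s assume n: "n \<in> carrier M" and m: "m \<in> carrier M" "m \<sqsubseteq> n" and s: "s \<in> sect F n"
    show "\<phi> m (res F n m s) = res G n m (\<phi> n s)"
      using \<phi> [OF n s] m n s by (intro \<phi>_eq related_res F.res_closed G.res_closed) auto
  qed
qed

end

subsection \<open>Sheaves on a dissolution locale\<close>

context frame
begin

context
  fixes F :: "('a \<Rightarrow> 'a, 's) presheaf"
  assumes F: "sheaf (nuclei L) F"
begin

interpretation F: sheaf "nuclei L" F by (rule F)

lemma glue_delta_diff:
  assumes "u \<in> carrier L" "v \<in> carrier L" "s \<in> sect F (delta_diff L u v)" "t \<in> sect F (nu L v)"
  shows "\<exists>!r. r \<in> sect F (nu L (u \<squnion> v)) \<and> res F (nu L (u \<squnion> v)) (delta_diff L u v) r = s \<and>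
    res F (nu L (u \<squnion> v)) (nu L v) r = t"
  using sheaf_glue_disjoint [OF complete_lattice_nuclei F delta_diff_closed [OF assms(1,2)]
      nu_nucleus [OF assms(2)] delta_diff_meet_nu [OF assms(1,2)] assms(3,4)] assms(1,2)
  by (simp add: delta_diff_join_nu)

text \<open>The extension is done in two steps, each of which fills in \<open>g\<close> on a complement: from \<open>\<nu>\<^sub>u - \<nu>\<^sub>v\<close> to
  \<open>\<nu>\<close> at \<open>u \<squnion> v\<close> across \<open>\<nu>\<^sub>v\<close>, and from there to \<open>\<top>\<close> across the complement.\<close>

lemma extend_from_delta_diff:
  assumes u: "u \<in> carrier L" and v: "v \<in> carrier L" and s: "s \<in> sect F (delta_diff L u v)"
    and g: "g \<in> sect F \<top>\<^bsub>nuclei L\<^esub>"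
  shows "\<exists>x\<in>sect F \<top>\<^bsub>nuclei L\<^esub>. res F \<top>\<^bsub>nuclei L\<^esub> (delta_diff L u v) x = s"
proof -
  let ?w = "u \<squnion> v"
  have w: "?w \<in> carrier L" using u v by simp
  have tw: "\<top> \<squnion> ?w = \<top>" using w by (intro join_eqI) auto
  have gres: "res F \<top>\<^bsub>nuclei L\<^esub> n g \<in> sect F n" if "n \<in> carrier (nuclei L)" for n
    using that g by (intro F.res_closed) auto
  obtain r where r: "r \<in> sect F (nu L ?w)" "res F (nu L ?w) (delta_diff L u v) r = s"
    using glue_delta_diff [OF u v s gres [OF nu_nucleus [OF v]]] by blast
  \<comment> \<open>The complement of \<open>\<nu>\<close> at \<open>u \<squnion> v\<close> is the difference with \<open>\<nu>\<close> at \<open>\<top>\<close>, so that the same glueing applies.\<close>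
  obtain x where x: "x \<in> sect F (nu L \<top>)" "res F (nu L \<top>) (nu L ?w) x = r"
    using glue_delta_diff [OF top_closed w gres [OF delta_diff_closed [OF top_closed w]] r(1)]
    unfolding tw by blast
  have "delta_diff L u v \<sqsubseteq>\<^bsub>nuclei L\<^esub> nu L ?w"
    using N.le_trans [OF delta_diff_le_nu nu_mono, of u v ?w] u v w join_left
      delta_diff_closed nu_nucleus by simp
  then have "res F (nu L \<top>) (delta_diff L u v) x = s"
    using F.res_res [of "nu L \<top>" "nu L ?w" "delta_diff L u v" x] u v w x r(2)
    by (simp add: nu_mono nu_nucleus delta_diff_closed)
  then show ?thesis using x(1) by (auto simp: nu_top)
qed

end

lemma sup_delta_diff_below:
  assumes n: "n \<in> carrier (nuclei L)"
  shows "\<Squnion>\<^bsub>nuclei L\<^esub>{b \<in> {delta_diff L u v |u v. u \<in> carrier L \<and> v \<in> carrier L}. b \<sqsubseteq>\<^bsub>nuclei L\<^esub> n} = n"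
    (is "\<Squnion>\<^bsub>nuclei L\<^esub>?C = n")
proof (rule N.sup_eqI)
  show "?C \<subseteq> carrier (nuclei L)" using delta_diff_closed by auto
  let ?D = "(\<lambda>a. delta_diff L (n a) a) ` carrier L"
  have D: "?D \<subseteq> carrier (nuclei L)"
    using nucleus_closed [OF n] delta_diff_closed by auto
  fix z assume z: "z \<in> carrier (nuclei L)" "\<And>d. d \<in> ?C \<Longrightarrow> d \<sqsubseteq>\<^bsub>nuclei L\<^esub> z"
  have "d \<sqsubseteq>\<^bsub>nuclei L\<^esub> n" if "d \<in> ?D" for d
    using N.sup_upper [OF D that] nucleus_eq_sup_delta_diff [OF n] by simp
  then have DC: "?D \<subseteq> ?C" using nucleus_closed [OF n] by blast
  have "\<Squnion>\<^bsub>nuclei L\<^esub>?D \<sqsubseteq>\<^bsub>nuclei L\<^esub> z"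
    by (rule N.sup_least [OF D z(1) z(2)]) (use DC in blast)
  then show "n \<sqsubseteq>\<^bsub>nuclei L\<^esub> z" using nucleus_eq_sup_delta_diff [OF n] by simp
qed (use n in auto)

lemma sheaf_iso_of_global_sections:
  assumes F: "sheaf (nuclei L) F" and G: "sheaf (nuclei L) G" and ne: "sect F \<top>\<^bsub>nuclei L\<^esub> \<noteq> {}"
    and bij: "bij_betw \<theta> (sect F \<top>\<^bsub>nuclei L\<^esub>) (sect G \<top>\<^bsub>nuclei L\<^esub>)"
    and agree: "\<And>u v x x'. \<lbrakk>u \<in> carrier L; v \<in> carrier L; x \<in> sect F \<top>\<^bsub>nuclei L\<^esub>; x' \<in> sect F \<top>\<^bsub>nuclei L\<^esub>\<rbrakk> \<Longrightarrow>
      res F \<top>\<^bsub>nuclei L\<^esub> (delta_diff L u v) x = res F \<top>\<^bsub>nuclei L\<^esub> (delta_diff L u v) x' \<longleftrightarrow>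
      res G \<top>\<^bsub>nuclei L\<^esub> (delta_diff L u v) (\<theta> x) = res G \<top>\<^bsub>nuclei L\<^esub> (delta_diff L u v) (\<theta> x')"
  shows "sheaf_iso (nuclei L) F G"
proof -
  let ?B = "{delta_diff L u v |u v. u \<in> carrier L \<and> v \<in> carrier L}"
  obtain g where g: "g \<in> sect F \<top>\<^bsub>nuclei L\<^esub>" using ne by blast
  then have g': "\<theta> g \<in> sect G \<top>\<^bsub>nuclei L\<^esub>" using bij bij_betwE by blast
  have "globally_generated_pair (nuclei L) F G ?B \<theta>"
  proof (intro globally_generated_pair.intro globally_generated_pair_axioms.intro)
    show "?B \<subseteq> carrier (nuclei L)" using delta_diff_closed by auto
    show "\<exists>x\<in>sect F \<top>\<^bsub>nuclei L\<^esub>. res F \<top>\<^bsub>nuclei L\<^esub> b x = s" if "b \<in> ?B" "s \<in> sect F b" for b s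
      using that extend_from_delta_diff [OF F _ _ _ g] by blast
    show "\<exists>y\<in>sect G \<top>\<^bsub>nuclei L\<^esub>. res G \<top>\<^bsub>nuclei L\<^esub> b y = t" if "b \<in> ?B" "t \<in> sect G b" for b t
      using that extend_from_delta_diff [OF G _ _ _ g'] by blast
    show "\<Squnion>\<^bsub>nuclei L\<^esub>{b \<in> ?B. b \<sqsubseteq>\<^bsub>nuclei L\<^esub> n} = n" if "n \<in> carrier (nuclei L)" for n
      using sup_delta_diff_below [OF that] .
  qed (use complete_lattice_nuclei F G bij agree in blast)+
  then show ?thesis by (rule globally_generated_pair.sheaf_iso)
qed

end

section \<open>Isomorphisms of skew lattices\<close>

text \<open>The section frames are given as bare records, so closure under the operations is a fact about
  them that has to be carried along.\<close>

definition skew_closed :: "('a, 'c) skew_lattice_scheme \<Rightarrow> bool" where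
  "skew_closed A \<longleftrightarrow> szero A \<in> carrier A \<and>
     (\<forall>x\<in>carrier A. \<forall>y\<in>carrier A. x \<curlywedge>\<^bsub>A\<^esub> y \<in> carrier A \<and> x \<curlyvee>\<^bsub>A\<^esub> y \<in> carrier A)"

definition skew_iso ::
    "('a, 'c) skew_lattice_scheme \<Rightarrow> ('b, 'd) skew_lattice_scheme \<Rightarrow> ('a \<Rightarrow> 'b) \<Rightarrow> bool" where
  "skew_iso A B f \<longleftrightarrow> bij_betw f (carrier A) (carrier B) \<and>
     (\<forall>x\<in>carrier A. \<forall>y\<in>carrier A. f (x \<curlywedge>\<^bsub>A\<^esub> y) = f x \<curlywedge>\<^bsub>B\<^esub> f y) \<and>
     (\<forall>x\<in>carrier A. \<forall>y\<in>carrier A. f (x \<curlyvee>\<^bsub>A\<^esub> y) = f x \<curlyvee>\<^bsub>B\<^esub> f y) \<and>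
     f (szero A) = szero B"

lemma skew_iso_closed: "\<lbrakk>skew_iso A B f; x \<in> carrier A\<rbrakk> \<Longrightarrow> f x \<in> carrier B"
  unfolding skew_iso_def by (meson bij_betwE)

lemma skew_iso_bij: "skew_iso A B f \<Longrightarrow> bij_betw f (carrier A) (carrier B)"
  by (simp add: skew_iso_def)

lemma skew_iso_inj: "\<lbrakk>skew_iso A B f; x \<in> carrier A; y \<in> carrier A\<rbrakk> \<Longrightarrow> f x = f y \<longleftrightarrow> x = y"
  unfolding skew_iso_def bij_betw_def by (meson inj_on_eq_iff)

lemma skew_iso_surj:
  assumes "skew_iso A B f" "y \<in> carrier B"
  obtains x where "x \<in> carrier A" "f x = y"
  using assms unfolding skew_iso_def bij_betw_def by (metis imageE)

lemma skew_iso_trans: "\<lbrakk>skew_iso A B f; skew_iso B C g\<rbrakk> \<Longrightarrow> skew_iso A C (g \<circ> f)"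
  using skew_iso_closed [of A B f] bij_betw_trans [of f "carrier A" "carrier B" g "carrier C"]
  by (simp add: skew_iso_def)

lemma skew_iso_sym:
  assumes f: "skew_iso A B f" and A: "skew_closed A"
  shows "skew_iso B A (inv_into (carrier A) f)"
proof -
  let ?g = "inv_into (carrier A) f"
  have bij: "bij_betw f (carrier A) (carrier B)" using f by (simp add: skew_iso_def)
  have g: "?g y \<in> carrier A" "f (?g y) = y" if "y \<in> carrier B" for y
    using bij_betw_inv_into [OF bij] bij_betw_inv_into_right [OF bij that] that bij_betwE by blast+
  have gf: "?g (f x) = x" if "x \<in> carrier A" for x
    by (rule bij_betw_inv_into_left [OF bij that])
  have "?g (y \<curlywedge>\<^bsub>B\<^esub> z) = ?g y \<curlywedge>\<^bsub>A\<^esub> ?g z" "?g (y \<curlyvee>\<^bsub>B\<^esub> z) = ?g y \<curlyvee>\<^bsub>A\<^esub> ?g z"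
    if "y \<in> carrier B" "z \<in> carrier B" for y z
  proof -
    have "f (?g y \<curlywedge>\<^bsub>A\<^esub> ?g z) = y \<curlywedge>\<^bsub>B\<^esub> z" "f (?g y \<curlyvee>\<^bsub>A\<^esub> ?g z) = y \<curlyvee>\<^bsub>B\<^esub> z"
      using f g that by (simp_all add: skew_iso_def)
    moreover have "?g y \<curlywedge>\<^bsub>A\<^esub> ?g z \<in> carrier A" "?g y \<curlyvee>\<^bsub>A\<^esub> ?g z \<in> carrier A"
      using A g that by (simp_all add: skew_closed_def)
    ultimately show "?g (y \<curlywedge>\<^bsub>B\<^esub> z) = ?g y \<curlywedge>\<^bsub>A\<^esub> ?g z" "?g (y \<curlyvee>\<^bsub>B\<^esub> z) = ?g y \<curlyvee>\<^bsub>A\<^esub> ?g z"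
      using gf by metis+
  qed
  moreover have "?g (szero B) = szero A"
    using f A gf [of "szero A"] by (simp add: skew_iso_def skew_closed_def)
  ultimately show ?thesis
    using bij_betw_inv_into [OF bij] by (simp add: skew_iso_def)
qed

lemma skew_closed_iso:
  assumes f: "skew_iso A B f" and A: "skew_closed A"
  shows "skew_closed B"
proof -
  have z: "szero B \<in> carrier B"
    using skew_iso_closed [OF f, of "szero A"] f A by (simp add: skew_iso_def skew_closed_def)
  have "y \<curlywedge>\<^bsub>B\<^esub> y' \<in> carrier B \<and> y \<curlyvee>\<^bsub>B\<^esub> y' \<in> carrier B" if y: "y \<in> carrier B" and y': "y' \<in> carrier B" for y y'
  proof -
    obtain x where x: "x \<in> carrier A" "f x = y" by (rule skew_iso_surj [OF f y])
    obtain x' where x': "x' \<in> carrier A" "f x' = y'" by (rule skew_iso_surj [OF f y'])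
    have "f (x \<curlywedge>\<^bsub>A\<^esub> x') = y \<curlywedge>\<^bsub>B\<^esub> y'" "f (x \<curlyvee>\<^bsub>A\<^esub> x') = y \<curlyvee>\<^bsub>B\<^esub> y'"
      using f x x' by (auto simp: skew_iso_def)
    moreover have "x \<curlywedge>\<^bsub>A\<^esub> x' \<in> carrier A" "x \<curlyvee>\<^bsub>A\<^esub> x' \<in> carrier A"
      using A x x' by (auto simp: skew_closed_def)
    ultimately show ?thesis using skew_iso_closed [OF f] by metis
  qed
  then show ?thesis using z by (simp add: skew_closed_def)
qed

text \<open>Suprema and the maximal \<open>\<D>\<close>-class are defined from the meet alone, so a bijection that preserves
  the operations preserves them as well.\<close>

lemma nc_frame_hom_of_skew_iso:
  assumes f: "skew_iso A B f" and A: "skew_closed A"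
  shows "nc_frame_hom A B f"
proof -
  note fc = skew_iso_closed [OF f]
  have meet: "f (x \<curlywedge>\<^bsub>A\<^esub> y) = f x \<curlywedge>\<^bsub>B\<^esub> f y" "x \<curlywedge>\<^bsub>A\<^esub> y \<in> carrier A"
    if "x \<in> carrier A" "y \<in> carrier A" for x y
    using f A that by (auto simp: skew_iso_def skew_closed_def)
  have le: "f x \<sqsubseteq>\<^bsub>natural_order B\<^esub> f y \<longleftrightarrow> x \<sqsubseteq>\<^bsub>natural_order A\<^esub> y" if "x \<in> carrier A" "y \<in> carrier A" for x y
    using that meet by (simp add: natural_order_def skew_iso_inj [OF f] flip: meet(1))
  have Upper: "Upper (natural_order C) S = {u \<in> carrier C. \<forall>x\<in>S. x \<sqsubseteq>\<^bsub>natural_order C\<^esub> u}"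
    if "S \<subseteq> carrier C" for C :: "('e, 'f) skew_lattice_scheme" and S
    using that by (auto simp: Upper_def natural_order_def)
  have "is_supremum B (f ` S) (f s)" if "commuting A S" and s: "is_supremum A S s" for S s
  proof -
    have S: "S \<subseteq> carrier A" using that(1) by (simp add: Defs.commuting_def)
    have fS: "f ` S \<subseteq> carrier B" using S fc by auto
    have s': "s \<in> carrier A" "\<forall>x\<in>S. x \<sqsubseteq>\<^bsub>natural_order A\<^esub> s"
      "\<And>u. \<lbrakk>u \<in> carrier A; \<forall>x\<in>S. x \<sqsubseteq>\<^bsub>natural_order A\<^esub> u\<rbrakk> \<Longrightarrow> s \<sqsubseteq>\<^bsub>natural_order A\<^esub> u"
      using s unfolding is_supremum_def least_def Upper [OF S] by auto
    have up: "f s \<in> Upper (natural_order B) (f ` S)"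
      unfolding Upper [OF fS] using s' S fc by (auto simp: le subset_iff)
    have "f s \<sqsubseteq>\<^bsub>natural_order B\<^esub> v" if v: "v \<in> Upper (natural_order B) (f ` S)" for v
    proof -
      have vc: "v \<in> carrier B" "\<forall>x\<in>S. f x \<sqsubseteq>\<^bsub>natural_order B\<^esub> v"
        using v unfolding Upper [OF fS] by auto
      obtain u where u: "u \<in> carrier A" "f u = v" by (rule skew_iso_surj [OF f vc(1)])
      have "\<forall>x\<in>S. x \<sqsubseteq>\<^bsub>natural_order A\<^esub> u"
      proof
        fix x assume "x \<in> S"
        then show "x \<sqsubseteq>\<^bsub>natural_order A\<^esub> u" using vc(2) u S le [of x u] by auto
      qed
      then show ?thesis using s'(3) [OF u(1)] le [OF s'(1) u(1)] u(2) by simp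
    qed
    moreover have "Upper (natural_order B) (f ` S) \<subseteq> carrier (natural_order B)" by simp
    ultimately show ?thesis using up unfolding is_supremum_def least_def by blast
  qed
  moreover have "f a \<in> maximal_D_class B" if a: "a \<in> maximal_D_class A" for a
    unfolding maximal_D_class_def
  proof (intro CollectI conjI ballI)
    have ac: "a \<in> carrier A" using a by (simp add: maximal_D_class_def)
    then show "f a \<in> carrier B" by (rule fc)
    fix b assume "b \<in> carrier B"
    then obtain x where x: "x \<in> carrier A" "f x = b" by (rule skew_iso_surj [OF f])
    have "f (x \<curlywedge>\<^bsub>A\<^esub> a \<curlywedge>\<^bsub>A\<^esub> x) = f x"
      using a x by (simp add: maximal_D_class_def)
    then show "b \<curlywedge>\<^bsub>B\<^esub> f a \<curlywedge>\<^bsub>B\<^esub> b = b"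
      using x ac meet by simp
  qed
  ultimately show ?thesis
    using f fc unfolding nc_frame_hom_def by (auto simp: skew_iso_def)
qed

lemma nc_frame_iso_iff_skew_iso:
  assumes A: "skew_closed A"
  shows "nc_frame_iso A B \<longleftrightarrow> (\<exists>f. skew_iso A B f)"
proof
  assume "nc_frame_iso A B"
  then obtain f g where fg: "nc_frame_hom A B f" "nc_frame_hom B A g"
     "\<forall>x\<in>carrier A. g (f x) = x" "\<forall>y\<in>carrier B. f (g y) = y"
    unfolding nc_frame_iso_def by blast
  have "bij_betw f (carrier A) (carrier B)"
    using fg by (intro bij_betw_byWitness [where f' = g]) (auto simp: nc_frame_hom_def)
  then have "skew_iso A B f" using fg(1) by (simp add: skew_iso_def nc_frame_hom_def)
  then show "\<exists>f. skew_iso A B f" by (rule exI [of _ f])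
next
  assume "\<exists>f. skew_iso A B f"
  then obtain f where f: "skew_iso A B f" ..
  have bij: "bij_betw f (carrier A) (carrier B)" using f by (simp add: skew_iso_def)
  show "nc_frame_iso A B"
    unfolding nc_frame_iso_def
    using nc_frame_hom_of_skew_iso [OF f A]
      nc_frame_hom_of_skew_iso [OF skew_iso_sym [OF f A] skew_closed_iso [OF f A]]
      bij_betw_inv_into_left [OF bij] bij_betw_inv_into_right [OF bij] by blast
qed

text \<open>The equation \<open>x \<curlywedge> y \<curlywedge> x = x\<close> says that the \<open>\<D>\<close>-class of \<open>x\<close> is below that of \<open>y\<close>.\<close>

lemma skew_iso_sandwich:
  assumes f: "skew_iso A B f" and A: "skew_closed A" and xy: "x \<in> carrier A" "y \<in> carrier A"
  shows "f x \<curlywedge>\<^bsub>B\<^esub> f y \<curlywedge>\<^bsub>B\<^esub> f x = f x \<longleftrightarrow> x \<curlywedge>\<^bsub>A\<^esub> y \<curlywedge>\<^bsub>A\<^esub> x = x"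
proof -
  have "x \<curlywedge>\<^bsub>A\<^esub> y \<in> carrier A" "x \<curlywedge>\<^bsub>A\<^esub> y \<curlywedge>\<^bsub>A\<^esub> x \<in> carrier A"
    using A xy by (simp_all add: skew_closed_def)
  then show ?thesis
    using skew_iso_inj [OF f, of "x \<curlywedge>\<^bsub>A\<^esub> y \<curlywedge>\<^bsub>A\<^esub> x" x] f xy by (simp add: skew_iso_def)
qed

subsection \<open>The commutative shadow\<close>

text \<open>A map onto \<open>L\<close> that presents \<open>L\<close> as the quotient of \<open>A\<close> by Green's relation. For both kinds of section
  frames it is the first projection.\<close>

definition shadow_map :: "('a, 'c) skew_lattice_scheme \<Rightarrow> ('l, 'd) gorder_scheme \<Rightarrow> ('a \<Rightarrow> 'l) \<Rightarrow> bool" where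
  "shadow_map A L \<pi> \<longleftrightarrow> \<pi> ` carrier A = carrier L \<and>
     (\<forall>x\<in>carrier A. \<forall>y\<in>carrier A. \<pi> x \<sqsubseteq>\<^bsub>L\<^esub> \<pi> y \<longleftrightarrow> x \<curlywedge>\<^bsub>A\<^esub> y \<curlywedge>\<^bsub>A\<^esub> x = x)"

lemma shadow_map_comp:
  assumes f: "skew_iso A B f" and A: "skew_closed A" and \<pi>: "shadow_map B L \<pi>"
  shows "shadow_map A L (\<pi> \<circ> f)"
proof -
  have "f ` carrier A = carrier B" using f by (simp add: skew_iso_def bij_betw_def)
  then have "(\<pi> \<circ> f) ` carrier A = carrier L"
    using \<pi> by (simp only: shadow_map_def image_comp [symmetric])
  then show ?thesis
    using \<pi> skew_iso_closed [OF f] skew_iso_sandwich [OF f A] by (simp add: shadow_map_def)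
qed

text \<open>Both targets carry the order of \<open>A\<close> modulo Green's relation, so each determines the other.\<close>

lemma shadow_map_unique:
  assumes L: "complete_lattice L" and M: "complete_lattice M"
    and \<pi>: "shadow_map A L \<pi>" and \<rho>: "shadow_map A M \<rho>"
  obtains \<phi> where "frame_hom L M \<phi>" "bij_betw \<phi> (carrier L) (carrier M)"
    "\<And>x. x \<in> carrier A \<Longrightarrow> \<phi> (\<pi> x) = \<rho> x" "frame_iso L M"
proof -
  interpret L: complete_lattice L by fact
  interpret M: complete_lattice M by fact
  have \<pi>c: "\<pi> x \<in> carrier L" and \<rho>c: "\<rho> x \<in> carrier M" if "x \<in> carrier A" for x
    using that \<pi> \<rho> by (auto simp: shadow_map_def)
  have iff: "\<pi> x \<sqsubseteq>\<^bsub>L\<^esub> \<pi> y \<longleftrightarrow> \<rho> x \<sqsubseteq>\<^bsub>M\<^esub> \<rho> y" if "x \<in> carrier A" "y \<in> carrier A" for x y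
    using that \<pi> \<rho> by (simp add: shadow_map_def)
  define r where "r = inv_into (carrier A) \<pi>"
  have r: "r u \<in> carrier A" "\<pi> (r u) = u" if "u \<in> carrier L" for u
    using that \<pi> by (auto simp: r_def shadow_map_def inv_into_into f_inv_into_f)
  define \<phi> where "\<phi> = \<rho> \<circ> r"
  have eq: "\<phi> (\<pi> x) = \<rho> x" if x: "x \<in> carrier A" for x
    using iff [of "r (\<pi> x)" x] iff [of x "r (\<pi> x)"] r [OF \<pi>c [OF x]] \<rho>c \<pi>c x M.le_antisym
    by (simp add: \<phi>_def)
  have le: "\<phi> u \<sqsubseteq>\<^bsub>M\<^esub> \<phi> v \<longleftrightarrow> u \<sqsubseteq>\<^bsub>L\<^esub> v" if "u \<in> carrier L" "v \<in> carrier L" for u v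
    using iff [of "r u" "r v"] r that by (simp add: \<phi>_def)
  have bij: "bij_betw \<phi> (carrier L) (carrier M)"
    unfolding bij_betw_def
  proof
    show "inj_on \<phi> (carrier L)"
    proof (rule inj_onI)
      fix u v assume uv: "u \<in> carrier L" "v \<in> carrier L" "\<phi> u = \<phi> v"
      then have "\<phi> u \<in> carrier M" using \<rho>c r by (simp add: \<phi>_def)
      then show "u = v" using le [of u v] le [of v u] uv L.le_antisym by simp
    qed
    show "\<phi> ` carrier L = carrier M"
    proof
      show "\<phi> ` carrier L \<subseteq> carrier M" using \<rho>c r by (auto simp: \<phi>_def)
      show "carrier M \<subseteq> \<phi> ` carrier L"
      proof
        fix m assume "m \<in> carrier M"
        then obtain x where "x \<in> carrier A" "m = \<rho> x" using \<rho> unfolding shadow_map_def by (metis imageE)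
        then show "m \<in> \<phi> ` carrier L" using eq \<pi>c by (metis imageI)
      qed
    qed
  qed
  show ?thesis
    using that [OF frame_hom_of_order_iso [OF L M bij le] bij eq frame_iso_of_order_iso [OF L M bij le]] .
qed

text \<open>The \<open>\<D>\<close>-classes are the fibres of \<open>\<pi>\<close>.\<close>

lemma frame_iso_commutative_shadow:
  assumes L: "complete_lattice L" and \<pi>: "shadow_map A L \<pi>"
    and meet: "\<And>x y. \<lbrakk>x \<in> carrier A; y \<in> carrier A\<rbrakk> \<Longrightarrow> x \<curlywedge>\<^bsub>A\<^esub> y \<in> carrier A \<and> \<pi> (x \<curlywedge>\<^bsub>A\<^esub> y) = \<pi> x \<sqinter>\<^bsub>L\<^esub> \<pi> y"
  shows "frame_iso (commutative_shadow A) L"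
proof -
  interpret L: complete_lattice L by fact
  let ?S = "commutative_shadow A"
  have \<pi>c: "\<pi> x \<in> carrier L" if "x \<in> carrier A" for x
    using that \<pi> by (auto simp: shadow_map_def)
  have D: "(x, y) \<in> green_D A \<longleftrightarrow> x \<in> carrier A \<and> y \<in> carrier A \<and> \<pi> x = \<pi> y" for x y
    using \<pi> \<pi>c L.eq_iff_le [of "\<pi> x" "\<pi> y"] by (auto simp: green_D_def shadow_map_def)
  define g where "g u = {x \<in> carrier A. \<pi> x = u}" for u
  have cls: "green_D A `` {x} = g (\<pi> x)" if "x \<in> carrier A" for x
    using that by (auto simp: D g_def)
  have ne: "\<exists>x. x \<in> g u" if u: "u \<in> carrier L" for u
  proof -
    obtain x where "x \<in> carrier A" "\<pi> x = u" using u \<pi> unfolding shadow_map_def by (metis imageE)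
    then show ?thesis by (auto simp: g_def)
  qed
  have bij: "bij_betw g (carrier L) (carrier ?S)"
    unfolding bij_betw_def
  proof
    show "inj_on g (carrier L)"
    proof (rule inj_onI)
      fix u v assume uv: "u \<in> carrier L" "v \<in> carrier L" "g u = g v"
      obtain x where "x \<in> g u" using ne uv(1) by blast
      then have "\<pi> x = u" "\<pi> x = v" using uv(3) by (auto simp: g_def)
      then show "u = v" by simp
    qed
    have "carrier ?S = (\<lambda>x. green_D A `` {x}) ` carrier A"
      by (auto simp: commutative_shadow_def quotient_def)
    also have "\<dots> = (\<lambda>x. g (\<pi> x)) ` carrier A" by (rule image_cong [OF refl cls])
    also have "\<dots> = g ` (\<pi> ` carrier A)" by (simp only: image_image)
    also have "\<dots> = g ` carrier L" using \<pi> by (simp only: shadow_map_def)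
    finally show "g ` carrier L = carrier ?S" by simp
  qed
  have le: "g u \<sqsubseteq>\<^bsub>?S\<^esub> g v \<longleftrightarrow> u \<sqsubseteq>\<^bsub>L\<^esub> v" if uv: "u \<in> carrier L" "v \<in> carrier L" for u v
  proof -
    obtain x y where "x \<in> g u" "y \<in> g v" using ne [OF uv(1)] ne [OF uv(2)] by blast
    moreover have "x \<curlywedge>\<^bsub>A\<^esub> y \<in> g u \<longleftrightarrow> u \<sqinter>\<^bsub>L\<^esub> v = u" if "x \<in> g u" "y \<in> g v" for x y
      using that meet [of x y] by (auto simp: g_def)
    moreover have "g u \<sqsubseteq>\<^bsub>?S\<^esub> g v \<longleftrightarrow> (\<exists>x\<in>g u. \<exists>y\<in>g v. x \<curlywedge>\<^bsub>A\<^esub> y \<in> g u)"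
      by (simp add: commutative_shadow_def)
    ultimately have "g u \<sqsubseteq>\<^bsub>?S\<^esub> g v \<longleftrightarrow> u \<sqinter>\<^bsub>L\<^esub> v = u" by blast
    then show ?thesis using L.le_iff_meet_eq uv by simp
  qed
  let ?h = "inv_into (carrier L) g"
  have bij': "bij_betw ?h (carrier ?S) (carrier L)" using bij by (rule bij_betw_inv_into)
  have le': "?h X \<sqsubseteq>\<^bsub>L\<^esub> ?h Y \<longleftrightarrow> X \<sqsubseteq>\<^bsub>?S\<^esub> Y" if "X \<in> carrier ?S" "Y \<in> carrier ?S" for X Y
    using le [of "?h X" "?h Y"] that bij_betwE [OF bij'] bij_betw_inv_into_right [OF bij] by auto
  have "complete_lattice ?S"
    by (rule complete_lattice_transport [OF L _ bij' le']) (simp add: commutative_shadow_def)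
  then show ?thesis
    by (rule frame_iso_of_order_iso [OF _ L bij' le'])
qed

section \<open>The noncommutative frames of sections\<close>

context frame
begin

lemma carrier_dual: "(u, s) \<in> carrier (dual_nc_frame L F) \<longleftrightarrow> u \<in> carrier L \<and> s \<in> sect F (nu L u)"
  by (simp add: dual_nc_frame_def)

lemma meet_dual: "(u, s) \<curlywedge>\<^bsub>dual_nc_frame L F\<^esub> (v, t) = (u \<sqinter> v, res F (nu L u) (nu L (u \<sqinter> v)) s)"
  by (simp add: dual_nc_frame_def)

lemma zero_dual: "szero (dual_nc_frame L F) = (\<bottom>, THE s. s \<in> sect F \<bottom>\<^bsub>nuclei L\<^esub>)"
  by (simp add: dual_nc_frame_def nu_bottom)

context
  fixes F :: "('a \<Rightarrow> 'a, 's) presheaf"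
  assumes F: "sheaf (nuclei L) F"
begin

interpretation F: sheaf "nuclei L" F by (rule F)

lemma res_nu_meet_closed:
  "\<lbrakk>u \<in> carrier L; v \<in> carrier L; s \<in> sect F (nu L u)\<rbrakk>
    \<Longrightarrow> res F (nu L u) (nu L (u \<sqinter> v)) s \<in> sect F (nu L (u \<sqinter> v))"
  by (intro F.res_closed) (auto intro: nu_nucleus nu_mono meet_left)

lemma join_dual_iff:
  assumes "(u, s) \<in> carrier (dual_nc_frame L F)" "(v, t) \<in> carrier (dual_nc_frame L F)"
  shows "(u, s) \<curlyvee>\<^bsub>dual_nc_frame L F\<^esub> (v, t) = (u \<squnion> v, r) \<longleftrightarrow>
    r \<in> sect F (nu L (u \<squnion> v)) \<and>
    res F (nu L (u \<squnion> v)) (delta_diff L u v) r = res F (nu L u) (delta_diff L u v) s \<and>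
    res F (nu L (u \<squnion> v)) (nu L v) r = t" (is "_ \<longleftrightarrow> ?P r")
proof -
  have c: "u \<in> carrier L" "s \<in> sect F (nu L u)" "v \<in> carrier L" "t \<in> sect F (nu L v)"
    using assms by (simp_all add: carrier_dual)
  have "res F (nu L u) (delta_diff L u v) s \<in> sect F (delta_diff L u v)"
    using c by (intro F.res_closed delta_diff_le_nu nu_nucleus delta_diff_closed)
  then have ex1: "\<exists>!r. ?P r"
    using glue_delta_diff [OF F c(1,3) _ c(4)] by blast
  have "(u, s) \<curlyvee>\<^bsub>dual_nc_frame L F\<^esub> (v, t) = (u \<squnion> v, THE r. ?P r)"
    by (simp add: dual_nc_frame_def)
  then show ?thesis using ex1 theI' [OF ex1] by auto
qed

lemma join_dualE:
  assumes "(u, s) \<in> carrier (dual_nc_frame L F)" "(v, t) \<in> carrier (dual_nc_frame L F)"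
  obtains r where "(u, s) \<curlyvee>\<^bsub>dual_nc_frame L F\<^esub> (v, t) = (u \<squnion> v, r)"
    "r \<in> sect F (nu L (u \<squnion> v))"
    "res F (nu L (u \<squnion> v)) (delta_diff L u v) r = res F (nu L u) (delta_diff L u v) s"
    "res F (nu L (u \<squnion> v)) (nu L v) r = t"
proof -
  obtain r where r: "(u, s) \<curlyvee>\<^bsub>dual_nc_frame L F\<^esub> (v, t) = (u \<squnion> v, r)"
    by (simp add: dual_nc_frame_def)
  have "r \<in> sect F (nu L (u \<squnion> v)) \<and>
    res F (nu L (u \<squnion> v)) (delta_diff L u v) r = res F (nu L u) (delta_diff L u v) s \<and>
    res F (nu L (u \<squnion> v)) (nu L v) r = t"
    using join_dual_iff [OF assms, of r] r by (rule iffD1)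
  then show ?thesis using that [OF r] by blast
qed

lemma skew_closed_dual: "skew_closed (dual_nc_frame L F)"
  unfolding skew_closed_def
proof (intro conjI ballI)
  have "(THE s. s \<in> sect F \<bottom>\<^bsub>nuclei L\<^esub>) \<in> sect F \<bottom>\<^bsub>nuclei L\<^esub>"
    using theI' [OF sheaf_sect_unique_bottom [OF complete_lattice_nuclei F]] .
  then show "szero (dual_nc_frame L F) \<in> carrier (dual_nc_frame L F)"
    by (simp add: zero_dual carrier_dual nu_bottom)
  fix x y assume xy: "x \<in> carrier (dual_nc_frame L F)" "y \<in> carrier (dual_nc_frame L F)"
  obtain u s v t where p: "x = (u, s)" "y = (v, t)" by (cases x; cases y)
  show "x \<curlywedge>\<^bsub>dual_nc_frame L F\<^esub> y \<in> carrier (dual_nc_frame L F)"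
    using xy res_nu_meet_closed by (simp add: p meet_dual carrier_dual)
  obtain r where "x \<curlyvee>\<^bsub>dual_nc_frame L F\<^esub> y = (u \<squnion> v, r)" "r \<in> sect F (nu L (u \<squnion> v))"
    using join_dualE xy unfolding p by metis
  then show "x \<curlyvee>\<^bsub>dual_nc_frame L F\<^esub> y \<in> carrier (dual_nc_frame L F)"
    using xy by (simp add: p carrier_dual)
qed

text \<open>The global section makes the first projection surjective.\<close>

lemma shadow_map_dual:
  assumes ne: "sect F \<top>\<^bsub>nuclei L\<^esub> \<noteq> {}"
  shows "shadow_map (dual_nc_frame L F) L fst"
proof -
  let ?A = "dual_nc_frame L F"
  obtain g where g: "g \<in> sect F \<top>\<^bsub>nuclei L\<^esub>" using ne by blast
  have "u \<in> fst ` carrier ?A" if u: "u \<in> carrier L" for u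
  proof -
    have "res F \<top>\<^bsub>nuclei L\<^esub> (nu L u) g \<in> sect F (nu L u)"
      using u g nu_nucleus by (intro F.res_closed) auto
    then have "(u, res F \<top>\<^bsub>nuclei L\<^esub> (nu L u) g) \<in> carrier ?A" using u by (simp add: carrier_dual)
    then show ?thesis by (rule image_eqI [rotated]) simp
  qed
  then have "fst ` carrier ?A = carrier L"
    by (auto simp: dual_nc_frame_def)
  moreover have "fst x \<sqsubseteq> fst y \<longleftrightarrow> x \<curlywedge>\<^bsub>?A\<^esub> y \<curlywedge>\<^bsub>?A\<^esub> x = x"
    if xy: "x \<in> carrier ?A" "y \<in> carrier ?A" for x y
  proof -
    obtain u s v t where p: "x = (u, s)" "y = (v, t)" by (cases x; cases y)
    have c: "u \<in> carrier L" "s \<in> sect F (nu L u)" "v \<in> carrier L"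
      using xy by (simp_all add: p carrier_dual)
    have m: "u \<sqinter> v \<sqinter> u = u \<sqinter> v"
      using c meet_left [of "u \<sqinter> v" u] by (intro meet_eqI) (auto simp: le_meet_iff meet_left meet_right)
    have "x \<curlywedge>\<^bsub>?A\<^esub> y \<curlywedge>\<^bsub>?A\<^esub> x = (u \<sqinter> v, res F (nu L u) (nu L (u \<sqinter> v)) s)"
      using c nu_nucleus nu_mono [of "u \<sqinter> v" u] meet_left
      by (simp add: p meet_dual m F.res_res)
    moreover have "res F (nu L u) (nu L (u \<sqinter> v)) s = s" if "u \<sqinter> v = u"
      using F.res_id [OF nu_nucleus [OF c(1)] c(2)] by (simp add: that)
    ultimately show ?thesis
      using le_iff_meet_eq [OF c(1,3)] by (auto simp: p)
  qed
  ultimately show ?thesis by (simp add: shadow_map_def)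
qed

text \<open>Whether two global sections agree on a locally closed part can be expressed by the skew
  lattice operations: restrict to the larger open part, and overwrite on the smaller one.\<close>

lemma agree_delta_diff_iff:
  assumes u: "(u, s) \<in> carrier (dual_nc_frame L F)" and v: "(v, t) \<in> carrier (dual_nc_frame L F)"
    and x: "(\<top>, x) \<in> carrier (dual_nc_frame L F)" and x': "(\<top>, x') \<in> carrier (dual_nc_frame L F)"
  shows "(\<top>, x) \<curlywedge>\<^bsub>dual_nc_frame L F\<^esub> (u, s) \<curlyvee>\<^bsub>dual_nc_frame L F\<^esub> (v, t) =
      (\<top>, x') \<curlywedge>\<^bsub>dual_nc_frame L F\<^esub> (u, s) \<curlyvee>\<^bsub>dual_nc_frame L F\<^esub> (v, t) \<longleftrightarrow>
    res F \<top>\<^bsub>nuclei L\<^esub> (delta_diff L u v) x = res F \<top>\<^bsub>nuclei L\<^esub> (delta_diff L u v) x'"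
proof -
  let ?A = "dual_nc_frame L F"
  have c: "u \<in> carrier L" "v \<in> carrier L" using u v by (simp_all add: carrier_dual)
  have tu: "\<top> \<sqinter> u = u" using c by (intro meet_eqI) auto
  have restrict: "(\<top>, y) \<curlywedge>\<^bsub>?A\<^esub> (u, s) = (u, res F \<top>\<^bsub>nuclei L\<^esub> (nu L u) y)"
    "(u, res F \<top>\<^bsub>nuclei L\<^esub> (nu L u) y) \<in> carrier ?A"
    "res F (nu L u) (delta_diff L u v) (res F \<top>\<^bsub>nuclei L\<^esub> (nu L u) y) = res F \<top>\<^bsub>nuclei L\<^esub> (delta_diff L u v) y"
    if "(\<top>, y) \<in> carrier ?A" for y
    using that c nu_nucleus delta_diff_closed delta_diff_le_nu
    by (simp_all add: meet_dual carrier_dual tu nu_top F.res_closed F.res_res)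
  obtain r where r: "(u, res F \<top>\<^bsub>nuclei L\<^esub> (nu L u) x) \<curlyvee>\<^bsub>?A\<^esub> (v, t) = (u \<squnion> v, r)"
    "r \<in> sect F (nu L (u \<squnion> v))"
    "res F (nu L (u \<squnion> v)) (delta_diff L u v) r = res F (nu L u) (delta_diff L u v) (res F \<top>\<^bsub>nuclei L\<^esub> (nu L u) x)"
    "res F (nu L (u \<squnion> v)) (nu L v) r = t"
    by (rule join_dualE [OF restrict(2) [OF x] v])
  have "(u, res F \<top>\<^bsub>nuclei L\<^esub> (nu L u) x') \<curlyvee>\<^bsub>?A\<^esub> (v, t) = (u \<squnion> v, r) \<longleftrightarrow>
      res F \<top>\<^bsub>nuclei L\<^esub> (delta_diff L u v) x = res F \<top>\<^bsub>nuclei L\<^esub> (delta_diff L u v) x'"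
    using r(2-4) restrict(3) [OF x] restrict(3) [OF x'] by (simp add: join_dual_iff [OF restrict(2) [OF x'] v])
  then show ?thesis
    using r(1) by (auto simp: restrict(1) [OF x] restrict(1) [OF x'])
qed

end

text \<open>An isomorphism over \<open>L\<close> acts on the elements over \<open>\<top>\<close>, that is, on the global sections, and it preserves the
  condition by which the preceding lemma expresses their agreement.\<close>

lemma sheaf_iso_of_skew_iso:
  assumes F: "sheaf (nuclei L) F" and G: "sheaf (nuclei L) G" and ne: "sect F \<top>\<^bsub>nuclei L\<^esub> \<noteq> {}"
    and f: "skew_iso (dual_nc_frame L F) (dual_nc_frame L G) f"
    and over: "\<And>x. x \<in> carrier (dual_nc_frame L F) \<Longrightarrow> fst (f x) = fst x"
  shows "sheaf_iso (nuclei L) F G"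
proof -
  let ?A = "dual_nc_frame L F" and ?B = "dual_nc_frame L G"
  note A = skew_closed_dual [OF F]
  have split: "f (u, s) = (u, snd (f (u, s)))" if "(u, s) \<in> carrier ?A" for u s
    using over [OF that] by (simp add: prod_eq_iff)
  have fB: "(u, snd (f (u, s))) \<in> carrier ?B" if "(u, s) \<in> carrier ?A" for u s
    using skew_iso_closed [OF f that] split [OF that] by simp
  define \<theta> where "\<theta> x = snd (f (\<top>, x))" for x
  have topF: "(\<top>, x) \<in> carrier ?A \<longleftrightarrow> x \<in> sect F \<top>\<^bsub>nuclei L\<^esub>" for x by (simp add: carrier_dual nu_top)
  have topG: "(\<top>, x) \<in> carrier ?B \<longleftrightarrow> x \<in> sect G \<top>\<^bsub>nuclei L\<^esub>" for x by (simp add: carrier_dual nu_top)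
  have f\<theta>: "f (\<top>, x) = (\<top>, \<theta> x)" if "x \<in> sect F \<top>\<^bsub>nuclei L\<^esub>" for x
    using split [of \<top> x] that by (simp add: topF \<theta>_def)
  have \<theta>c: "(\<top>, \<theta> x) \<in> carrier ?B" if "x \<in> sect F \<top>\<^bsub>nuclei L\<^esub>" for x
    using fB [of \<top> x] that by (simp add: topF \<theta>_def)
  have bij: "bij_betw \<theta> (sect F \<top>\<^bsub>nuclei L\<^esub>) (sect G \<top>\<^bsub>nuclei L\<^esub>)"
    unfolding bij_betw_def
  proof
    show "inj_on \<theta> (sect F \<top>\<^bsub>nuclei L\<^esub>)"
    proof (rule inj_onI)
      fix x y assume xy: "x \<in> sect F \<top>\<^bsub>nuclei L\<^esub>" "y \<in> sect F \<top>\<^bsub>nuclei L\<^esub>" "\<theta> x = \<theta> y"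
      then have "f (\<top>, x) = f (\<top>, y)" using f\<theta> by simp
      then show "x = y" using skew_iso_inj [OF f, of "(\<top>, x)" "(\<top>, y)"] xy by (simp add: topF)
    qed
    show "\<theta> ` sect F \<top>\<^bsub>nuclei L\<^esub> = sect G \<top>\<^bsub>nuclei L\<^esub>"
    proof
      show "\<theta> ` sect F \<top>\<^bsub>nuclei L\<^esub> \<subseteq> sect G \<top>\<^bsub>nuclei L\<^esub>" using \<theta>c topG by blast
      show "sect G \<top>\<^bsub>nuclei L\<^esub> \<subseteq> \<theta> ` sect F \<top>\<^bsub>nuclei L\<^esub>"
      proof
        fix y assume "y \<in> sect G \<top>\<^bsub>nuclei L\<^esub>"
        then have "(\<top>, y) \<in> carrier ?B" by (simp add: topG)
        then obtain z where z: "z \<in> carrier ?A" "f z = (\<top>, y)" by (rule skew_iso_surj [OF f])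
        then have "z = (\<top>, snd z)" using over [OF z(1)] by (simp add: prod_eq_iff)
        then have "snd z \<in> sect F \<top>\<^bsub>nuclei L\<^esub>" "\<theta> (snd z) = y"
          using z topF by (metis, metis \<theta>_def snd_conv)
        then show "y \<in> \<theta> ` sect F \<top>\<^bsub>nuclei L\<^esub>" by blast
      qed
    qed
  qed
  show ?thesis
  proof (rule sheaf_iso_of_global_sections [OF F G ne bij])
    fix u v x x'
    assume u: "u \<in> carrier L" and v: "v \<in> carrier L"
      and x: "x \<in> sect F \<top>\<^bsub>nuclei L\<^esub>" and x': "x' \<in> sect F \<top>\<^bsub>nuclei L\<^esub>"
    have "\<exists>s. (w, s) \<in> carrier ?A" if "w \<in> carrier L" for w
      using that shadow_map_dual [OF F ne] unfolding shadow_map_def by (metis imageE prod.collapse)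
    then obtain s t where st: "(u, s) \<in> carrier ?A" "(v, t) \<in> carrier ?A" using u v by metis
    have xA: "(\<top>, x) \<in> carrier ?A" "(\<top>, x') \<in> carrier ?A" using x x' by (simp_all add: topF)
    let ?w = "\<lambda>y. (\<top>, y) \<curlywedge>\<^bsub>?A\<^esub> (u, s) \<curlyvee>\<^bsub>?A\<^esub> (v, t)"
    have w: "?w y \<in> carrier ?A" "f (?w y) = (\<top>, \<theta> y) \<curlywedge>\<^bsub>?B\<^esub> (u, snd (f (u, s))) \<curlyvee>\<^bsub>?B\<^esub> (v, snd (f (v, t)))"
      if y: "y \<in> sect F \<top>\<^bsub>nuclei L\<^esub>" for y
    proof -
      have yA: "(\<top>, y) \<in> carrier ?A" using y by (simp add: topF)
      have m: "(\<top>, y) \<curlywedge>\<^bsub>?A\<^esub> (u, s) \<in> carrier ?A" using A yA st by (simp add: skew_closed_def)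
      then show "?w y \<in> carrier ?A" using A st by (simp add: skew_closed_def)
      have "f (?w y) = f (\<top>, y) \<curlywedge>\<^bsub>?B\<^esub> f (u, s) \<curlyvee>\<^bsub>?B\<^esub> f (v, t)"
        using f m yA st by (simp add: skew_iso_def)
      then show "f (?w y) = (\<top>, \<theta> y) \<curlywedge>\<^bsub>?B\<^esub> (u, snd (f (u, s))) \<curlyvee>\<^bsub>?B\<^esub> (v, snd (f (v, t)))"
        using f\<theta> [OF y] split [OF st(1)] split [OF st(2)] by simp
    qed
    have "res F \<top>\<^bsub>nuclei L\<^esub> (delta_diff L u v) x = res F \<top>\<^bsub>nuclei L\<^esub> (delta_diff L u v) x' \<longleftrightarrow> ?w x = ?w x'"
      using agree_delta_diff_iff [OF F st xA] by simp
    also have "\<dots> \<longleftrightarrow> f (?w x) = f (?w x')"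
      using skew_iso_inj [OF f w(1) [OF x] w(1) [OF x']] by simp
    also have "\<dots> \<longleftrightarrow> res G \<top>\<^bsub>nuclei L\<^esub> (delta_diff L u v) (\<theta> x) = res G \<top>\<^bsub>nuclei L\<^esub> (delta_diff L u v) (\<theta> x')"
      unfolding w(2) [OF x] w(2) [OF x']
      by (rule agree_delta_diff_iff [OF G fB [OF st(1)] fB [OF st(2)] \<theta>c [OF x] \<theta>c [OF x']])
    finally show "res F \<top>\<^bsub>nuclei L\<^esub> (delta_diff L u v) x = res F \<top>\<^bsub>nuclei L\<^esub> (delta_diff L u v) x' \<longleftrightarrow>
        res G \<top>\<^bsub>nuclei L\<^esub> (delta_diff L u v) (\<theta> x) = res G \<top>\<^bsub>nuclei L\<^esub> (delta_diff L u v) (\<theta> x')" .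
  qed
qed

text \<open>Joins are characterised by restrictions, which a morphism of sheaves respects.\<close>

lemma skew_iso_of_sheaf_iso:
  assumes F: "sheaf (nuclei L) F" and G: "sheaf (nuclei L) G" and iso: "sheaf_iso (nuclei L) F G"
  shows "\<exists>f. skew_iso (dual_nc_frame L F) (dual_nc_frame L G) f"
proof -
  let ?A = "dual_nc_frame L F" and ?B = "dual_nc_frame L G"
  obtain \<phi> where \<phi>: "\<And>n. n \<in> carrier (nuclei L) \<Longrightarrow> bij_betw (\<phi> n) (sect F n) (sect G n)"
    "\<And>n m s. \<lbrakk>n \<in> carrier (nuclei L); m \<in> carrier (nuclei L); m \<sqsubseteq>\<^bsub>nuclei L\<^esub> n; s \<in> sect F n\<rbrakk>
      \<Longrightarrow> \<phi> m (res F n m s) = res G n m (\<phi> n s)"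
    by (rule sheaf_isoE [OF iso], rule that) blast+
  have \<phi>c: "\<phi> n s \<in> sect G n" if "n \<in> carrier (nuclei L)" "s \<in> sect F n" for n s
    using bij_betwE [OF \<phi>(1) [OF that(1)]] that(2) by blast
  define f where "f = (\<lambda>(u, s). (u, \<phi> (nu L u) s))"
  have f: "f (u, s) = (u, \<phi> (nu L u) s)" for u s by (simp add: f_def)
  have fB: "f x \<in> carrier ?B" if "x \<in> carrier ?A" for x
    using that \<phi>c nu_nucleus by (cases x) (simp add: f carrier_dual)
  have "bij_betw f (carrier ?A) (carrier ?B)"
    unfolding bij_betw_def
  proof
    show "inj_on f (carrier ?A)"
    proof (rule inj_onI)
      fix x y assume xy: "x \<in> carrier ?A" "y \<in> carrier ?A" "f x = f y"
      obtain u s v t where p: "x = (u, s)" "y = (v, t)" by (cases x; cases y)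
      have "u = v" "\<phi> (nu L u) s = \<phi> (nu L u) t" "u \<in> carrier L" "s \<in> sect F (nu L u)" "t \<in> sect F (nu L u)"
        using xy by (auto simp: p f carrier_dual)
      then show "x = y"
        using \<phi>(1) [OF nu_nucleus, of u] by (simp add: p bij_betw_def inj_on_def)
    qed
    show "f ` carrier ?A = carrier ?B"
    proof
      show "f ` carrier ?A \<subseteq> carrier ?B" using fB by blast
      show "carrier ?B \<subseteq> f ` carrier ?A"
      proof
        fix y assume y: "y \<in> carrier ?B"
        obtain u t where p: "y = (u, t)" by (cases y)
        have c: "u \<in> carrier L" "t \<in> sect G (nu L u)" using y by (simp_all add: p carrier_dual)
        then obtain s where "s \<in> sect F (nu L u)" "\<phi> (nu L u) s = t"
          using \<phi>(1) [OF nu_nucleus [OF c(1)]] unfolding bij_betw_def by (metis imageE)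
        then have "(u, s) \<in> carrier ?A" "f (u, s) = y" using c by (simp_all add: p f carrier_dual)
        then show "y \<in> f ` carrier ?A" by blast
      qed
    qed
  qed
  moreover have "f (x \<curlywedge>\<^bsub>?A\<^esub> y) = f x \<curlywedge>\<^bsub>?B\<^esub> f y" if xy: "x \<in> carrier ?A" "y \<in> carrier ?A" for x y
  proof -
    obtain u s v t where p: "x = (u, s)" "y = (v, t)" by (cases x; cases y)
    have c: "u \<in> carrier L" "s \<in> sect F (nu L u)" "v \<in> carrier L" using xy by (simp_all add: p carrier_dual)
    show ?thesis
      using \<phi>(2) [of "nu L u" "nu L (u \<sqinter> v)" s] c nu_nucleus nu_mono meet_left
      by (simp add: p f meet_dual)
  qed
  moreover have "f (x \<curlyvee>\<^bsub>?A\<^esub> y) = f x \<curlyvee>\<^bsub>?B\<^esub> f y" if xy: "x \<in> carrier ?A" "y \<in> carrier ?A" for x y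
  proof -
    obtain u s v t where p: "x = (u, s)" "y = (v, t)" by (cases x; cases y)
    have c: "u \<in> carrier L" "s \<in> sect F (nu L u)" "v \<in> carrier L" "t \<in> sect F (nu L v)"
      using xy by (simp_all add: p carrier_dual)
    let ?uv = "nu L (u \<squnion> v)" and ?d = "delta_diff L u v"
    have n: "?uv \<in> carrier (nuclei L)" "?d \<in> carrier (nuclei L)" "nu L u \<in> carrier (nuclei L)"
      "nu L v \<in> carrier (nuclei L)" "?d \<sqsubseteq>\<^bsub>nuclei L\<^esub> nu L u" "nu L v \<sqsubseteq>\<^bsub>nuclei L\<^esub> ?uv"
      "nu L u \<sqsubseteq>\<^bsub>nuclei L\<^esub> ?uv"
      using c nu_nucleus delta_diff_closed delta_diff_le_nu nu_mono join_left join_right by simp_all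
    have dle: "?d \<sqsubseteq>\<^bsub>nuclei L\<^esub> ?uv" using N.le_trans [OF n(5,7)] n by simp
    obtain r where r: "(u, s) \<curlyvee>\<^bsub>?A\<^esub> (v, t) = (u \<squnion> v, r)" "r \<in> sect F ?uv"
      "res F ?uv ?d r = res F (nu L u) ?d s" "res F ?uv (nu L v) r = t"
      using join_dualE [OF F] xy unfolding p by metis
    have "\<phi> ?uv r \<in> sect G ?uv" using \<phi>c n r by simp
    moreover have "res G ?uv ?d (\<phi> ?uv r) = res G (nu L u) ?d (\<phi> (nu L u) s)"
      using \<phi>(2) [OF n(1,2) dle r(2)] \<phi>(2) [OF n(3,2,5) c(2)] r(3) by simp
    moreover have "res G ?uv (nu L v) (\<phi> ?uv r) = \<phi> (nu L v) t"
      using \<phi>(2) [OF n(1,4,6) r(2)] r(4) by simp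
    ultimately have "f (u, s) \<curlyvee>\<^bsub>?B\<^esub> f (v, t) = (u \<squnion> v, \<phi> ?uv r)"
      using join_dual_iff [OF G, of u "\<phi> (nu L u) s" v "\<phi> (nu L v) t"] fB [OF xy(1)] fB [OF xy(2)]
      by (simp add: p f)
    then show ?thesis by (simp add: p r(1) f)
  qed
  moreover have "f (szero ?A) = szero ?B"
  proof -
    have b: "(THE s. s \<in> sect F \<bottom>\<^bsub>nuclei L\<^esub>) \<in> sect F \<bottom>\<^bsub>nuclei L\<^esub>"
      using theI' [OF sheaf_sect_unique_bottom [OF complete_lattice_nuclei F]] .
    have "(THE s. s \<in> sect G \<bottom>\<^bsub>nuclei L\<^esub>) = \<phi> \<bottom>\<^bsub>nuclei L\<^esub> (THE s. s \<in> sect F \<bottom>\<^bsub>nuclei L\<^esub>)"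
      using the1_equality [OF sheaf_sect_unique_bottom [OF complete_lattice_nuclei G] \<phi>c [OF _ b]] by simp
    then show ?thesis by (simp add: zero_dual f nu_bottom)
  qed
  ultimately have "skew_iso ?A ?B f" by (simp add: skew_iso_def)
  then show ?thesis by (rule exI [of _ f])
qed

text \<open>The sections of \<open>h\<^sub>* E\<close> over \<open>\<nu>\<^sub>u\<close> are literally those of \<open>E\<close> over \<open>\<phi> u\<close>, and \<open>h\<close> takes differences to set
  differences. So both joins are described by the same condition.\<close>

lemma skew_iso_dual_H:
  assumes \<phi>: "frame_hom L (opens X) \<phi>" "bij_betw \<phi> (carrier L) (carrier (opens X))"
    and h: "frame_hom (nuclei L) (opens (front_topology X)) h" "\<And>a. a \<in> carrier L \<Longrightarrow> h (nu L a) = \<phi> a"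
  shows "skew_iso (dual_nc_frame L (direct_image h E)) (H X E) (\<lambda>(u, s). (\<phi> u, s))"
proof -
  let ?A = "dual_nc_frame L (direct_image h E)" and ?f = "\<lambda>(u, s). (\<phi> u, s)"
  have dd: "h (delta_diff L u v) = \<phi> u - \<phi> v" if "u \<in> carrier L" "v \<in> carrier L" for u v
    using frame_hom_delta_diff [OF h] that by blast
  have inj: "inj_on \<phi> (carrier L)" and surj: "\<phi> ` carrier L = {U. openin X U}"
    using \<phi>(2) by (auto simp: bij_betw_def carrier_opens)
  have "bij_betw ?f (carrier ?A) (carrier (H X E))"
    unfolding bij_betw_def
  proof
    show "inj_on ?f (carrier ?A)"
      using inj by (auto simp: inj_on_def carrier_dual)
    show "?f ` carrier ?A = carrier (H X E)"
    proof
      show "?f ` carrier ?A \<subseteq> carrier (H X E)"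
        using surj h(2) by (auto simp: carrier_dual H_def direct_image_def)
      show "carrier (H X E) \<subseteq> ?f ` carrier ?A"
      proof
        fix y assume y: "y \<in> carrier (H X E)"
        obtain U s where p: "y = (U, s)" by (cases y)
        have c: "U \<in> \<phi> ` carrier L" "s \<in> sect E U" using y surj by (simp_all add: p H_def)
        then obtain u where "u \<in> carrier L" "U = \<phi> u" by blast
        then have "(u, s) \<in> carrier ?A" "y = ?f (u, s)"
          using c h(2) by (simp_all add: p carrier_dual direct_image_def)
        then show "y \<in> ?f ` carrier ?A" by blast
      qed
    qed
  qed
  moreover have "?f (x \<curlywedge>\<^bsub>?A\<^esub> y) = ?f x \<curlywedge>\<^bsub>H X E\<^esub> ?f y" if xy: "x \<in> carrier ?A" "y \<in> carrier ?A" for x y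
  proof -
    obtain u s v t where p: "x = (u, s)" "y = (v, t)" by (cases x; cases y)
    show ?thesis
      using xy by (simp add: p carrier_dual meet_dual H_def direct_image_def h(2) to_opens_meet [OF \<phi>(1)])
  qed
  moreover have "?f (x \<curlyvee>\<^bsub>?A\<^esub> y) = ?f x \<curlyvee>\<^bsub>H X E\<^esub> ?f y" if xy: "x \<in> carrier ?A" "y \<in> carrier ?A" for x y
  proof -
    obtain u s v t where p: "x = (u, s)" "y = (v, t)" by (cases x; cases y)
    have "u \<in> carrier L" "v \<in> carrier L" using xy by (simp_all add: p carrier_dual)
    then show ?thesis
      by (simp add: p dual_nc_frame_def H_def direct_image_def h(2) dd to_opens_join [OF \<phi>(1)])
  qed
  moreover have "?f (szero ?A) = szero (H X E)"
  proof -
    have "\<phi> \<bottom> = {}"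
      using frame_hom_bottom [OF complete_lattice_axioms complete_lattice_opens \<phi>(1)] by (simp add: bottom_opens)
    then show ?thesis
      using h(2) [of \<bottom>] by (simp add: dual_nc_frame_def H_def direct_image_def)
  qed
  ultimately show ?thesis by (simp add: skew_iso_def)
qed

end

lemma shadow_map_H:
  assumes E: "sheaf (opens (front_topology X)) E" and ne: "sect E (topspace X) \<noteq> {}"
  shows "shadow_map (H X E) (opens X) fst"
proof -
  interpret E: sheaf "opens (front_topology X)" E by fact
  have op: "U \<in> carrier (opens (front_topology X))" if "openin X U" for U
    using that by (simp add: carrier_opens openin_front_of_open)
  obtain g where g: "g \<in> sect E (topspace X)" using ne by blast
  have "U \<in> fst ` carrier (H X E)" if U: "openin X U" for U
  proof -
    have "res E (topspace X) U g \<in> sect E U"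
      using U g op openin_subset [OF U] by (intro E.res_closed) (auto simp: le_opens)
    then have "(U, res E (topspace X) U g) \<in> carrier (H X E)" using U by (simp add: H_def)
    then show ?thesis by (rule image_eqI [rotated]) simp
  qed
  then have "fst ` carrier (H X E) = carrier (opens X)"
    by (auto simp: H_def carrier_opens)
  moreover have "fst x \<sqsubseteq>\<^bsub>opens X\<^esub> fst y \<longleftrightarrow> x \<curlywedge>\<^bsub>H X E\<^esub> y \<curlywedge>\<^bsub>H X E\<^esub> x = x"
    if xy: "x \<in> carrier (H X E)" "y \<in> carrier (H X E)" for x y
  proof -
    obtain U s V t where p: "x = (U, s)" "y = (V, t)" by (cases x; cases y)
    have c: "openin X U" "s \<in> sect E U" "openin X V" using xy by (simp_all add: p H_def)
    have m: "U \<inter> V \<inter> U = U \<inter> V" by blast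
    have "x \<curlywedge>\<^bsub>H X E\<^esub> y \<curlywedge>\<^bsub>H X E\<^esub> x = (U \<inter> V, res E U (U \<inter> V) s)"
      using c op by (simp add: p H_def m E.res_res le_opens openin_Int)
    then show ?thesis
      using E.res_id [OF op [OF c(1)] c(2)] by (auto simp: p le_opens inf.absorb_iff1)
  qed
  ultimately show ?thesis by (simp add: shadow_map_def)
qed

section \<open>Spatial noncommutative frames\<close>

lemma (in left_handed_nc_frame) skew_closed: "skew_closed A"
  by (simp add: skew_closed_def zero_closed smeet_closed sjoin_closed)

lemma is_dualE:
  assumes "left_handed_nc_frame A" "is_dual A L F"
  obtains f where "skew_closed A" "frame L" "sheaf (nuclei L) F" "sect F \<top>\<^bsub>nuclei L\<^esub> \<noteq> {}"
    "skew_iso A (dual_nc_frame L F) f"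
  using assms nc_frame_iso_iff_skew_iso [OF left_handed_nc_frame.skew_closed [OF assms(1)]]
    left_handed_nc_frame.skew_closed [OF assms(1)] that
  unfolding is_dual_def by metis

lemma frame_iso_shadow_of_dual:
  assumes "left_handed_nc_frame A" "is_dual A L F"
  shows "frame_iso (commutative_shadow A) L"
proof -
  obtain f where d: "skew_closed A" "frame L" "sheaf (nuclei L) F" "sect F \<top>\<^bsub>nuclei L\<^esub> \<noteq> {}"
    "skew_iso A (dual_nc_frame L F) f" by (rule is_dualE [OF assms])
  interpret frame L by (rule d(2))
  show ?thesis
  proof (rule frame_iso_commutative_shadow [OF complete_lattice_axioms])
    show "shadow_map A L (fst \<circ> f)"
      by (rule shadow_map_comp [OF d(5,1) shadow_map_dual [OF d(3,4)]])
    fix x y assume xy: "x \<in> carrier A" "y \<in> carrier A"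
    obtain u s v t where p: "f x = (u, s)" "f y = (v, t)" by (cases "f x"; cases "f y")
    have "f (x \<curlywedge>\<^bsub>A\<^esub> y) = (u, s) \<curlywedge>\<^bsub>dual_nc_frame L F\<^esub> (v, t)"
      using d(5) xy p by (simp add: skew_iso_def)
    then show "x \<curlywedge>\<^bsub>A\<^esub> y \<in> carrier A \<and> (fst \<circ> f) (x \<curlywedge>\<^bsub>A\<^esub> y) = (fst \<circ> f) x \<sqinter>\<^bsub>L\<^esub> (fst \<circ> f) y"
      using d(1) xy p by (simp add: skew_closed_def meet_dual)
  qed
qed

lemma spatial_locale_pt:
  assumes "frame L" "frame_iso L (opens X)"
  shows "spatial_locale TYPE('l set) (L :: 'l gorder)"
  using frame.frame_iso_pt(1) [OF assms] unfolding spatial_locale_def by blast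

text \<open>The isomorphism is the composite \<open>A \<cong> dual(L, F) \<cong> dual(L, k\<^sub>* E) \<cong> H(pt L, E)\<close>.\<close>

lemma nc_frame_iso_H_of_direct_image:
  fixes L :: "'l gorder" and E :: "('l set set, 't) presheaf"
  assumes "left_handed_nc_frame A" "is_dual A L F" and sp: "spatial_locale TYPE('p) L"
    and E: "sheaf (opens (front_topology (pt L))) E"
    and iso: "sheaf_iso (nuclei L) F (direct_image (k_map L) E)"
  shows "nc_frame_iso A (H (pt L) E)" and "sect E (topspace (pt L)) \<noteq> {}"
proof -
  obtain f where d: "skew_closed A" "frame L" "sheaf (nuclei L) F" "sect F \<top>\<^bsub>nuclei L\<^esub> \<noteq> {}"
    "skew_iso A (dual_nc_frame L F) f" by (rule is_dualE [OF assms(1,2)])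
  interpret frame L by (rule d(2))
  obtain X :: "'p topology" where X: "frame_iso L (opens X)"
    using sp unfolding spatial_locale_def by blast
  have "sheaf (nuclei L) (direct_image (k_map L) E)"
    by (rule sheaf_direct_image [OF complete_lattice_nuclei complete_lattice_opens frame_hom_k_map E])
  then obtain g where g: "skew_iso (dual_nc_frame L F) (dual_nc_frame L (direct_image (k_map L) E)) g"
    using skew_iso_of_sheaf_iso [OF d(3) _ iso] by blast
  have "skew_iso (dual_nc_frame L (direct_image (k_map L) E)) (H (pt L) E) (\<lambda>(u, s). (pt_open L u, s))"
    by (rule skew_iso_dual_H [OF frame_hom_pt_open frame_iso_pt(2) [OF X] frame_hom_k_map k_map_nu])
  then show "nc_frame_iso A (H (pt L) E)"
    unfolding nc_frame_iso_iff_skew_iso [OF d(1)]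
    by (intro exI) (rule skew_iso_trans [OF skew_iso_trans [OF d(5) g]])
  obtain \<phi> where "bij_betw \<phi> (sect F \<top>\<^bsub>nuclei L\<^esub>) (sect (direct_image (k_map L) E) \<top>\<^bsub>nuclei L\<^esub>)"
    using iso N.top_closed unfolding sheaf_iso_def by blast
  moreover have "k_map L \<top>\<^bsub>nuclei L\<^esub> = topspace (pt L)"
    using frame_hom_k_map by (simp add: frame_hom_def top_opens)
  ultimately show "sect E (topspace (pt L)) \<noteq> {}"
    using d(4) by (auto simp: direct_image_def bij_betw_def)
qed

text \<open>The space \<open>X\<close> need not be \<open>pt L\<close>, nor sober, and \<open>E\<close> may have sections of another type than \<open>F\<close>. The former
  is repaired by pushing \<open>E\<close> forward along the map to \<open>pt L\<close>, the latter by renaming its sections.\<close>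

lemma direct_image_of_spatial:
  fixes L :: "'l gorder" and F :: "('l \<Rightarrow> 'l, 's) presheaf"
    and X :: "'p topology" and E :: "('p set, 't) presheaf"
  assumes "left_handed_nc_frame A" "is_dual A L F"
    and E: "sheaf (opens (front_topology X)) E" and Ene: "sect E (topspace X) \<noteq> {}"
    and iso: "nc_frame_iso A (H X E)"
  shows "frame_iso L (opens X)"
    and "\<exists>E' :: ('l set set, 's) presheaf. sheaf (opens (front_topology (pt L))) E' \<and>
      sheaf_iso (nuclei L) F (direct_image (k_map L) E')"
proof -
  obtain f where d: "skew_closed A" "frame L" "sheaf (nuclei L) F" "sect F \<top>\<^bsub>nuclei L\<^esub> \<noteq> {}"
    "skew_iso A (dual_nc_frame L F) f" by (rule is_dualE [OF assms(1,2)])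
  interpret frame L by (rule d(2))
  let ?D = "dual_nc_frame L F"
  obtain g where "skew_iso A (H X E) g"
    using iso nc_frame_iso_iff_skew_iso [OF d(1)] by blast
  then obtain h where h: "skew_iso ?D (H X E) h"
    using skew_iso_trans [OF skew_iso_sym [OF d(5,1)]] by blast
  note Dc = skew_closed_dual [OF d(3)]
  obtain \<phi> where \<phi>: "frame_hom L (opens X) \<phi>" "bij_betw \<phi> (carrier L) (carrier (opens X))"
    "\<And>x. x \<in> carrier ?D \<Longrightarrow> \<phi> (fst x) = (fst \<circ> h) x" "frame_iso L (opens X)"
    by (rule shadow_map_unique [OF complete_lattice_axioms complete_lattice_opens
          shadow_map_dual [OF d(3,4)] shadow_map_comp [OF h Dc shadow_map_H [OF E Ene]]]) blast
  show "frame_iso L (opens X)" by (rule \<phi>(4))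
  let ?\<eta> = "\<lambda>S. {x \<in> topspace X. filter_of_point \<phi> x \<in> S}"
  note \<eta>k = frame_hom_filter_of_point_k_map [OF \<phi>(1)]
  let ?G = "direct_image (?\<eta> \<circ> k_map L) E"
  have G: "sheaf (nuclei L) ?G"
    by (rule sheaf_direct_image [OF complete_lattice_nuclei complete_lattice_opens \<eta>k(1) E])
  let ?p = "\<lambda>(u, s). (\<phi> u, s)"
  have p: "skew_iso (dual_nc_frame L ?G) (H X E) ?p"
    by (rule skew_iso_dual_H [OF \<phi>(1,2) \<eta>k])
  let ?q = "inv_into (carrier (dual_nc_frame L ?G)) ?p"
  have q: "skew_iso (H X E) (dual_nc_frame L ?G) ?q"
    by (rule skew_iso_sym [OF p skew_closed_dual [OF G]])
  have "sheaf_iso (nuclei L) F ?G"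
  proof (rule sheaf_iso_of_skew_iso [OF d(3) G d(4) skew_iso_trans [OF h q]])
    fix x assume x: "x \<in> carrier ?D"
    let ?z = "?q (h x)"
    have hx: "h x \<in> carrier (H X E)" by (rule skew_iso_closed [OF h x])
    have z: "?z \<in> carrier (dual_nc_frame L ?G)" by (rule skew_iso_closed [OF q hx])
    have pz: "?p ?z = h x"
      by (rule bij_betw_inv_into_right [OF skew_iso_bij [OF p] hx])
    have "\<phi> (fst ?z) = fst (?p ?z)" by (simp add: case_prod_beta)
    also have "\<dots> = \<phi> (fst x)" using \<phi>(3) [OF x] by (simp only: pz comp_apply)
    finally have "\<phi> (fst ?z) = \<phi> (fst x)" .
    moreover have "fst ?z \<in> carrier L" "fst x \<in> carrier L"
      using x z carrier_dual [of "fst ?z" "snd ?z"] carrier_dual [of "fst x" "snd x"] by simp_all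
    ultimately show "fst ((?q \<circ> h) x) = fst x"
      using \<phi>(2) by (simp add: bij_betw_def inj_on_def)
  qed
  then have iso1: "sheaf_iso (nuclei L) F (direct_image (k_map L) (direct_image ?\<eta> E))"
    by (simp add: direct_image_comp)
  let ?O = "opens (front_topology (pt L))" and ?E = "direct_image ?\<eta> E"
  have E1: "sheaf ?O ?E"
    by (rule sheaf_direct_image [OF complete_lattice_opens complete_lattice_opens
          frame_hom_filter_of_point [OF \<phi>(1)] E])
  obtain \<psi> where \<psi>: "\<And>n. n \<in> carrier (nuclei L) \<Longrightarrow>
      bij_betw (\<psi> n) (sect F n) (sect (direct_image (k_map L) ?E) n)"
    using iso1 unfolding sheaf_iso_def by blast
  \<comment> \<open>The sections of the pushed forward sheaf over \<open>W = k n\<close> are in bijection with \<open>F n\<close>, and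
    one such \<open>n\<close> is chosen for each \<open>W\<close>.\<close>
  have "\<forall>W. \<exists>n. openin (front_topology (pt L)) W \<longrightarrow> n \<in> carrier (nuclei L) \<and> k_map L n = W"
    using k_map_surj by metis
  then obtain n where n: "\<And>W. openin (front_topology (pt L)) W \<Longrightarrow> n W \<in> carrier (nuclei L) \<and> k_map L (n W) = W"
    by metis
  let ?T = "transported_presheaf (\<lambda>W. sect F (n W)) (\<lambda>W. \<psi> (n W)) ?E"
  have b: "bij_betw (\<psi> (n W)) (sect F (n W)) (sect ?E W)" if "W \<in> carrier ?O" for W
    using \<psi> [of "n W"] n [of W] that by (simp add: carrier_opens direct_image_def)
  have "sheaf ?O ?T" by (rule sheaf_transported [OF complete_lattice_opens E1 b])
  moreover have "sheaf_iso (nuclei L) F (direct_image (k_map L) ?T)"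
    using sheaf_iso_trans [OF iso1 sheaf_iso_direct_image [OF complete_lattice_nuclei complete_lattice_opens
          frame_hom_k_map sheaf_iso_transported [OF complete_lattice_opens E1 b]]] .
  ultimately show "\<exists>E' :: ('l set set, 's) presheaf. sheaf (opens (front_topology (pt L))) E' \<and>
      sheaf_iso (nuclei L) F (direct_image (k_map L) E')" by blast
qed

lemma spatial_imp_direct_image:
  fixes L :: "'l gorder" and F :: "('l \<Rightarrow> 'l, 's) presheaf"
  assumes "left_handed_nc_frame A" "is_dual A L F" and sp: "spatial TYPE('p) TYPE('t) A"
  shows "spatial_locale TYPE('l set) L \<and>
    (\<exists>E :: ('l set set, 's) presheaf. sheaf (opens (front_topology (pt L))) E \<and>
      sheaf_iso (nuclei L) F (direct_image (k_map L) E))"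
proof -
  have L: "frame L" using assms(2) by (simp add: is_dual_def)
  obtain X :: "'p topology" and E :: "('p set, 't) presheaf"
    where XE: "sheaf (opens (front_topology X)) E" "sect E (topspace X) \<noteq> {}" "nc_frame_iso A (H X E)"
    using sp unfolding spatial_def by blast
  show ?thesis
    using direct_image_of_spatial [OF assms(1,2) XE] spatial_locale_pt [OF L] by blast
qed

theorem proposition6p11:
  fixes A :: "'a skew_lattice" and L :: "'l gorder" and F :: "('l \<Rightarrow> 'l, 's) presheaf"
  assumes "left_handed_nc_frame A" and "is_dual A L F"
  shows "frame_iso (commutative_shadow A) L \<and>
    (spatial TYPE('l set) TYPE('s) A \<longleftrightarrow>
       spatial_locale TYPE('l set) L \<and>
       (\<exists>E :: ('l set set, 's) presheaf. sheaf (opens (front_topology (pt L))) E \<and>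
          sheaf_iso (nuclei L) F (direct_image (k_map L) E))) \<and>
    (\<forall>E :: ('l set set, 't) presheaf.
       spatial_locale TYPE('l set) L \<and> sheaf (opens (front_topology (pt L))) E \<and>
       sheaf_iso (nuclei L) F (direct_image (k_map L) E) \<longrightarrow> nc_frame_iso A (H (pt L) E)) \<and>
    (spatial TYPE('p) TYPE('t) A \<longrightarrow> spatial TYPE('l set) TYPE('s) A) \<and>
    (spatial_locale TYPE('p) L \<longrightarrow> spatial_locale TYPE('l set) L)"
proof -
  have L: "frame L" using assms(2) by (simp add: is_dual_def)
  have spatial: "spatial TYPE('l set) TYPE('s) A"
    if "spatial_locale TYPE('l set) L" "sheaf (opens (front_topology (pt L))) E"
      "sheaf_iso (nuclei L) F (direct_image (k_map L) E)" for E :: "('l set set, 's) presheaf"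
    unfolding spatial_def using nc_frame_iso_H_of_direct_image [OF assms that] that(2) by blast
  have "frame_iso (commutative_shadow A) L" by (rule frame_iso_shadow_of_dual [OF assms])
  moreover have "spatial TYPE('l set) TYPE('s) A \<longleftrightarrow> spatial_locale TYPE('l set) L \<and>
       (\<exists>E :: ('l set set, 's) presheaf. sheaf (opens (front_topology (pt L))) E \<and>
          sheaf_iso (nuclei L) F (direct_image (k_map L) E))"
    using spatial spatial_imp_direct_image [OF assms] by blast
  moreover have "nc_frame_iso A (H (pt L) E)"
    if "spatial_locale TYPE('l set) L" "sheaf (opens (front_topology (pt L))) E"
      "sheaf_iso (nuclei L) F (direct_image (k_map L) E)" for E :: "('l set set, 't) presheaf"
    by (rule nc_frame_iso_H_of_direct_image [OF assms that])
  moreover have "spatial TYPE('l set) TYPE('s) A" if "spatial TYPE('p) TYPE('t) A"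
    using spatial spatial_imp_direct_image [OF assms that] by blast
  moreover have "spatial_locale TYPE('l set) L" if "spatial_locale TYPE('p) L"
    using that spatial_locale_pt [OF L] unfolding spatial_locale_def by blast
  ultimately show ?thesis by blast
qed

end
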